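(* Let $\Omega=(a,b)$ be a bounded interval, let $\lambda>0$, and assume that $K:[0,\infty)\to[0,\infty)$ satisfies (K1), (K2) and (K3). Assume that $g\in C[a,b]$ is non-decreasing (resp. non-increasing). Let $M>0$ be such that $M\ge \max_{[a,b]}g-\min_{[a,b]}g=|g(b)-g(a)|$. Let $U\in BV(a,b)$ be a minimizer of $TV_{Kg}$ over $BV(a,b)$. Then $U$ must be a non-decreasing (resp. non-increasing) piecewise constant function (with finitely many jumps) satisfying $\inf g\le U\le \sup g$ on $[a,b]$. Moreover, the number $m$ of jumps of $U$ satisfies $$m\le\left[\frac{(b-a)\lambda}{2C_M}\right]+1,$$ where $C_M$ is the constant in (K2) and $[r]$ denotes the integer part of $r\ge0$.
   Context: Conditions on $K$: (K1) $K$ is lower semicontinuous and non-decreasing with $K(0)=0$. (K2) For any $M>0$ there exists a constant $C_M>0$ such that $K(\rho_1)+K(\rho_2)\ge K(\rho_1+\rho_2)+C_M\rho_1\rho_2$ for all $\rho_1,\rho_2\ge0$ with $\rho_1+\rho_2\le M$. (K3) $\lim_{\rho\to0}K(\rho)/\rho=1$. For $u\in BV(\Omega)$, $\Omega=(a,b)$, with distributional derivative $Du$, jump set $J_u$ and one-sided limits $u^\pm$ at points of $J_u$, set $$TV_K(u)=\int_{\Omega\setminus J_u}|Du|+\sum_{x\in J_u}K(|u^+(x)-u^-(x)|),\qquad TV_{Kg}(u)=TV_K(u)+\frac{\lambda}{2}\int_\Omega|u-g|^2\,dx.$$ Functions in $BV$ are identified when equal almost everywhere; pointwise properties of $U$ refer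 to a suitable representative. *)

theory Defs
  imports "HOL-Analysis.Analysis"
begin

section \<open>The space BV(a,b)\<close>

definition smooth :: "(real \<Rightarrow> real) \<Rightarrow> bool" where
  "smooth \<phi> \<longleftrightarrow> (\<forall>n x. (deriv ^^ n) \<phi> differentiable (at x))"

definition test_fun :: "real \<Rightarrow> real \<Rightarrow> (real \<Rightarrow> real) \<Rightarrow> bool" where
  "test_fun a b \<phi> \<longleftrightarrow> smooth \<phi> \<and> compact (closure {x. \<phi> x \<noteq> 0})
     \<and> closure {x. \<phi> x \<noteq> 0} \<subseteq> {a<..<b}"

text \<open>
  A finite signed Borel measure on $(a,b)$ is given by its Jordan decomposition: the pair \<open>(P, N)\<close>
  of mutually singular finite measures stands for \<open>P - N\<close>, and its total variation measure is
  \<open>P + N\<close>. The last clause says that \<open>P - N\<close> is the distributional derivative of \<open>u\<close>.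
\<close>

definition has_deriv_measure ::
    "real \<Rightarrow> real \<Rightarrow> (real \<Rightarrow> real) \<Rightarrow> real measure \<times> real measure \<Rightarrow> bool" where
  "has_deriv_measure a b u = (\<lambda>(P, N).
     finite_measure P \<and> finite_measure N \<and>
     sets P = sets (restrict_space borel {a<..<b}) \<and>
     sets N = sets (restrict_space borel {a<..<b}) \<and>
     (\<exists>A\<in>sets P. emeasure P ({a<..<b} - A) = 0 \<and> emeasure N A = 0) \<and>
     (\<forall>\<phi>. test_fun a b \<phi> \<longrightarrow>
        (LINT x:{a<..<b}|lebesgue. u x * deriv \<phi> x)
          = - (integral\<^sup>L P \<phi> - integral\<^sup>L N \<phi>)))"

text \<open>
  Functions are total on \<open>real\<close>, but only their values on $(a,b)$ up to null sets matter in what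
  follows; equivalence classes are represented by their elements.
\<close>

definition BV :: "real \<Rightarrow> real \<Rightarrow> (real \<Rightarrow> real) set" where
  "BV a b = {u. u absolutely_integrable_on {a<..<b} \<and> (\<exists>D. has_deriv_measure a b u D)}"

text \<open>For \<open>u \<in> BV a b\<close> the pair \<open>D\<close> is unique.\<close>

definition deriv_measure :: "real \<Rightarrow> real \<Rightarrow> (real \<Rightarrow> real) \<Rightarrow> real measure \<times> real measure" where
  "deriv_measure a b u = (SOME D. has_deriv_measure a b u D)"

definition abs_deriv :: "real \<Rightarrow> real \<Rightarrow> (real \<Rightarrow> real) \<Rightarrow> real set \<Rightarrow> ennreal" where
  "abs_deriv a b u A = (case deriv_measure a b u of (P, N) \<Rightarrow> emeasure P A + emeasure N A)"

text \<open>
  One-sided limits are taken modulo null sets, hence do not depend on the representative: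
  \<open>u \<longlongrightarrow> l\<close> along the filter \<open>ess_right x\<close> means that \<open>u y \<longlongrightarrow> l\<close> as \<open>y\<close> decreases to \<open>x\<close> outside
  some null set.
\<close>

definition ess_left :: "real \<Rightarrow> real filter" where
  "ess_left x = inf (at_left x) (ae_filter lebesgue)"

definition ess_right :: "real \<Rightarrow> real filter" where
  "ess_right x = inf (at_right x) (ae_filter lebesgue)"

definition jump_set :: "real \<Rightarrow> real \<Rightarrow> (real \<Rightarrow> real) \<Rightarrow> real set" where
  "jump_set a b u = {x \<in> {a<..<b}.
     \<exists>l r. (u \<longlongrightarrow> l) (ess_left x) \<and> (u \<longlongrightarrow> r) (ess_right x) \<and> l \<noteq> r}"

definition jump_size :: "(real \<Rightarrow> real) \<Rightarrow> real \<Rightarrow> real" where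
  "jump_size u x = \<bar>Lim (ess_right x) u - Lim (ess_left x) u\<bar>"


section \<open>The functionals\<close>

text \<open>The values are extended nonnegative reals, so that no divergent sum or integral is read as $0$.\<close>

definition TV_K :: "(real \<Rightarrow> real) \<Rightarrow> real \<Rightarrow> real \<Rightarrow> (real \<Rightarrow> real) \<Rightarrow> ennreal" where
  "TV_K K a b u = abs_deriv a b u ({a<..<b} - jump_set a b u)
     + (\<Sum>\<^sub>\<infinity>x\<in>jump_set a b u. ennreal (K (jump_size u x)))"

definition TV_Kg ::
    "(real \<Rightarrow> real) \<Rightarrow> real \<Rightarrow> (real \<Rightarrow> real) \<Rightarrow> real \<Rightarrow> real \<Rightarrow> (real \<Rightarrow> real) \<Rightarrow> ennreal" where
  "TV_Kg K lam g a b u = TV_K K a b u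
     + ennreal (lam / 2) * (\<integral>\<^sup>+x\<in>{a<..<b}. ennreal (\<bar>u x - g x\<bar>\<^sup>2) \<partial>lebesgue)"


section \<open>Conditions on \<open>K\<close>\<close>

text \<open>\<open>K\<close> is a function on $[0,\infty)$; its values at negative arguments are irrelevant.\<close>

definition lower_semicontinuous_on :: "real set \<Rightarrow> (real \<Rightarrow> real) \<Rightarrow> bool" where
  "lower_semicontinuous_on S f \<longleftrightarrow> (\<forall>x\<in>S. \<forall>c<f x. \<forall>\<^sub>F y in at x within S. c < f y)"

definition K1 :: "(real \<Rightarrow> real) \<Rightarrow> bool" where
  "K1 K \<longleftrightarrow> lower_semicontinuous_on {0..} K \<and> mono_on {0..} K \<and> K 0 = 0"

text \<open>\<open>C M\<close> is the constant $C_M$.\<close>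

definition K2 :: "(real \<Rightarrow> real) \<Rightarrow> (real \<Rightarrow> real) \<Rightarrow> bool" where
  "K2 K C \<longleftrightarrow> (\<forall>M>0. C M > 0 \<and>
     (\<forall>\<rho>\<^sub>1\<ge>0. \<forall>\<rho>\<^sub>2\<ge>0. \<rho>\<^sub>1 + \<rho>\<^sub>2 \<le> M \<longrightarrow> K \<rho>\<^sub>1 + K \<rho>\<^sub>2 \<ge> K (\<rho>\<^sub>1 + \<rho>\<^sub>2) + C M * \<rho>\<^sub>1 * \<rho>\<^sub>2))"

definition K3 :: "(real \<Rightarrow> real) \<Rightarrow> bool" where
  "K3 K \<longleftrightarrow> ((\<lambda>\<rho>. K \<rho> / \<rho>) \<longlongrightarrow> 1) (at_right 0)"


section \<open>Piecewise constant functions\<close>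

text \<open>The break points are interior, so \<open>f\<close> is constant up to the end points of the interval.\<close>

definition piecewise_constant_on :: "real \<Rightarrow> real \<Rightarrow> (real \<Rightarrow> real) \<Rightarrow> bool" where
  "piecewise_constant_on a b f \<longleftrightarrow>
     (\<exists>F. finite F \<and> F \<subseteq> {a<..<b} \<and> (\<forall>I\<in>components ({a..b} - F). f constant_on I))"

end

(*
  A function in BV(a,b) has a right-continuous representative w = c + P(-oo,x] - N(-oo,x] with P - N its
  derivative (du Bois-Reymond lemma), and TV_K depends only on |Dw| = P + N, monotonically.

  Let g be increasing. Truncating w at the levels g(a), g(b), or at a level l on one side of a point where
  w falls across l, does not increase |Dw| and brings w closer to g; hence a minimizer is increasing and
  takes values between g(a) and g(b). For [k,d] inside (a,b) and k <= x < d replace w on [k,d] by a single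
  jump, placed so that the mean over [k,d] is preserved. By (K2) the variation term drops by at least
  C_M Dw[k,x] Dw(x,d], while the fidelity term grows by at most (lam/2) (d-k) sup_z Dw[k,z] Dw(z,d].
  If d - k < 2 C_M / lam, the supremum must vanish, so Dw is carried by at most one point of [k,d]. Thus w
  is piecewise constant and its jumps are at distance at least 2 C_M / lam from each other.
*)
theory Submission
  imports Defs "HOL-Probability.Distribution_Functions" "HOL-Computational_Algebra.Polynomial"
begin

section \<open>Test functions and the lemma of du Bois-Reymond\<close>

text \<open>The absolutely continuous, Cantor and jump parts of Dw are never separated. Collapsing
  all mass of a set into one jump costs at most the energy of that set: subadditivity of K handles
  the atoms, and K(r) \<le> r, a consequence of subadditivity and (K3), handles the rest. The
  product Dw[k,x] Dw(x,d] occurs in two roles: as the gain from (K2) at one freely chosen split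
  point, and as the integrand of the fidelity loss. The gain is thus available at the worst point,
  while the loss is an integral over a short interval. Preserving the mean is what makes the loss
  comparable to this product: otherwise a term with a constant factor times v - w would survive,
  which the product does not control. An obstacle is that |Du| is read off a mutually singular pair,
  whereas competitors come with pairs that usually are not. Cancellation only lowers the energy, so
  an upper bound suffices for competitors, while equality holds for the minimizer. The bound on m
  counts gaps: m points of (a,b) leave m - 1 gaps of length at least 2 C_M / lam.\<close>

lemma smooth_has_real_derivative: "smooth f \<Longrightarrow> (f has_real_derivative deriv f x) (at x)"
  unfolding smooth_def by (metis DERIV_deriv_iff_real_differentiable funpow_0)

lemma smooth_deriv: "smooth f \<Longrightarrow> smooth (deriv f)"
  unfolding smooth_def by (metis funpow_Suc_right o_apply)

text \<open>A direct induction on the order of the derivative would need a formula for every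
  iterate. An invariant class \<open>S\<close> avoids this: each smoothness proof below only has to
  exhibit a suitable \<open>S\<close>.\<close>

lemma smooth_coinduct:
  assumes "S f" "\<And>f x. S f \<Longrightarrow> f differentiable (at x)" "\<And>f. S f \<Longrightarrow> S (deriv f)"
  shows "smooth f"
proof -
  have "S ((deriv ^^ n) f)" for n
    by (induction n) (auto intro: assms)
  then show ?thesis
    using assms(2) unfolding smooth_def by blast
qed

lemma deriv_fun_eqI: "(\<And>x. (f has_real_derivative f' x) (at x)) \<Longrightarrow> deriv f = f'"
  using DERIV_imp_deriv by blast

lemma smooth_of_smooth_derivative:
  assumes "\<And>x. (f has_real_derivative f' x) (at x)" "smooth f'"
  shows "smooth f"
proof (rule smooth_coinduct[where S = "\<lambda>h. h = f \<or> smooth h"])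
  show "h differentiable at x" if "h = f \<or> smooth h" for h x
    using that assms(1) smooth_has_real_derivative real_differentiable_def by blast
  show "deriv h = f \<or> smooth (deriv h)" if "h = f \<or> smooth h" for h
    using that deriv_fun_eqI[OF assms(1)] assms(2) smooth_deriv by metis
qed simp

text \<open>The Leibniz rule turns a product into a sum of products, so products of smooth functions
  alone are not visibly closed under \<open>deriv\<close>. The class generated by sums and products
  is, and \<open>smooth_alg_iff\<close> shows that it is no larger than
  \<open>smooth\<close>.\<close>

inductive smooth_alg :: "(real \<Rightarrow> real) \<Rightarrow> bool" where
  base: "smooth f \<Longrightarrow> smooth_alg f"
| add: "smooth_alg f \<Longrightarrow> smooth_alg g \<Longrightarrow> smooth_alg (\<lambda>x. f x + g x)"
| mult: "smooth_alg f \<Longrightarrow> smooth_alg g \<Longrightarrow> smooth_alg (\<lambda>x. f x * g x)"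

lemma smooth_alg_deriv:
  "smooth_alg f \<Longrightarrow> (\<forall>x. f differentiable (at x)) \<and> smooth_alg (deriv f)"
proof (induction rule: smooth_alg.induct)
  case (base f)
  then show ?case
    by (auto intro: smooth_alg.base smooth_deriv simp: real_differentiable_def
        dest: smooth_has_real_derivative)
next
  case (add f g)
  then have "deriv (\<lambda>x. f x + g x) = (\<lambda>x. deriv f x + deriv g x)"
    by (intro deriv_fun_eqI derivative_intros) (simp_all add: DERIV_deriv_iff_real_differentiable)
  with add show ?case by (auto intro: smooth_alg.add)
next
  case (mult f g)
  then have "deriv (\<lambda>x. f x * g x) = (\<lambda>x. deriv f x * g x + deriv g x * f x)"
    by (intro deriv_fun_eqI DERIV_mult) (simp_all add: DERIV_deriv_iff_real_differentiable)
  with mult show ?case by (auto intro!: smooth_alg.add smooth_alg.mult)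
qed

lemma smooth_alg_iff: "smooth_alg f \<longleftrightarrow> smooth f"
  using smooth_coinduct[of smooth_alg f] smooth_alg_deriv smooth_alg.base by blast

lemma smooth_add: "smooth f \<Longrightarrow> smooth g \<Longrightarrow> smooth (\<lambda>x. f x + g x)"
  and smooth_mult: "smooth f \<Longrightarrow> smooth g \<Longrightarrow> smooth (\<lambda>x. f x * g x)"
  unfolding smooth_alg_iff[symmetric] by (auto intro: smooth_alg.intros)

lemma smooth_const: "smooth (\<lambda>x. k)"
proof (rule smooth_coinduct[where S = "\<lambda>h. \<exists>k. h = (\<lambda>x. k)"])
  show "\<exists>k. deriv h = (\<lambda>x. k)" if "\<exists>k. h = (\<lambda>x. k)" for h :: "real \<Rightarrow> real"
    using that by (auto intro!: exI[of _ 0] deriv_fun_eqI)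
qed auto

lemma smooth_affine:
  assumes "smooth f" shows "smooth (\<lambda>x. f (m * x + d))"
\<comment> \<open>The factor \<open>k\<close> collects the powers of \<open>m\<close> that the chain
  rule produces.\<close>
proof (rule smooth_coinduct[where S = "\<lambda>h. \<exists>f k. smooth f \<and> h = (\<lambda>x. k * f (m * x + d))"])
  have D: "((\<lambda>x. k * f (m * x + d)) has_real_derivative (k * m * deriv f (m * x + d))) (at x)"
    if "smooth f" for f k x
    using smooth_has_real_derivative[OF that, of "m * x + d"]
    by (auto intro!: derivative_eq_intros DERIV_chain2[where f = f])
  show "h differentiable at x" if "\<exists>f k. smooth f \<and> h = (\<lambda>x. k * f (m * x + d))" for h x
    using that D real_differentiable_def by blast
  show "\<exists>f k. smooth f \<and> deriv h = (\<lambda>x. k * f (m * x + d))"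
    if "\<exists>f k. smooth f \<and> h = (\<lambda>x. k * f (m * x + d))" for h
    using that deriv_fun_eqI[OF D] smooth_deriv by blast
  show "\<exists>f' k. smooth f' \<and> (\<lambda>x. f (m * x + d)) = (\<lambda>x. k * f' (m * x + d))"
    using assms by (intro exI[of _ f] exI[of _ 1]) auto
qed

section \<open>A smooth function vanishing on a half-line, and bumps built from it\<close>

definition flat :: "real poly \<Rightarrow> real \<Rightarrow> real" where
  "flat p x = (if x > 0 then poly p (1 / x) * exp (- (1 / x)) else 0)"

lemma poly_times_exp_tendsto_0: "((\<lambda>y::real. poly p y * exp (- y)) \<longlongrightarrow> 0) at_top"
proof -
  have "((\<lambda>y. \<Sum>i\<le>degree p. coeff p i * (y ^ i / exp y)) \<longlongrightarrow> (\<Sum>i\<le>degree p. coeff p i * 0)) at_top"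
    by (intro tendsto_intros tendsto_power_div_exp_0)
  then show ?thesis
    by (simp add: poly_altdef exp_minus sum_distrib_right divide_inverse mult.assoc)
qed

lemma flat_tendsto_0: "(flat p \<longlongrightarrow> 0) (at 0)"
proof -
  have "((\<lambda>x. poly p (inverse x) * exp (- inverse x)) \<longlongrightarrow> 0) (at_right 0)"
    using filterlim_compose[OF poly_times_exp_tendsto_0 filterlim_inverse_at_top_right] .
  then have "(flat p \<longlongrightarrow> 0) (at_right 0)"
    by (rule Lim_transform_eventually)
      (auto simp: flat_def eventually_at_filter field_simps)
  moreover have "(flat p \<longlongrightarrow> 0) (at_left 0)"
    by (rule tendsto_eventually) (auto simp: flat_def eventually_at_filter)
  ultimately show ?thesis
    by (simp add: filterlim_at_split)
qed

text \<open>With y = 1/x the derivative of p(y) exp(-y) is y^2 (p(y) - p'(y)) exp(-y), because dy/dx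
  = -y^2. This is why the family carries a polynomial: it becomes closed under \<open>deriv\<close>.
  At 0 the difference quotient is \<open>flat\<close> of the polynomial multiplied by its variable,
  which tends to 0.\<close>

lemma flat_has_real_derivative:
  "(flat p has_real_derivative flat (monom 1 2 * (p - pderiv p)) x) (at x)"
proof -
  consider "x > 0" | "x < 0" | "x = 0" by linarith
  then show ?thesis
  proof cases
    case 1
    have "((\<lambda>x. poly p (1 / x) * exp (- (1 / x))) has_real_derivative
        flat (monom 1 2 * (p - pderiv p)) x) (at x)"
      using 1 by (auto intro!: derivative_eq_intros simp: flat_def poly_monom field_simps power2_eq_square)
    then show ?thesis
      by (rule DERIV_cong_ev[THEN iffD1, rotated -1])
        (use 1 eventually_nhds_in_open[of "{0<..}" x] in \<open>auto simp: flat_def elim: eventually_mono\<close>)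
  next
    case 2
    have "((\<lambda>x. 0) has_real_derivative flat (monom 1 2 * (p - pderiv p)) x) (at x)"
      using 2 by (simp add: flat_def)
    then show ?thesis
      by (rule DERIV_cong_ev[THEN iffD1, rotated -1])
        (use 2 eventually_nhds_in_open[of "{..<0}" x] in \<open>auto simp: flat_def elim: eventually_mono\<close>)
  next
    case 3
    have "((\<lambda>h. (flat p (0 + h) - flat p 0) / h) \<longlongrightarrow> 0) (at 0)"
      by (rule Lim_transform_eventually[OF flat_tendsto_0[of "monom 1 1 * p"]])
        (auto simp: flat_def poly_monom eventually_at_filter)
    then show ?thesis
      using 3 by (simp add: DERIV_def flat_def)
  qed
qed

lemma smooth_flat: "smooth (flat p)"
proof (rule smooth_coinduct[where S = "\<lambda>h. \<exists>p. h = flat p"])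
  show "h differentiable at x" if "\<exists>p. h = flat p" for h x
    using that flat_has_real_derivative real_differentiable_def by blast
  show "\<exists>p. deriv h = flat p" if "\<exists>p. h = flat p" for h
    using that deriv_fun_eqI[OF flat_has_real_derivative] by blast
qed auto

text \<open>Two copies of exp(-1/x) face each other from \<open>s\<close> and \<open>t\<close>. The
  dilation by \<open>Suc n\<close> sends both factors to 1 inside the interval, so the bumps
  approximate the indicator of the open interval from below.\<close>

definition bump :: "real \<Rightarrow> real \<Rightarrow> nat \<Rightarrow> real \<Rightarrow> real" where
  "bump s t n x = flat 1 (real (Suc n) * (x - s)) * flat 1 (real (Suc n) * (t - x))"

lemma smooth_bump: "smooth (bump s t n)"
proof -
  have "smooth (\<lambda>x. flat 1 (real (Suc n) * x + - (real (Suc n) * s)) * flat 1 (- real (Suc n) * x + real (Suc n) * t))"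
    by (intro smooth_mult smooth_affine smooth_flat)
  then show ?thesis
    by (simp add: bump_def[abs_def] algebra_simps)
qed

lemma bump_eq_0_iff: "bump s t n x = 0 \<longleftrightarrow> x \<notin> {s<..<t}"
  by (auto simp: bump_def flat_def zero_less_mult_iff)

lemma bump_nonneg: "0 \<le> bump s t n x" and bump_le_1: "bump s t n x \<le> 1"
  unfolding bump_def by (auto simp: flat_def intro!: mult_le_one)

lemma bump_tendsto: "(\<lambda>n. bump s t n x) \<longlonglongrightarrow> indicator {s<..<t} x"
proof (cases "x \<in> {s<..<t}")
  case True
  have *: "(\<lambda>n. exp (- (1 / (real (Suc n) * r)))) \<longlonglongrightarrow> 1" if "r > 0" for r
  proof -
    have "(\<lambda>n. exp (- (inverse (real (Suc n)) * (1 / r)))) \<longlonglongrightarrow> exp (- (0 * (1 / r)))"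
      by (intro tendsto_intros LIMSEQ_inverse_real_of_nat)
    then show ?thesis by (simp add: field_simps)
  qed
  have "(\<lambda>n. exp (- (1 / (real (Suc n) * (x - s)))) * exp (- (1 / (real (Suc n) * (t - x))))) \<longlonglongrightarrow> 1 * 1"
    using True by (intro tendsto_mult *) auto
  moreover have "bump s t n x = exp (- (1 / (real (Suc n) * (x - s)))) * exp (- (1 / (real (Suc n) * (t - x))))" for n
    using True by (simp add: bump_def flat_def zero_less_mult_iff)
  ultimately show ?thesis
    using True by simp
next
  case False
  then show ?thesis
    using bump_eq_0_iff[of s t _ x] by simp
qed

lemma test_fun_iff:
  assumes "a < b"
  shows "test_fun a b \<phi> \<longleftrightarrow> smooth \<phi> \<and> (\<exists>s t. a < s \<and> s \<le> t \<and> t < b \<and> (\<forall>x. x \<notin> {s..t} \<longrightarrow> \<phi> x = 0))"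
    (is "_ \<longleftrightarrow> _ \<and> ?supp")
proof
  assume \<phi>: "test_fun a b \<phi>"
  define S where "S = closure {x. \<phi> x \<noteq> 0}"
  have S: "compact S" "S \<subseteq> {a<..<b}" "\<And>x. x \<notin> S \<Longrightarrow> \<phi> x = 0"
    using \<phi> closure_subset[of "{x. \<phi> x \<noteq> 0}"] by (auto simp: test_fun_def S_def)
  have ?supp
  \<comment> \<open>The zero function has empty support; \<open>a < b\<close> then supplies a point
    at which a degenerate interval with s = t can be placed.\<close>
  proof (cases "S = {}")
    case True
    then show ?thesis
      using S assms by (intro exI[of _ "(a + b) / 2"]) auto
  next
    case False
    obtain s where s: "s \<in> S" "\<forall>x\<in>S. s \<le> x"
      using compact_attains_inf[OF S(1) False] by blast
    obtain t where t: "t \<in> S" "\<forall>x\<in>S. x \<le> t"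
      using compact_attains_sup[OF S(1) False] by blast
    have "\<phi> x = 0" if "x \<notin> {s..t}" for x
      using that s t by (intro S(3)) auto
    then show ?thesis
      using S(2) s t by (intro exI[of _ s] exI[of _ t]) auto
  qed
  then show "smooth \<phi> \<and> ?supp"
    using \<phi> by (simp add: test_fun_def)
next
  assume *: "smooth \<phi> \<and> ?supp"
  then obtain s t where st: "a < s" "t < b" "\<And>x. x \<notin> {s..t} \<Longrightarrow> \<phi> x = 0"
    by blast
  have "closure {x. \<phi> x \<noteq> 0} \<subseteq> {s..t}"
    using st(3) by (intro closure_minimal) (blast, simp)
  moreover from this have "compact (closure {x. \<phi> x \<noteq> 0})"
    by (meson bounded_subset closed_closure compact_eq_bounded_closed compact_Icc)
  ultimately show "test_fun a b \<phi>"
    using * st(1,2) unfolding test_fun_def by fastforce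
qed

lemma test_funE:
  assumes "test_fun a b \<phi>" "a < b"
  obtains s t where "a < s" "s \<le> t" "t < b" "\<And>x. x \<notin> {s..t} \<Longrightarrow> \<phi> x = 0"
    "\<And>x. x \<notin> {s..t} \<Longrightarrow> deriv \<phi> x = 0"
proof -
  obtain s t where st: "a < s" "s \<le> t" "t < b" "\<And>x. x \<notin> {s..t} \<Longrightarrow> \<phi> x = 0"
    using assms by (auto simp: test_fun_iff)
  have "deriv \<phi> x = 0" if "x \<notin> {s..t}" for x
  proof -
    have "eventually (\<lambda>y. \<phi> y = 0) (nhds x)"
      using eventually_nhds_in_open[of "- {s..t}" x] that
      by (intro eventually_mono[OF _ st(4)]) (auto intro: open_Compl)
    then have "deriv \<phi> x = deriv (\<lambda>_. 0) x"
      by (intro deriv_cong_ev) auto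
    then show ?thesis by simp
  qed
  with st that show ?thesis by blast
qed

lemma smooth_continuous_on: "smooth f \<Longrightarrow> continuous_on A f"
  by (meson DERIV_isCont continuous_at_imp_continuous_on smooth_has_real_derivative)

lemma smooth_borel_measurable: "smooth f \<Longrightarrow> f \<in> borel_measurable borel"
  by (simp add: smooth_continuous_on borel_measurable_continuous_onI)

lemma test_fun_smooth: "test_fun a b \<phi> \<Longrightarrow> smooth \<phi>"
  by (simp add: test_fun_def)

lemma integrable_compact_support:
  fixes f :: "real \<Rightarrow> real"
  assumes "continuous_on UNIV f" "\<And>x. x \<notin> {s..t} \<Longrightarrow> f x = 0"
  shows "integrable lborel f"
proof -
  have "integrable lborel (\<lambda>x. f x * indicator {s..t} x)"
    using assms(1) by (intro borel_integrable_atLeastAtMost) (simp add: continuous_on_eq_continuous_at)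
  moreover have "(\<lambda>x. f x * indicator {s..t} x) = f"
    using assms(2) by (auto simp: fun_eq_iff indicator_def)
  ultimately show ?thesis by simp
qed

lemma smooth_bounded_of_support:
  assumes "smooth f" "\<And>x. x \<notin> {s..t} \<Longrightarrow> f x = 0"
  obtains B where "\<And>x. \<bar>f x\<bar> \<le> B"
proof -
  have "compact (f ` {s..t})"
    by (intro compact_continuous_image smooth_continuous_on assms) auto
  then obtain B where "\<forall>x\<in>{s..t}. norm (f x) \<le> B"
    by (auto dest!: compact_imp_bounded simp: bounded_iff)
  then have "\<bar>f x\<bar> \<le> max B 0" for x
    using assms(2)[of x] by (cases "x \<in> {s..t}") force+
  then show ?thesis using that by blast
qed

section \<open>Vanishing against all derivatives of test functions forces a constant\<close>

lemma not_AE_interval: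
  fixes s t :: real
  assumes "s < t" "AE x in lborel. x \<notin> {s<..<t}" shows False
proof -
  have "emeasure lborel {x \<in> space lborel. \<not> x \<notin> {s<..<t}} = 0"
    using assms(2) by (intro AE_E2) auto
  also have "{x \<in> space lborel. \<not> x \<notin> {s<..<t}} = {s<..<t}" by auto
  finally show False
    using assms(1) by simp
qed

text \<open>The Borel sets over which the integral of \<open>h\<close> vanishes form a Dynkin class,
  and the open intervals are a generator stable under intersection. Complements require the integral
  over the whole line, which is the limit over (-n, n).\<close>

lemma integral_eq_0_on_intervals_imp_AE_0:
  fixes h :: "real \<Rightarrow> real"
  assumes h: "integrable lborel h" and z: "\<And>s t. s < t \<Longrightarrow> (LINT x:{s<..<t}|lborel. h x) = 0"
  shows "AE x in lborel. h x = 0"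
proof (rule sigma_finite_measure.density_zero[OF sigma_finite_lborel h])
  have int: "set_integrable lborel A h" if "A \<in> sets borel" for A
    using integrable_mult_indicator[OF _ h] that unfolding set_integrable_def by simp
  have UNIV0: "(LINT x:UNIV|lborel. h x) = 0"
  proof -
    have "(\<lambda>n. LINT x:{-real n<..<real n}|lborel. h x) \<longlonglongrightarrow> (LINT x:(\<Union>n. {-real n<..<real n})|lborel. h x)"
      using int by (intro set_integral_cont_up) (auto simp: incseq_def)
    moreover have "(\<Union>n. {-real n<..<real n}) = UNIV"
    proof (intro equalityI subsetI UNIV_I)
      fix x :: real
      obtain n where "\<bar>x\<bar> < real n" using reals_Archimedean2 by blast
      then show "x \<in> (\<Union>n. {-real n<..<real n})" by (intro UN_I[of n]) auto
    qed
    moreover have "(LINT x:{-real n<..<real n}|lborel. h x) = 0" for n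
      using z[of "- real n" "real n"] by (cases "n = 0") (auto simp: set_lebesgue_integral_def)
    ultimately show ?thesis
      by (simp add: LIMSEQ_const_iff)
  qed
  fix A :: "real set" assume "A \<in> sets lborel"
  then have A: "A \<in> sigma_sets UNIV (range (\<lambda>(s, t). box s t))"
    by (simp add: borel_eq_box)
  have G: "Int_stable (range (\<lambda>(s, t). box s t :: real set))" "range (\<lambda>(s, t). box s t :: real set) \<subseteq> Pow UNIV"
    by (auto simp: Int_stable_def box_Int_box)
  from G A show "(LINT x:A|lborel. h x) = 0"
  proof (induction rule: sigma_sets_induct_disjoint)
    case (basic A)
    then obtain s t where "A = {s<..<t}" by (auto simp: box_real)
    then show ?case using z[of s t] by (cases "s < t") (auto simp: set_lebesgue_integral_def)
  next
    case (compl A)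
    then have "A \<in> sets borel" by (simp add: borel_eq_box)
    have "(LINT x:(A \<union> (UNIV - A))|lborel. h x) = (LINT x:A|lborel. h x) + (LINT x:(UNIV - A)|lborel. h x)"
      using \<open>A \<in> sets borel\<close> by (intro set_integral_Un int) auto
    then show ?case using compl UNIV0 by simp
  next
    case (union A)
    then have A: "A i \<in> sets borel" for i by (auto simp: borel_eq_box)
    show ?case
      using union(1,3) A
      by (subst lebesgue_integral_countable_add) (auto simp: disjoint_family_on_def intro!: int)
    qed (simp add: set_lebesgue_integral_def)
qed

text \<open>A smooth function with integral zero and compact support in (a, b) is the derivative of
  a test function. Subtracting from a bump the right multiple of one fixed bump produces such
  functions, so \<open>h\<close> and a constant have the same integral against every bump; the
  constant is the mean of \<open>h\<close> weighted by the fixed bump.\<close>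

lemma du_bois_reymond:
  fixes h :: "real \<Rightarrow> real"
  assumes ab: "a < b" and h: "integrable lborel h"
    and z: "\<And>\<phi>. test_fun a b \<phi> \<Longrightarrow> (LINT x|lborel. h x * deriv \<phi> x) = 0"
  obtains k where "AE x in lborel. x \<in> {a<..<b} \<longrightarrow> h x = k"
proof -
  have bump_cont: "continuous_on UNIV (bump s t n)" for s t n
    by (intro smooth_continuous_on smooth_bump)
  have bump_int: "integrable lborel (bump s t n)" for s t n
    by (rule integrable_compact_support[where s = s and t = t, OF bump_cont]) (auto simp: bump_eq_0_iff)
  have [measurable]: "bump s t n \<in> borel_measurable borel" for s t n
    by (intro smooth_borel_measurable smooth_bump)
  have [measurable]: "h \<in> borel_measurable borel"
    using h by auto
  have hbump_int: "integrable lborel (\<lambda>x. h x * bump s t n x)" for s t n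
    by (rule Bochner_Integration.integrable_bound[OF h])
      (auto simp: abs_mult bump_nonneg intro!: AE_I2 mult_left_le bump_le_1)
  define s0 t0 where "s0 = (2 * a + b) / 3" and "t0 = (a + 2 * b) / 3"
  have st0: "a < s0" "s0 < t0" "t0 < b"
    using ab by (auto simp: s0_def t0_def)
  define J where "J = (LINT x|lborel. bump s0 t0 0 x)"
  have J: "J \<noteq> 0"
  proof
    assume "J = 0"
    then have "AE x in lborel. bump s0 t0 0 x = 0"
      unfolding J_def by (subst (asm) integral_nonneg_eq_0_iff_AE) (auto simp: bump_int bump_nonneg)
    then show False
      using not_AE_interval[OF st0(2)] by (simp add: bump_eq_0_iff)
  qed
  define k where "k = (LINT x|lborel. h x * bump s0 t0 0 x) / J"
  have key: "(LINT x|lborel. h x * bump s t n x) = k * (LINT x|lborel. bump s t n x)"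
    if st: "a < s" "s < t" "t < b" for s t n
  proof -
    \<comment> \<open>This choice gives \<open>q\<close> total integral zero; hence its primitive
      \<open>F\<close> takes the same value on both sides of the support, and
      \<open>F x - F lo\<close> is a test function.\<close>
    define c where "c = (LINT x|lborel. bump s t n x) / J"
    define q where "q x = bump s t n x + (- c) * bump s0 t0 0 x" for x
    have sm: "smooth q"
      unfolding q_def[abs_def] by (intro smooth_add smooth_mult smooth_const smooth_bump)
    have q_int: "integrable lborel q" "(LINT x|lborel. q x) = 0"
      unfolding q_def[abs_def] using J bump_int by (simp_all add: c_def J_def)
    obtain F where F: "\<And>x. (F has_real_derivative q x) (at x)"
      using einterval_antiderivative[of "-\<infinity>" "\<infinity>" q] smooth_continuous_on[OF sm, of UNIV]
      by (auto simp: has_real_derivative_iff_has_vector_derivative continuous_on_eq_continuous_at)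
    define lo hi where "lo = min s s0" and "hi = max t t0"
    have lohi: "a < lo" "lo < hi" "hi < b"
      using st st0 by (auto simp: lo_def hi_def)
    have q0: "q x = 0" if "x \<le> lo \<or> hi \<le> x" for x
      using that bump_eq_0_iff[of s t n x] bump_eq_0_iff[of s0 t0 0 x]
      by (auto simp: q_def lo_def hi_def)
    have "(LINT x|lborel. q x * indicator {lo..hi} x) = F hi - F lo"
      using lohi sm smooth_continuous_on[OF sm, of UNIV]
      by (intro integral_FTC_Icc_real F) (auto simp: continuous_on_eq_continuous_at)
    moreover have "(\<lambda>x. q x * indicator {lo..hi} x) = q"
    proof
      fix x show "q x * indicator {lo..hi} x = q x"
        using q0[of x] by (cases "x \<in> {lo..hi}") auto
    qed
    ultimately have hi: "F hi = F lo"
      using q_int by simp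
    have out: "F x = F lo" if "x \<notin> {lo..hi}" for x
    proof (cases "x < lo")
      case True
      then show ?thesis
        using MVT2[of x lo F q, OF _ F] q0 by force
    next
      case False
      then show ?thesis
        using MVT2[of hi x F q, OF _ F] q0 that hi by force
    qed
    define \<phi> where "\<phi> x = F x - F lo" for x
    have D: "(\<phi> has_real_derivative q x) (at x)" for x
      unfolding \<phi>_def[abs_def] using F[of x] by (auto intro!: derivative_eq_intros)
    have "smooth \<phi>"
      by (rule smooth_of_smooth_derivative[OF D sm])
    moreover have "deriv \<phi> = q"
      by (rule deriv_fun_eqI[OF D])
    moreover have "\<phi> x = 0" if "x \<notin> {lo..hi}" for x
      using out[OF that] by (simp add: \<phi>_def)
    ultimately have "test_fun a b \<phi>"
      unfolding test_fun_iff[OF ab] using lohi by (metis less_imp_le)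
    from z[OF this] have "(LINT x|lborel. h x * q x) = 0"
      by (simp add: \<open>deriv \<phi> = q\<close>)
    also have "(\<lambda>x. h x * q x) = (\<lambda>x. h x * bump s t n x - c * (h x * bump s0 t0 0 x))"
      by (auto simp: q_def algebra_simps)
    finally show ?thesis
      using hbump_int by (simp add: k_def c_def)
  qed
  define H where "H x = indicator {a<..<b} x * (h x - k)" for x
  have H_int: "integrable lborel H"
  proof -
    have "integrable lborel (\<lambda>x. indicator {a<..<b} x *\<^sub>R h x)"
      by (rule integrable_mult_indicator) (auto simp: h)
    moreover have "integrable lborel (\<lambda>x. indicator {a<..<b} x *\<^sub>R k)"
      using ab by simp
    ultimately show ?thesis
      unfolding H_def[abs_def] by (simp add: right_diff_distrib)
  qed
  have "AE x in lborel. H x = 0"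
  proof (rule integral_eq_0_on_intervals_imp_AE_0[OF H_int])
    have inner: "(LINT x:{s<..<t}|lborel. h x - k) = 0" if st: "a < s" "s < t" "t < b" for s t
    proof -
      have "(\<lambda>n. LINT x|lborel. (h x - k) * bump s t n x) \<longlonglongrightarrow> (LINT x|lborel. (h x - k) * indicator {s<..<t} x)"
      proof (rule integral_dominated_convergence[where w = "\<lambda>x. \<bar>h x\<bar> + \<bar>k\<bar> * indicator {s<..<t} x"])
        show "integrable lborel (\<lambda>x. \<bar>h x\<bar> + \<bar>k\<bar> * indicator {s<..<t} x)"
          using h st by (intro Bochner_Integration.integrable_add integrable_abs) auto
        show "AE x in lborel. norm ((h x - k) * bump s t n x) \<le> \<bar>h x\<bar> + \<bar>k\<bar> * indicator {s<..<t} x" for n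
        proof (rule AE_I2)
          fix x
          have "bump s t n x \<le> indicator {s<..<t} x"
            using bump_le_1[of s t n x] bump_eq_0_iff[of s t n x] by (auto simp: indicator_def)
          then have "norm ((h x - k) * bump s t n x) \<le> (\<bar>h x\<bar> + \<bar>k\<bar>) * indicator {s<..<t} x"
            unfolding norm_mult by (intro mult_mono) (auto simp: bump_nonneg)
          also have "\<dots> \<le> \<bar>h x\<bar> + \<bar>k\<bar> * indicator {s<..<t} x"
            by (auto simp: indicator_def)
          finally show "norm ((h x - k) * bump s t n x) \<le> \<bar>h x\<bar> + \<bar>k\<bar> * indicator {s<..<t} x" .
        qed
      qed (auto intro!: tendsto_intros bump_tendsto)
      moreover have "(LINT x|lborel. (h x - k) * bump s t n x) = 0" for n
        using key[OF st, of n] hbump_int bump_int by (simp add: left_diff_distrib)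
      ultimately have "(LINT x|lborel. (h x - k) * indicator {s<..<t} x) = 0"
        by (simp add: LIMSEQ_const_iff)
      then show ?thesis
        by (simp add: set_lebesgue_integral_def mult.commute)
    qed
    fix s t :: real assume "s < t"
    define s' t' where "s' = max a s" and "t' = min b t"
    have int: "set_integrable lborel A H" if "A \<in> sets borel" for A
      using integrable_mult_indicator[OF _ H_int] that unfolding set_integrable_def by simp
    show "(LINT x:{s<..<t}|lborel. H x) = 0"
    proof (cases "s' < t'")
      case True
      \<comment> \<open>\<open>inner\<close> only treats intervals with closure in (a, b), while
        (s', t') may reach \<open>a\<close> or \<open>b\<close>. It is exhausted from inside; the
        shift to \<open>n + 2\<close> keeps the shrunken intervals nonempty.\<close>
      define e where "e n = (t' - s') / (2 * real (n + 2))" for n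
      have e: "0 < e n" "e n \<le> (t' - s') / 4" for n
        using True unfolding e_def by (simp, intro divide_left_mono) auto
      have e0: "e \<longlonglongrightarrow> 0"
      proof -
        have "(\<lambda>n. (t' - s') / 2 * inverse (real (Suc (Suc n)))) \<longlonglongrightarrow> (t' - s') / 2 * 0"
          by (intro tendsto_intros LIMSEQ_Suc[OF LIMSEQ_inverse_real_of_nat])
        then show ?thesis
          by (simp add: e_def[abs_def] field_simps)
      qed
      have "(\<lambda>n. LINT x:{s' + e n<..<t' - e n}|lborel. H x) \<longlonglongrightarrow> (LINT x:(\<Union>n. {s' + e n<..<t' - e n})|lborel. H x)"
      proof (intro set_integral_cont_up int)
        show "incseq (\<lambda>n. {s' + e n<..<t' - e n})"
        proof (rule incseq_SucI)
          fix n
          have "e (Suc n) \<le> e n"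
            unfolding e_def using True by (intro divide_left_mono) auto
          then show "{s' + e n<..<t' - e n} \<subseteq> {s' + e (Suc n)<..<t' - e (Suc n)}" by auto
        qed
      qed auto
      moreover have "(LINT x:{s' + e n<..<t' - e n}|lborel. H x) = 0" for n
      proof -
        have "(LINT x:{s' + e n<..<t' - e n}|lborel. H x) = (LINT x:{s' + e n<..<t' - e n}|lborel. h x - k)"
          using e[of n] by (intro set_lebesgue_integral_cong) (auto simp: H_def s'_def t'_def indicator_def)
        also have "\<dots> = 0"
          using e[of n] True by (intro inner) (auto simp: s'_def t'_def)
        finally show ?thesis .
      qed
      moreover have "(\<Union>n. {s' + e n<..<t' - e n}) = {s'<..<t'}"
      proof (intro equalityI subsetI)
        fix x assume "x \<in> {s'<..<t'}"
        then have "eventually (\<lambda>n. e n < min (x - s') (t' - x)) sequentially"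
          by (intro order_tendstoD(2)[OF e0]) auto
        then obtain n where "e n < min (x - s') (t' - x)"
          by (auto simp: eventually_sequentially)
        then show "x \<in> (\<Union>n. {s' + e n<..<t' - e n})"
          by (intro UN_I[of n]) auto
      next
        fix x assume "x \<in> (\<Union>n. {s' + e n<..<t' - e n})"
        then obtain n where "x \<in> {s' + e n<..<t' - e n}" by blast
        then show "x \<in> {s'<..<t'}" using e(1)[of n] by auto
      qed
      ultimately have "(LINT x:{s'<..<t'}|lborel. H x) = 0"
        by (simp add: LIMSEQ_const_iff)
      moreover have "(LINT x:{s<..<t}|lborel. H x) = (LINT x:{s'<..<t'}|lborel. H x)"
        unfolding set_lebesgue_integral_def
        by (intro Bochner_Integration.integral_cong) (auto simp: H_def s'_def t'_def indicator_def)
      ultimately show ?thesis by simp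
    next
      case False
      then have "(\<lambda>x. indicator {s<..<t} x *\<^sub>R H x) = (\<lambda>x. 0)"
        by (auto simp: H_def s'_def t'_def indicator_def fun_eq_iff)
      then show ?thesis by (simp add: set_lebesgue_integral_def)
    qed
  qed
  then have "AE x in lborel. x \<in> {a<..<b} \<longrightarrow> h x = k"
    by eventually_elim (auto simp: H_def)
  then show ?thesis by (rule that)
qed

text \<open>Fubini for \<phi>'(x) on the region t \<le> x: integrating over t first yields
  \<open>cdf P\<close>, integrating over x first yields \<open>- \<phi> t\<close>.\<close>

lemma weak_derivative_cdf:
  assumes P: "finite_borel_measure P" and \<phi>: "test_fun a b \<phi>" and ab: "a < b"
  shows "integrable lborel (\<lambda>x. cdf P x * deriv \<phi> x)"
    and "(LINT x|lborel. cdf P x * deriv \<phi> x) = - (LINT t|P. \<phi> t)"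
proof -
  interpret P: finite_borel_measure P by (rule P)
  interpret pair_sigma_finite lborel P by unfold_locales
  have [measurable_cong]: "sets P = sets borel" by (rule P.M_is_borel)
  have sm: "smooth \<phi>" using \<phi> by (rule test_fun_smooth)
  have [measurable]: "deriv \<phi> \<in> borel_measurable borel"
    by (intro smooth_borel_measurable smooth_deriv sm)
  have cont: "continuous_on UNIV (deriv \<phi>)"
    by (intro smooth_continuous_on smooth_deriv sm)
  obtain lo hi where lohi: "a < lo" "lo \<le> hi" "hi < b" and out: "\<And>x. x \<notin> {lo..hi} \<Longrightarrow> \<phi> x = 0"
    "\<And>x. x \<notin> {lo..hi} \<Longrightarrow> deriv \<phi> x = 0"
    using test_funE[OF \<phi> ab] by metis
  have d_int: "integrable lborel (deriv \<phi>)"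
    by (rule integrable_compact_support[OF cont out(2)])
  define f where "f x t = deriv \<phi> x * (if t \<le> x then 1 else 0)" for x t :: real
  have f_meas: "case_prod f \<in> borel_measurable (lborel \<Otimes>\<^sub>M P)"
    unfolding f_def[abs_def] by measurable
  have slice: "(LINT t|P. (if t \<le> x then 1 else 0)) = cdf P x" for x
  proof -
    have "(\<lambda>t. if t \<le> x then 1 else 0) = (indicator {..x} :: real \<Rightarrow> real)"
      by (auto simp: indicator_def)
    then show ?thesis
      by (simp add: cdf_def P.borel_UNIV)
  qed
  have cdf_meas: "cdf P \<in> borel_measurable borel"
    by (intro borel_measurable_mono monoI P.cdf_nondecreasing)
  note [measurable] = cdf_meas
  show int: "integrable lborel (\<lambda>x. cdf P x * deriv \<phi> x)"
  proof (rule Bochner_Integration.integrable_bound)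
    show "integrable lborel (\<lambda>x. measure P (space P) * deriv \<phi> x)"
      using d_int by simp
    show "AE x in lborel. norm (cdf P x * deriv \<phi> x) \<le> norm (measure P (space P) * deriv \<phi> x)"
      by (auto simp: abs_mult P.cdf_nonneg intro!: AE_I2 mult_right_mono P.cdf_bounded)
  qed simp
  have f_int: "integrable (lborel \<Otimes>\<^sub>M P) (case_prod f)"
  proof (rule Fubini_integrable[OF f_meas])
    have "(LINT t|P. norm (case_prod f (x, t))) = cdf P x * \<bar>deriv \<phi> x\<bar>" for x
    proof -
      have "(\<lambda>t. norm (case_prod f (x, t))) = (\<lambda>t. \<bar>deriv \<phi> x\<bar> * (if t \<le> x then 1 else 0))"
        by (auto simp: f_def fun_eq_iff)
      then show ?thesis
        by (simp only: integral_mult_right_zero slice mult.commute)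
    qed
    moreover have "integrable lborel (\<lambda>x. cdf P x * \<bar>deriv \<phi> x\<bar>)"
      using integrable_abs[OF int] by (simp add: abs_mult P.cdf_nonneg)
    ultimately show "integrable lborel (\<lambda>x. LINT t|P. norm (case_prod f (x, t)))"
      by simp
    show "AE x in lborel. integrable P (\<lambda>t. case_prod f (x, t))"
      by (intro AE_I2 P.integrable_const_bound[where B = "\<bar>deriv \<phi> x\<bar>" for x]) (auto simp: f_def)
  qed
  have "(LINT x|lborel. cdf P x * deriv \<phi> x) = (LINT x|lborel. (LINT t|P. f x t))"
    unfolding f_def using slice by (simp add: mult.commute)
  also have "\<dots> = (LINT t|P. (LINT x|lborel. f x t))"
    using Fubini_integral[OF f_int] by simp
  also have "\<dots> = (LINT t|P. - \<phi> t)"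
  proof (intro Bochner_Integration.integral_cong refl)
    fix t
    \<comment> \<open>The upper limit lies beyond both \<open>t\<close> and the support, so the
      boundary term there is 0.\<close>
    define u where "u = max t hi + 1"
    have "(LINT x|lborel. f x t) = (LINT x|lborel. deriv \<phi> x * indicator {t..u} x)"
    proof (intro Bochner_Integration.integral_cong refl)
      fix x show "f x t = deriv \<phi> x * indicator {t..u} x"
      proof (cases "x \<le> u")
        case False
        then have "x \<notin> {lo..hi}" by (auto simp: u_def)
        with False show ?thesis by (simp add: out(2) f_def)
      qed (auto simp: f_def indicator_def)
    qed
    also have "\<dots> = \<phi> u - \<phi> t"
      using smooth_has_real_derivative[OF sm] cont
      by (intro integral_FTC_Icc_real) (auto simp: u_def continuous_on_eq_continuous_at)
    also have "\<phi> u = 0"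
      by (rule out(1)) (auto simp: u_def max_def)
    finally show "(LINT x|lborel. f x t) = - \<phi> t" by simp
  qed
  finally show "(LINT x|lborel. cdf P x * deriv \<phi> x) = - (LINT t|P. \<phi> t)"
    by simp
qed

section \<open>Representation of functions of bounded variation\<close>

definition add_measure :: "real measure \<Rightarrow> real measure \<Rightarrow> real measure" where
  "add_measure P N = measure_of UNIV (sets borel) (\<lambda>X. emeasure P X + emeasure N X)"

lemma sets_add_measure [simp]: "sets (add_measure P N) = sets borel"
  by (metis add_measure_def sets.sets_measure_of_eq space_borel)

lemma space_add_measure [simp]: "space (add_measure P N) = UNIV"
  by (simp add: add_measure_def space_measure_of_conv)

lemma finite_borel_measureI:
  "sets M = sets borel \<Longrightarrow> emeasure M UNIV \<noteq> \<infinity> \<Longrightarrow> finite_borel_measure M"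
  using sets_eq_imp_space_eq[of M borel]
  by (simp add: finite_borel_measure_def finite_borel_measure_axioms_def finite_measureI)

context
  fixes P N :: "real measure"
  assumes P: "finite_borel_measure P" and N: "finite_borel_measure N"
begin

interpretation P: finite_borel_measure P by (rule P)
interpretation N: finite_borel_measure N by (rule N)

lemma emeasure_add_measure: "emeasure (add_measure P N) X = emeasure P X + emeasure N X"
proof (cases "X \<in> sets borel")
  case True
  show ?thesis
    unfolding add_measure_def
  proof (rule emeasure_measure_of_sigma[OF _ _ _ True])
    show "sigma_algebra UNIV (sets (borel :: real measure))"
      using sets.sigma_algebra_axioms[of "borel :: real measure"] by simp
    show "countably_additive (sets borel) (\<lambda>X. emeasure P X + emeasure N X)"
    proof (rule countably_additiveI)
      fix A :: "nat \<Rightarrow> real set" assume "range A \<subseteq> sets borel" "disjoint_family A"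
      then show "(\<Sum>i. emeasure P (A i) + emeasure N (A i)) = emeasure P (\<Union> (range A)) + emeasure N (\<Union> (range A))"
        by (subst suminf_add[symmetric]) (auto simp: suminf_emeasure P.M_is_borel N.M_is_borel)
    qed
  qed (simp add: positive_def)
qed (simp add: emeasure_notin_sets P.M_is_borel N.M_is_borel)

lemma finite_borel_add_measure: "finite_borel_measure (add_measure P N)"
  by (rule finite_borel_measureI)
    (simp_all add: emeasure_add_measure P.emeasure_eq_measure N.emeasure_eq_measure)

lemma measure_add_measure: "measure (add_measure P N) X = measure P X + measure N X"
  unfolding measure_def emeasure_add_measure
  by (rule enn2real_plus) (simp_all add: less_top[symmetric] P.emeasure_finite N.emeasure_finite)

lemma cdf_add_measure: "cdf (add_measure P N) x = cdf P x + cdf N x"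
  by (simp add: cdf_def measure_add_measure)

end

definition mutually_singular :: "real measure \<Rightarrow> real measure \<Rightarrow> bool" where
  "mutually_singular P N \<longleftrightarrow> (\<exists>A\<in>sets borel. emeasure P (- A) = 0 \<and> emeasure N A = 0)"

lemma mutually_singular_sym: "mutually_singular P N \<Longrightarrow> mutually_singular N P"
  unfolding mutually_singular_def by (metis borel_comp double_complement)

lemma emeasure_split:
  assumes "sets M = sets borel" "A \<in> sets borel" "X \<in> sets borel"
  shows "emeasure M X = emeasure M (X \<inter> A) + emeasure M (X - A)"
proof -
  have "X = (X \<inter> A) \<union> (X - A)" by blast
  with assms show ?thesis
    by (metis Diff_disjoint Int_Diff_disjoint plus_emeasure sets.Diff sets.Int)
qed

text \<open>Moving the negative parts across turns the equality of distribution functions into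
  equality of the positive measures P + N' and P' + N. On a set that carries \<open>P\<close> and is
  null for \<open>N\<close> this reads P + N' = P', and on its complement N' = P' + N.\<close>

lemma jordan_decomposition_minimal:
  assumes "finite_borel_measure P" "finite_borel_measure N" "finite_borel_measure P'" "finite_borel_measure N'"
    and sing: "mutually_singular P N"
    and eq: "\<And>x. cdf P x - cdf N x = cdf P' x - cdf N' x"
    and X: "X \<in> sets borel"
  shows "emeasure P X \<le> emeasure P' X" "emeasure N X \<le> emeasure N' X"
proof -
  have sets: "sets P = sets borel" "sets N = sets borel"
    using assms finite_borel_measure.M_is_borel by blast+
  have "cdf (add_measure P N') = cdf (add_measure P' N)"
  proof
    fix x show "cdf (add_measure P N') x = cdf (add_measure P' N) x"
      using eq[of x] assms(1-4) by (simp add: cdf_add_measure field_simps)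
  qed
  then have "add_measure P N' = add_measure P' N"
    using assms by (intro cdf_unique' finite_borel_add_measure)
  then have *: "emeasure P X + emeasure N' X = emeasure P' X + emeasure N X" for X
    using emeasure_add_measure assms by metis
  obtain A where A: "A \<in> sets borel" "emeasure P (- A) = 0" "emeasure N A = 0"
    using sing by (auto simp: mutually_singular_def)
  have P0: "emeasure P (X - A) = 0"
    using A by (intro emeasure_eq_0[OF _ A(2)]) (auto simp: sets)
  have N0: "emeasure N (X \<inter> A) = 0"
    using A by (intro emeasure_eq_0[OF _ A(3)]) (auto simp: sets)
  have sub: "emeasure M (X \<inter> A) \<le> emeasure M X" "emeasure M (X - A) \<le> emeasure M X"
    if "finite_borel_measure M" for M
    using that X by (auto intro!: emeasure_mono simp: finite_borel_measure.M_is_borel)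
  have "emeasure P X = emeasure P (X \<inter> A)"
    using emeasure_split[OF sets(1) A(1) X] P0 by simp
  also have "\<dots> \<le> emeasure P' (X \<inter> A)"
    using *[of "X \<inter> A"] N0 by (metis add.right_neutral le_iff_add)
  also have "\<dots> \<le> emeasure P' X"
    using sub assms by blast
  finally show "emeasure P X \<le> emeasure P' X" .
  have "emeasure N X = emeasure N (X - A)"
    using emeasure_split[OF sets(2) A(1) X] N0 by simp
  also have "\<dots> \<le> emeasure N' (X - A)"
    using *[of "X - A"] P0 by (metis add.left_neutral add.commute le_iff_add)
  also have "\<dots> \<le> emeasure N' X"
    using sub assms by blast
  finally show "emeasure N X \<le> emeasure N' X" .
qed

text \<open>A Hahn set \<open>Y\<close> separates the signs of P' - N': on \<open>Y\<close> the
  difference is nonnegative and gives \<open>P\<close>, off \<open>Y\<close> its negative gives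
  \<open>N\<close>.\<close>

lemma jordan_decomposition_exists:
  assumes P': "finite_borel_measure P'" and N': "finite_borel_measure N'"
  obtains P N where "finite_borel_measure P" "finite_borel_measure N" "mutually_singular P N"
    "\<And>x. cdf P x - cdf N x = cdf P' x - cdf N' x"
    "\<And>X. X \<in> sets borel \<Longrightarrow> emeasure P X \<le> emeasure P' X"
    "\<And>X. X \<in> sets borel \<Longrightarrow> emeasure N X \<le> emeasure N' X"
proof -
  interpret P': finite_borel_measure P' by (rule P')
  interpret N': finite_borel_measure N' by (rule N')
  note [simp] = P'.M_is_borel N'.M_is_borel P'.borel_UNIV N'.borel_UNIV
  obtain Y where Y: "Y \<in> sets borel" "\<And>X. X \<in> sets borel \<Longrightarrow> X \<subseteq> Y \<Longrightarrow> emeasure N' X \<le> emeasure P' X"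
    "\<And>X. X \<in> sets borel \<Longrightarrow> X \<inter> Y = {} \<Longrightarrow> emeasure P' X \<le> emeasure N' X"
    using finite_unsigned_Hahn_decomposition[of P' N'] P'.finite_measure_axioms N'.finite_measure_axioms
    by auto
  \<comment> \<open>\<open>diff_measure\<close> requires the subtracted measure to be the smaller
    one on every set, which is ensured by restricting to \<open>Y\<close> or to its
    complement.\<close>
  define R where "R M Z = density M (indicator Z)" for M :: "real measure" and Z
  have R: "emeasure (R M Z) X = emeasure M (X \<inter> Z)" "finite_borel_measure (R M Z)" "sets (R M Z) = sets borel"
    if "finite_borel_measure M" "Z \<in> sets borel" "X \<in> sets borel" for M Z X
  proof -
    interpret M: finite_borel_measure M by (rule that)
    note [simp] = M.M_is_borel M.borel_UNIV
    have e: "emeasure (R M Z) X = emeasure M (X \<inter> Z)" if "X \<in> sets borel" for X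
      unfolding R_def using that \<open>Z \<in> sets borel\<close> by (subst emeasure_restricted) (auto simp: Int_commute)
    show "emeasure (R M Z) X = emeasure M (X \<inter> Z)" using that by (intro e)
    show s: "sets (R M Z) = sets borel" by (simp add: R_def)
    show "finite_borel_measure (R M Z)"
      using s e[of UNIV] by (intro finite_borel_measureI) auto
  qed
  define P where "P = diff_measure (R P' Y) (R N' Y)"
  define N where "N = diff_measure (R N' (- Y)) (R P' (- Y))"
  have eP: "emeasure P X = emeasure P' (X \<inter> Y) - emeasure N' (X \<inter> Y)" if "X \<in> sets borel" for X
    unfolding P_def using that Y R P' N'
    by (subst emeasure_diff_measure) (auto simp: finite_borel_measure_def)
  have eN: "emeasure N X = emeasure N' (X - Y) - emeasure P' (X - Y)" if "X \<in> sets borel" for X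
    unfolding N_def using that Y R P' N'
    by (subst emeasure_diff_measure) (auto simp: finite_borel_measure_def Diff_eq)
  have leP: "emeasure P X \<le> emeasure P' X" if "X \<in> sets borel" for X
    using that Y by (simp add: eP) (meson diff_le_self_ennreal order.trans P'.emeasure_finite emeasure_mono Int_lower1 P'.sets_M)
  have leN: "emeasure N X \<le> emeasure N' X" if "X \<in> sets borel" for X
    using that Y by (simp add: eN) (meson diff_le_self_ennreal order.trans emeasure_mono Diff_subset N'.sets_M)
  have sP: "sets P = sets borel" and sN: "sets N = sets borel"
    using R[OF P' Y(1), of "{}"] R[OF N', of "- Y" "{}"] Y(1) by (auto simp: P_def N_def)
  have fP: "finite_borel_measure P"
    using leP[of UNIV] sP by (intro finite_borel_measureI) (auto simp: top_unique)
  have fN: "finite_borel_measure N"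
    using leN[of UNIV] sN by (intro finite_borel_measureI) (auto simp: top_unique)
  interpret P: finite_borel_measure P by (rule fP)
  interpret N: finite_borel_measure N by (rule fN)
  have "mutually_singular P N"
    unfolding mutually_singular_def using Y by (intro bexI[of _ Y]) (auto simp: eP eN)
  moreover have "cdf P x - cdf N x = cdf P' x - cdf N' x" for x
  proof -
    have "measure P {..x} = measure P' ({..x} \<inter> Y) - measure N' ({..x} \<inter> Y)"
      using eP[of "{..x}"] Y(1) Y(2)[of "{..x} \<inter> Y"] P.emeasure_eq_measure[of "{..x}"]
      by (simp add: P'.emeasure_eq_measure N'.emeasure_eq_measure ennreal_minus)
    moreover have "({..x} - Y) \<inter> Y = {}" by blast
    then have "measure N {..x} = measure N' ({..x} - Y) - measure P' ({..x} - Y)"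
      using eN[of "{..x}"] Y(1) Y(3)[of "{..x} - Y"] N.emeasure_eq_measure[of "{..x}"]
      by (simp add: P'.emeasure_eq_measure N'.emeasure_eq_measure ennreal_minus)
    moreover have "measure P' {..x} = measure P' ({..x} \<inter> Y) + measure P' ({..x} - Y)"
      using Y by (subst P'.finite_measure_Union[symmetric]) (auto intro: arg_cong[where f = "measure P'"])
    moreover have "measure N' {..x} = measure N' ({..x} \<inter> Y) + measure N' ({..x} - Y)"
      using Y by (subst N'.finite_measure_Union[symmetric]) (auto intro: arg_cong[where f = "measure N'"])
    ultimately show ?thesis by (simp add: cdf_def)
  qed
  ultimately show ?thesis using that fP fN leP leN by blast
qed

text \<open>
  Here \<open>c + cdf P - cdf N\<close> is the right-continuous representative of \<open>u\<close>, constant outside the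
  interval, and \<open>P - N\<close> is its derivative; \<open>P\<close> and \<open>N\<close> need not be mutually singular.
\<close>

definition bv_rep :: "real \<Rightarrow> real \<Rightarrow> (real \<Rightarrow> real) \<Rightarrow> real \<Rightarrow> real measure \<Rightarrow> real measure \<Rightarrow> bool" where
  "bv_rep a b u c P N \<longleftrightarrow> finite_borel_measure P \<and> finite_borel_measure N \<and>
     emeasure P (- {a<..<b}) = 0 \<and> emeasure N (- {a<..<b}) = 0 \<and>
     (AE x in lborel. x \<in> {a<..<b} \<longrightarrow> u x = c + cdf P x - cdf N x)"

section \<open>Functions of bounded variation as differences of distribution functions\<close>

lemma cdf_borel_measurable: "finite_borel_measure P \<Longrightarrow> cdf P \<in> borel_measurable borel"
  by (intro borel_measurable_mono monoI finite_borel_measure.cdf_nondecreasing)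

text \<open>Derivative measures live on the trace sigma-algebra of the interval, distribution
  functions belong to Borel measures on the line; the push-forward under the identity passes from
  the first to the second.\<close>

lemma finite_borel_measure_extend:
  assumes "finite_measure P" "sets P = sets (restrict_space borel S)" "S \<in> sets borel"
  defines "Q \<equiv> distr P borel (\<lambda>x. x)"
  shows "finite_borel_measure Q" "\<And>X. X \<in> sets borel \<Longrightarrow> emeasure Q X = emeasure P (X \<inter> S)"
    "emeasure Q (- S) = 0"
    "\<And>f :: real \<Rightarrow> real. f \<in> borel_measurable borel \<Longrightarrow> integral\<^sup>L Q f = integral\<^sup>L P f"
proof -
  interpret P: finite_measure P by fact
  have sp: "space P = S"
    using sets_eq_imp_space_eq[OF assms(2)] by (simp add: space_restrict_space)
  have m: "(\<lambda>x. x) \<in> measurable P borel"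
    unfolding measurable_cong_sets[OF assms(2) refl] by (rule measurable_restrict_space1) simp
  show e: "emeasure Q X = emeasure P (X \<inter> S)" if "X \<in> sets borel" for X
    unfolding Q_def using that m by (subst emeasure_distr) (auto simp: sp)
  show "emeasure Q (- S) = 0" using assms(3) by (subst e) auto
  have "finite_measure Q" unfolding Q_def by (rule P.finite_measure_distr[OF m])
  then show "finite_borel_measure Q"
    by (simp add: finite_borel_measure_def finite_borel_measure_axioms_def Q_def)
  show "integral\<^sup>L Q f = integral\<^sup>L P f" if "f \<in> borel_measurable borel" for f :: "real \<Rightarrow> real"
    unfolding Q_def using that by (simp add: integral_distr[OF m])
qed

text \<open>By \<open>weak_derivative_cdf\<close> the difference of the distribution functions has
  the same distributional derivative as \<open>u\<close>, so the two differ by a constant. The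
  measures obtained extend the very pair selected by the choice operator in
  \<open>deriv_measure\<close>, which is why \<open>abs_deriv\<close> can be read off them.\<close>

lemma BV_rep:
  assumes ab: "a < b" and u: "u \<in> BV a b"
  obtains c P N where "bv_rep a b u c P N" "mutually_singular P N"
    "\<And>X. X \<in> sets borel \<Longrightarrow> abs_deriv a b u (X \<inter> {a<..<b}) = emeasure P X + emeasure N X"
proof -
  let ?I = "{a<..<b}"
  obtain P N where D: "deriv_measure a b u = (P, N)" by (rule prod.exhaust)
  have "\<exists>D. has_deriv_measure a b u D" using u by (simp add: BV_def)
  then have has: "has_deriv_measure a b u (P, N)"
    unfolding D[symmetric] deriv_measure_def by (rule someI_ex)
  define P' N' where "P' = distr P borel (\<lambda>x. x)" and "N' = distr N borel (\<lambda>x. x)"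
  have fin: "finite_measure P" "finite_measure N" and sets: "sets P = sets (restrict_space borel ?I)"
    "sets N = sets (restrict_space borel ?I)"
    and sing: "\<exists>A\<in>sets P. emeasure P (?I - A) = 0 \<and> emeasure N A = 0"
    and weak: "\<And>\<phi>. test_fun a b \<phi> \<Longrightarrow>
      (LINT x:?I|lebesgue. u x * deriv \<phi> x) = - (integral\<^sup>L P \<phi> - integral\<^sup>L N \<phi>)"
    using has by (auto simp: has_deriv_measure_def)
  have I: "?I \<in> sets borel" by simp
  note P' = finite_borel_measure_extend[OF fin(1) sets(1) I, folded P'_def]
  note N' = finite_borel_measure_extend[OF fin(2) sets(2) I, folded N'_def]
  have u_int: "integrable lebesgue (\<lambda>x. indicator ?I x *\<^sub>R u x)"
    using u by (simp add: BV_def set_integrable_def)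
  \<comment> \<open>\<open>u\<close> is only Lebesgue measurable; a Borel version allows the passage
    between \<open>lebesgue\<close> and \<open>lborel\<close>, over which the Fubini argument
    runs.\<close>
  obtain v where v: "v \<in> borel_measurable lborel" "AE x in lborel. indicator ?I x *\<^sub>R u x = v x"
    using completion_ex_borel_measurable_real[OF borel_measurable_integrable[OF u_int]] by blast
  have "integrable lebesgue v"
    by (rule integrable_cong_AE_imp[OF u_int measurable_completion[OF v(1)] AE_completion])
      (rule v(2))
  then have v_int: "integrable lborel v"
    using v(1) integrable_completion by blast
  define w where "w x = indicator ?I x *\<^sub>R (cdf P' x - cdf N' x)" for x
  have [measurable]: "cdf P' \<in> borel_measurable borel" "cdf N' \<in> borel_measurable borel"
    "v \<in> borel_measurable borel"
    using cdf_borel_measurable P'(1) N'(1) v(1) by auto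
  have cdf_int: "integrable lborel (\<lambda>x. indicator ?I x *\<^sub>R cdf M x)" if "finite_borel_measure M" for M
  proof (rule integrableI_bounded_set_indicator[where B = "measure M (space M)"])
    interpret M: finite_borel_measure M by (rule that)
    show "AE x in lborel. x \<in> ?I \<longrightarrow> norm (cdf M x) \<le> measure M (space M)"
      by (simp add: M.cdf_nonneg M.cdf_bounded)
    show "emeasure lborel ?I < \<infinity>" using ab by simp
  qed (use cdf_borel_measurable[OF that] in auto)
  have w_int: "integrable lborel w"
    unfolding w_def[abs_def] scaleR_diff_right by (intro Bochner_Integration.integrable_diff cdf_int P' N')
  obtain c where c: "AE x in lborel. x \<in> ?I \<longrightarrow> v x - w x = c"
  proof (rule du_bois_reymond[OF ab, of "\<lambda>x. v x - w x"])
    show "integrable lborel (\<lambda>x. v x - w x)" using v_int w_int by simp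
    fix \<phi> assume \<phi>: "test_fun a b \<phi>"
    have [measurable]: "\<phi> \<in> borel_measurable borel" "deriv \<phi> \<in> borel_measurable borel"
      by (intro smooth_borel_measurable smooth_deriv test_fun_smooth[OF \<phi>])+
    obtain lo hi where lohi: "a < lo" "lo \<le> hi" "hi < b" "\<And>x. x \<notin> {lo..hi} \<Longrightarrow> \<phi> x = 0"
      "\<And>x. x \<notin> {lo..hi} \<Longrightarrow> deriv \<phi> x = 0"
      by (rule test_funE[OF \<phi> ab]) (rule that; assumption)
    obtain B where B: "\<And>x. \<bar>deriv \<phi> x\<bar> \<le> B"
      by (rule smooth_bounded_of_support[OF smooth_deriv[OF test_fun_smooth[OF \<phi>]] lohi(5)], assumption) (rule that; assumption)
    have bint: "integrable lborel (\<lambda>x. f x * deriv \<phi> x)" if "integrable lborel f" for f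
    proof (rule Bochner_Integration.integrable_bound)
      show "integrable lborel (\<lambda>x. f x * B)" using that by simp
      show "AE x in lborel. norm (f x * deriv \<phi> x) \<le> norm (f x * B)"
        unfolding norm_mult by (intro AE_I2 mult_left_mono) (auto intro: order.trans[OF B abs_ge_self])
    qed (use borel_measurable_integrable[OF that] in measurable)
    have "(LINT x|lborel. v x * deriv \<phi> x) = (LINT x|lebesgue. v x * deriv \<phi> x)"
      by (rule integral_completion[symmetric]) simp
    also have "\<dots> = (LINT x:?I|lebesgue. u x * deriv \<phi> x)"
      unfolding set_lebesgue_integral_def
    proof (rule integral_cong_AE)
      show "(\<lambda>x. indicator ?I x *\<^sub>R (u x * deriv \<phi> x)) \<in> borel_measurable lebesgue"
        using borel_measurable_times[OF borel_measurable_integrable[OF u_int]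
            measurable_completion[of "deriv \<phi>" lborel borel]] by (simp add: mult.assoc)
      show "AE x in lebesgue. v x * deriv \<phi> x = indicator ?I x *\<^sub>R (u x * deriv \<phi> x)"
        using AE_completion[OF v(2)]
      proof eventually_elim
        fix x assume "indicator ?I x *\<^sub>R u x = v x"
        then show "v x * deriv \<phi> x = indicator ?I x *\<^sub>R (u x * deriv \<phi> x)"
          by (simp flip: mult.assoc)
      qed
    qed (auto intro: measurable_completion)
    also have "\<dots> = - (integral\<^sup>L P' \<phi> - integral\<^sup>L N' \<phi>)"
      using weak[OF \<phi>] P'(4) N'(4) by simp
    also have "\<dots> = (LINT x|lborel. cdf P' x * deriv \<phi> x) - (LINT x|lborel. cdf N' x * deriv \<phi> x)"
      using weak_derivative_cdf[OF P'(1) \<phi> ab] weak_derivative_cdf[OF N'(1) \<phi> ab] by simp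
    also have "\<dots> = (LINT x|lborel. cdf P' x * deriv \<phi> x - cdf N' x * deriv \<phi> x)"
      using weak_derivative_cdf[OF P'(1) \<phi> ab] weak_derivative_cdf[OF N'(1) \<phi> ab] by simp
    also have "\<dots> = (LINT x|lborel. w x * deriv \<phi> x)"
    proof (intro Bochner_Integration.integral_cong refl)
      fix x show "cdf P' x * deriv \<phi> x - cdf N' x * deriv \<phi> x = w x * deriv \<phi> x"
        using lohi(1-3) lohi(5)[of x] by (cases "x \<in> {lo..hi}") (auto simp: w_def algebra_simps)
    qed
    finally show "(LINT x|lborel. (v x - w x) * deriv \<phi> x) = 0"
      using bint[OF v_int] bint[OF w_int] by (simp add: left_diff_distrib)
  qed
  show ?thesis
  proof (rule that)
    show "bv_rep a b u c P' N'"
      unfolding bv_rep_def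
    proof (intro conjI P' N')
      show "AE x in lborel. x \<in> ?I \<longrightarrow> u x = c + cdf P' x - cdf N' x"
        using c v(2) by eventually_elim (auto simp: w_def)
    qed
    obtain A where A: "A \<in> sets P" "emeasure P (?I - A) = 0" "emeasure N A = 0" using sing by blast
    have AI: "A \<subseteq> ?I" "A \<in> sets borel"
      using A(1) by (auto simp: sets sets_restrict_space)
    show "mutually_singular P' N'"
      unfolding mutually_singular_def
    proof (intro bexI[OF _ AI(2)] conjI)
      have "- A \<inter> ?I = ?I - A" by blast
      then show "emeasure P' (- A) = 0" using A AI by (subst P'(2)) auto
      show "emeasure N' A = 0" using A AI by (subst N'(2)) (auto simp: Int_absorb2)
    qed
    show "abs_deriv a b u (X \<inter> ?I) = emeasure P' X + emeasure N' X" if "X \<in> sets borel" for X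
      using that by (simp add: abs_deriv_def D P'(2) N'(2))
  qed
qed

text \<open>A derivative has to be given by a mutually singular pair, which P' and N' need not be.
  Their Jordan decomposition has the same difference of distribution functions, hence represents the
  same function.\<close>

lemma BV_if_rep:
  assumes ab: "a < b" and rep: "bv_rep a b u c P' N'"
  shows "u \<in> BV a b"
proof -
  let ?I = "{a<..<b}"
  have P': "finite_borel_measure P'" and N': "finite_borel_measure N'"
    and u': "AE x in lborel. x \<in> ?I \<longrightarrow> u x = c + cdf P' x - cdf N' x"
    using rep by (auto simp: bv_rep_def)
  obtain P N where P: "finite_borel_measure P" and N: "finite_borel_measure N"
    and sing: "mutually_singular P N" and eq: "\<And>x. cdf P x - cdf N x = cdf P' x - cdf N' x"
    using jordan_decomposition_exists[OF P' N'] by metis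
  interpret P: finite_borel_measure P by (rule P)
  interpret N: finite_borel_measure N by (rule N)
  note [simp] = P.M_is_borel N.M_is_borel P.borel_UNIV N.borel_UNIV
  define w where "w x = c + cdf P x - cdf N x" for x
  have uw: "AE x in lborel. x \<in> ?I \<longrightarrow> u x = w x"
    using u'
  proof eventually_elim
    fix x assume "x \<in> ?I \<longrightarrow> u x = c + cdf P' x - cdf N' x"
    then show "x \<in> ?I \<longrightarrow> u x = w x" using eq[of x] by (simp add: w_def)
  qed
  have [measurable]: "cdf P \<in> borel_measurable borel" "cdf N \<in> borel_measurable borel"
    using cdf_borel_measurable P N by auto
  have [measurable]: "w \<in> borel_measurable borel"
    unfolding w_def[abs_def] by measurable
  have wB: "\<bar>w x\<bar> \<le> \<bar>c\<bar> + measure P UNIV + measure N UNIV" for x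
    using P.cdf_nonneg[of x] N.cdf_nonneg[of x] P.cdf_bounded[of x] N.cdf_bounded[of x] by (simp add: w_def)
  have "integrable lborel (\<lambda>x. indicator ?I x *\<^sub>R w x)"
    by (rule integrableI_bounded_set_indicator[where B = "\<bar>c\<bar> + measure P UNIV + measure N UNIV"])
      (use wB ab in auto)
  then have "integrable lebesgue (\<lambda>x. indicator ?I x *\<^sub>R w x)"
    by (subst integrable_completion) auto
  moreover have AE: "AE x in lebesgue. indicator ?I x *\<^sub>R w x = indicator ?I x *\<^sub>R u x"
    using AE_completion[OF uw] by eventually_elim (auto simp: indicator_def)
  moreover have u_meas: "(\<lambda>x. indicator ?I x *\<^sub>R u x) \<in> borel_measurable lebesgue"
    by (rule borel_measurable_AE[OF _ AE]) (auto intro: measurable_completion)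
  ultimately have u_int: "integrable lebesgue (\<lambda>x. indicator ?I x *\<^sub>R u x)"
    by (subst integrable_cong_AE[of _ _ "\<lambda>x. indicator ?I x *\<^sub>R w x"]) (auto intro: measurable_completion)
  define P0 N0 where "P0 = restrict_space P ?I" and "N0 = restrict_space N ?I"
  have res: "finite_measure (restrict_space M ?I)" "sets (restrict_space M ?I) = sets (restrict_space borel ?I)"
    "\<And>\<phi> :: real \<Rightarrow> real. (\<And>x. x \<notin> ?I \<Longrightarrow> \<phi> x = 0) \<Longrightarrow> integral\<^sup>L (restrict_space M ?I) \<phi> = integral\<^sup>L M \<phi>"
    if "finite_borel_measure M" for M
  proof -
    interpret M: finite_borel_measure M by (rule that)
    note [simp] = M.M_is_borel M.borel_UNIV
    show "finite_measure (restrict_space M ?I)" by (rule finite_measure_restrict_space[OF M.finite_measure_axioms]) simp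
    show "sets (restrict_space M ?I) = sets (restrict_space borel ?I)"
      by (rule sets_restrict_space_cong) simp
    show "integral\<^sup>L (restrict_space M ?I) \<phi> = integral\<^sup>L M \<phi>" if "\<And>x. x \<notin> ?I \<Longrightarrow> \<phi> x = 0" for \<phi> :: "real \<Rightarrow> real"
    proof -
      have "(\<lambda>x. indicator ?I x *\<^sub>R \<phi> x) = \<phi>" using that by (auto simp: fun_eq_iff indicator_def)
      then show ?thesis by (simp add: integral_restrict_space)
    qed
  qed
  have "has_deriv_measure a b u (P0, N0)"
    unfolding has_deriv_measure_def prod.case
  proof (intro conjI allI impI)
    show "finite_measure P0" "finite_measure N0" "sets P0 = sets (restrict_space borel ?I)"
      "sets N0 = sets (restrict_space borel ?I)"
      unfolding P0_def N0_def using res P N by blast+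
    obtain A where A: "A \<in> sets borel" "emeasure P (- A) = 0" "emeasure N A = 0"
      using sing by (auto simp: mutually_singular_def)
    show "\<exists>A\<in>sets P0. emeasure P0 (?I - A) = 0 \<and> emeasure N0 A = 0"
    proof (intro bexI conjI)
      show "A \<inter> ?I \<in> sets P0" using A by (auto simp: P0_def sets_restrict_space)
      have "emeasure P0 (?I - A \<inter> ?I) = emeasure P (?I - A \<inter> ?I)"
        unfolding P0_def by (rule emeasure_restrict_space) auto
      also have "\<dots> = 0" using A by (intro emeasure_eq_0[OF _ A(2)]) auto
      finally show "emeasure P0 (?I - A \<inter> ?I) = 0" .
      have "emeasure N0 (A \<inter> ?I) = emeasure N (A \<inter> ?I)"
        unfolding N0_def by (rule emeasure_restrict_space) auto
      also have "\<dots> = 0" using A by (intro emeasure_eq_0[OF _ A(3)]) auto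
      finally show "emeasure N0 (A \<inter> ?I) = 0" .
    qed
    fix \<phi> assume \<phi>: "test_fun a b \<phi>"
    have [measurable]: "\<phi> \<in> borel_measurable borel" "deriv \<phi> \<in> borel_measurable borel"
      by (intro smooth_borel_measurable smooth_deriv test_fun_smooth[OF \<phi>])+
    obtain lo hi where lohi: "a < lo" "lo \<le> hi" "hi < b" "\<And>x. x \<notin> {lo..hi} \<Longrightarrow> \<phi> x = 0"
      "\<And>x. x \<notin> {lo..hi} \<Longrightarrow> deriv \<phi> x = 0"
      by (rule test_funE[OF \<phi> ab]) (rule that; assumption)
    have d_int: "integrable lborel (deriv \<phi>)"
      using lohi(5) by (intro integrable_compact_support[of _ lo hi] smooth_continuous_on smooth_deriv test_fun_smooth[OF \<phi>]) auto
    \<comment> \<open>This makes the constant \<open>c\<close> drop out of the weak formulation. The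
      interval is enlarged by 1 because \<open>\<phi>\<close> is known to vanish only outside
      \<open>{lo..hi}\<close>.\<close>
    have d0: "(LINT x|lborel. deriv \<phi> x) = 0"
    proof -
      have "(LINT x|lborel. deriv \<phi> x * indicator {lo-1..hi+1} x) = \<phi> (hi + 1) - \<phi> (lo - 1)"
        using smooth_has_real_derivative[OF test_fun_smooth[OF \<phi>]] lohi(2)
          smooth_continuous_on[OF smooth_deriv[OF test_fun_smooth[OF \<phi>]], of UNIV]
        by (intro integral_FTC_Icc_real) (auto simp: continuous_on_eq_continuous_at)
      moreover have "(\<lambda>x. deriv \<phi> x * indicator {lo-1..hi+1} x) = deriv \<phi>"
      proof
        fix x show "deriv \<phi> x * indicator {lo-1..hi+1} x = deriv \<phi> x"
          using lohi(5)[of x] by (cases "x \<in> {lo..hi}") auto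
      qed
      ultimately show ?thesis
        using lohi(4)[of "hi + 1"] lohi(4)[of "lo - 1"] by simp
    qed
    have "(LINT x:?I|lebesgue. u x * deriv \<phi> x) = (LINT x|lebesgue. w x * deriv \<phi> x)"
      unfolding set_lebesgue_integral_def
    proof (rule integral_cong_AE)
      show "(\<lambda>x. indicator ?I x *\<^sub>R (u x * deriv \<phi> x)) \<in> borel_measurable lebesgue"
        using borel_measurable_times[OF u_meas measurable_completion[of "deriv \<phi>" lborel borel]]
        by (simp add: mult.assoc)
      show "AE x in lebesgue. indicator ?I x *\<^sub>R (u x * deriv \<phi> x) = w x * deriv \<phi> x"
        using AE_completion[OF uw]
      proof eventually_elim
        fix x assume "x \<in> ?I \<longrightarrow> u x = w x"
        then show "indicator ?I x *\<^sub>R (u x * deriv \<phi> x) = w x * deriv \<phi> x"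
          using lohi(1-3) lohi(5)[of x] by (cases "x \<in> {lo..hi}") auto
      qed
    qed (auto intro: measurable_completion)
    also have "\<dots> = (LINT x|lborel. w x * deriv \<phi> x)"
      by (rule integral_completion) simp
    also have "\<dots> = (LINT x|lborel. c * deriv \<phi> x + cdf P x * deriv \<phi> x - cdf N x * deriv \<phi> x)"
      by (simp add: w_def algebra_simps)
    also have "\<dots> = - (integral\<^sup>L P \<phi> - integral\<^sup>L N \<phi>)"
      using weak_derivative_cdf[OF P \<phi> ab] weak_derivative_cdf[OF N \<phi> ab] d_int d0 by simp
    also have "integral\<^sup>L P \<phi> = integral\<^sup>L P0 \<phi>"
      unfolding P0_def using lohi by (intro res(3)[symmetric] P) auto
    also have "integral\<^sup>L N \<phi> = integral\<^sup>L N0 \<phi>"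
      unfolding N0_def using lohi by (intro res(3)[symmetric] N) auto
    finally show "(LINT x:?I|lebesgue. u x * deriv \<phi> x) = - (integral\<^sup>L P0 \<phi> - integral\<^sup>L N0 \<phi>)" .
  qed
  then show ?thesis
    using u_int by (auto simp: BV_def set_integrable_def)
qed

section \<open>Jumps and the functional \<open>TV_K\<close>\<close>

text \<open>A one-sided neighbourhood contains an interval, which no null set covers. Nontriviality
  of the filter gives uniqueness of limits, so that \<open>Lim\<close> in \<open>jump_size\<close>
  denotes the actual one-sided limit.\<close>

lemma ess_right_neq_bot: "ess_right x \<noteq> bot"
proof
  assume "ess_right x = bot"
  then have "eventually (\<lambda>_. False) (inf (at_right x) (ae_filter lebesgue))"
    by (simp add: ess_right_def)
  then obtain P Q where "eventually P (at_right x)" "AE y in lebesgue. Q y" "\<And>y. P y \<Longrightarrow> Q y \<Longrightarrow> False"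
    unfolding eventually_inf by blast
  moreover then obtain e where "x < e" "\<And>y. x < y \<Longrightarrow> y < e \<Longrightarrow> P y"
    unfolding eventually_at_right_field by blast
  ultimately have "AE y in lebesgue. y \<notin> {x<..<e}"
    by (auto elim!: eventually_mono)
  then show False
    using not_AE_interval[OF \<open>x < e\<close>] by (simp add: AE_completion_iff)
qed

lemma ess_left_neq_bot: "ess_left x \<noteq> bot"
proof
  assume "ess_left x = bot"
  then have "eventually (\<lambda>_. False) (inf (at_left x) (ae_filter lebesgue))"
    by (simp add: ess_left_def)
  then obtain P Q where "eventually P (at_left x)" "AE y in lebesgue. Q y" "\<And>y. P y \<Longrightarrow> Q y \<Longrightarrow> False"
    unfolding eventually_inf by blast
  moreover then obtain e where "e < x" "\<And>y. e < y \<Longrightarrow> y < x \<Longrightarrow> P y"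
    unfolding eventually_at_left_field by blast
  ultimately have "AE y in lebesgue. y \<notin> {e<..<x}"
    by (auto elim!: eventually_mono)
  then show False
    using not_AE_interval[OF \<open>e < x\<close>] by (simp add: AE_completion_iff)
qed

lemma tendsto_inf_ae_filter:
  assumes "AE y in lborel. y \<in> {a<..<b} \<longrightarrow> u y = w y" "eventually (\<lambda>y. y \<in> {a<..<b}) F" "(w \<longlongrightarrow> l) F"
  shows "(u \<longlongrightarrow> l) (inf F (ae_filter lebesgue))"
proof (rule Lim_transform_eventually)
  show "(w \<longlongrightarrow> l) (inf F (ae_filter lebesgue))"
    by (rule tendsto_mono[OF inf_le1 assms(3)])
  show "eventually (\<lambda>y. w y = u y) (inf F (ae_filter lebesgue))"
    unfolding eventually_inf using assms(2) AE_completion[OF assms(1)]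
    by (intro exI[of _ "\<lambda>y. y \<in> {a<..<b}"] exI[of _ "\<lambda>y. y \<in> {a<..<b} \<longrightarrow> u y = w y"]) auto
qed

lemma tendsto_ess_right:
  assumes "AE y in lborel. y \<in> {a<..<b} \<longrightarrow> u y = w y" "a \<le> x" "x < b" "(w \<longlongrightarrow> l) (at_right x)"
  shows "(u \<longlongrightarrow> l) (ess_right x)"
  unfolding ess_right_def using assms
  by (intro tendsto_inf_ae_filter[OF assms(1) _ assms(4)]) (auto simp: eventually_at_right_field)

lemma tendsto_ess_left:
  assumes "AE y in lborel. y \<in> {a<..<b} \<longrightarrow> u y = w y" "a < x" "x \<le> b" "(w \<longlongrightarrow> l) (at_left x)"
  shows "(u \<longlongrightarrow> l) (ess_left x)"
  unfolding ess_left_def using assms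
  by (intro tendsto_inf_ae_filter[OF assms(1) _ assms(4)]) (auto simp: eventually_at_left_field)

text \<open>Both functions converge to their values at \<open>x\<close> along
  \<open>ess_right x\<close>, where they coincide almost everywhere. Limits from the right include
  the end point \<open>a\<close>; the end point \<open>b\<close> has to be reached in another
  way.\<close>

lemma AE_eq_imp_eq_right_continuous:
  fixes f g :: "real \<Rightarrow> real"
  assumes "AE y in lborel. y \<in> {a<..<b} \<longrightarrow> f y = g y" "a \<le> x" "x < b"
    "continuous (at_right x) f" "continuous (at_right x) g"
  shows "f x = g x"
proof (rule tendsto_unique[OF ess_right_neq_bot])
  show "(f \<longlongrightarrow> g x) (ess_right x)"
    using assms by (intro tendsto_ess_right[OF assms(1-3)]) (simp add: continuous_within)
  show "(f \<longlongrightarrow> f x) (ess_right x)"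
    using assms by (intro tendsto_ess_right[where w = f]) (auto simp: continuous_within)
qed

context
  fixes a b c :: real and u :: "real \<Rightarrow> real" and P N :: "real measure"
  assumes rep: "bv_rep a b u c P N"
begin

interpretation P: finite_borel_measure P using rep by (simp add: bv_rep_def)
interpretation N: finite_borel_measure N using rep by (simp add: bv_rep_def)

lemma rep_one_sided_limits:
  assumes "x \<in> {a<..<b}"
  shows "(u \<longlongrightarrow> c + cdf P x - cdf N x) (ess_right x)"
    and "(u \<longlongrightarrow> c + measure P {..<x} - measure N {..<x}) (ess_left x)"
proof -
  have AE: "AE y in lborel. y \<in> {a<..<b} \<longrightarrow> u y = c + cdf P y - cdf N y"
    using rep by (simp add: bv_rep_def)
  have "(cdf P \<longlongrightarrow> cdf P x) (at_right x)" "(cdf N \<longlongrightarrow> cdf N x) (at_right x)"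
    using P.cdf_is_right_cont N.cdf_is_right_cont by (auto simp: continuous_within)
  then show "(u \<longlongrightarrow> c + cdf P x - cdf N x) (ess_right x)"
    using assms by (intro tendsto_ess_right[OF AE] tendsto_intros) auto
  show "(u \<longlongrightarrow> c + measure P {..<x} - measure N {..<x}) (ess_left x)"
    using assms by (intro tendsto_ess_left[OF AE] tendsto_intros P.cdf_at_left N.cdf_at_left) auto
qed

lemma cdf_eq_left_plus_atom:
  "cdf P x = measure P {..<x} + measure P {x}" "cdf N x = measure N {..<x} + measure N {x}"
  unfolding cdf_def ivl_disj_un(2)[symmetric]
  by (rule P.finite_measure_Union N.finite_measure_Union;
      simp add: P.M_is_borel N.M_is_borel)+

lemma rep_jump_size:
  assumes "x \<in> {a<..<b}" shows "jump_size u x = \<bar>measure P {x} - measure N {x}\<bar>"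
proof -
  have "Lim (ess_right x) u = c + cdf P x - cdf N x"
    "Lim (ess_left x) u = c + measure P {..<x} - measure N {..<x}"
    using rep_one_sided_limits[OF assms] by (auto intro!: tendsto_Lim ess_right_neq_bot ess_left_neq_bot)
  then show ?thesis
    by (simp add: jump_size_def cdf_eq_left_plus_atom)
qed

lemma rep_jump_set: "jump_set a b u = {x \<in> {a<..<b}. measure P {x} \<noteq> measure N {x}}"
  unfolding jump_set_def
proof (intro Collect_cong conj_cong refl)
  fix x assume x: "x \<in> {a<..<b}"
  have "(\<exists>l r. (u \<longlongrightarrow> l) (ess_left x) \<and> (u \<longlongrightarrow> r) (ess_right x) \<and> l \<noteq> r) \<longleftrightarrow>
      c + measure P {..<x} - measure N {..<x} \<noteq> c + cdf P x - cdf N x"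
    using rep_one_sided_limits[OF x] tendsto_unique[OF ess_right_neq_bot] tendsto_unique[OF ess_left_neq_bot]
    by metis
  then show "(\<exists>l r. (u \<longlongrightarrow> l) (ess_left x) \<and> (u \<longlongrightarrow> r) (ess_right x) \<and> l \<noteq> r) \<longleftrightarrow>
      measure P {x} \<noteq> measure N {x}"
    by (auto simp: cdf_eq_left_plus_atom)
qed

end

section \<open>The variation term as a functional of the measure |Du|\<close>

definition atoms :: "real measure \<Rightarrow> real set" where
  "atoms \<tau> = {x. measure \<tau> {x} \<noteq> 0}"

text \<open>For P + N with a mutually singular representing pair and \<open>I = UNIV\<close> this is
  \<open>TV_K\<close>. The sign of the derivative has disappeared, so functions can be compared
  through inequalities between measures; the set \<open>I\<close> allows the energy to be
  localised.\<close>

definition energy :: "(real \<Rightarrow> real) \<Rightarrow> real measure \<Rightarrow> real set \<Rightarrow> ennreal" where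
  "energy K \<tau> I = emeasure \<tau> (I - atoms \<tau>) + (\<Sum>\<^sub>\<infinity>x\<in>I \<inter> atoms \<tau>. ennreal (K (measure \<tau> {x})))"

lemma countable_atoms:
  assumes "finite_borel_measure \<tau>" shows "countable (atoms \<tau>)"
proof -
  have "atoms \<tau> = {x. measure \<tau> {x} > 0}"
    by (auto simp: atoms_def zero_less_measure_iff)
  then show ?thesis
    using finite_borel_measure.countable_atoms[OF assms] by simp
qed

lemma borel_atoms: "finite_borel_measure \<tau> \<Longrightarrow> atoms \<tau> \<in> sets borel"
  by (rule sets.countable[OF _ countable_atoms]) auto

lemma infsum_ennreal_mono_neutral:
  fixes f g :: "'a \<Rightarrow> ennreal"
  assumes "\<And>x. x \<in> A \<Longrightarrow> x \<in> B \<Longrightarrow> f x \<le> g x" "\<And>x. x \<in> A \<Longrightarrow> x \<notin> B \<Longrightarrow> f x = 0"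
  shows "infsum f A \<le> infsum g B"
  using assms by (intro infsum_mono_neutral nonneg_summable_on_complete) auto

text \<open>The two diffuse parts are taken off different atom sets. Points of \<open>I\<close> that
  are atoms of \<open>\<tau>\<close> but not of \<open>\<sigma>\<close> are countably many and
  \<open>\<sigma>\<close>-null, so the atoms of the larger measure can be removed on both sides; the
  jumps are then compared one by one through the monotonicity of \<open>K\<close>.\<close>

lemma energy_mono:
  assumes \<sigma>: "finite_borel_measure \<sigma>" and \<tau>: "finite_borel_measure \<tau>" and K: "mono_on {0..} K"
    and I: "I \<in> sets borel" and le: "\<And>X. X \<in> sets borel \<Longrightarrow> X \<subseteq> I \<Longrightarrow> emeasure \<sigma> X \<le> emeasure \<tau> X"
  shows "energy K \<sigma> I \<le> energy K \<tau> I"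
proof -
  interpret S: finite_borel_measure \<sigma> by (rule \<sigma>)
  interpret T: finite_borel_measure \<tau> by (rule \<tau>)
  note [simp] = S.M_is_borel T.M_is_borel borel_atoms[OF \<sigma>] borel_atoms[OF \<tau>] I
  have le': "measure \<sigma> {x} \<le> measure \<tau> {x}" if "x \<in> I" for x
    using le[of "{x}"] that by (simp add: S.emeasure_eq_measure T.emeasure_eq_measure)
  have sub: "I \<inter> atoms \<sigma> \<subseteq> atoms \<tau>"
    using le' by (force simp: atoms_def intro: antisym)
  have "(\<Union>x\<in>I \<inter> (atoms \<tau> - atoms \<sigma>). {x}) \<in> null_sets \<sigma>"
    using countable_atoms[OF \<tau>] by (intro null_sets_UN') (auto simp: null_sets_def atoms_def S.emeasure_eq_measure)
  then have null: "emeasure \<sigma> (I \<inter> (atoms \<tau> - atoms \<sigma>)) = 0"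
    by (simp add: null_sets_def)
  have "emeasure \<sigma> (I - atoms \<sigma>) \<le> emeasure \<sigma> ((I - atoms \<tau>) \<union> (I \<inter> (atoms \<tau> - atoms \<sigma>)))"
    by (intro emeasure_mono) (auto simp: sets.Un sets.Diff sets.Int)
  also have "\<dots> \<le> emeasure \<sigma> (I - atoms \<tau>) + emeasure \<sigma> (I \<inter> (atoms \<tau> - atoms \<sigma>))"
    by (intro emeasure_subadditive) (simp_all add: sets.Diff sets.Int)
  also have "\<dots> \<le> emeasure \<tau> (I - atoms \<tau>)"
    unfolding null using le[of "I - atoms \<tau>"] by (simp add: sets.Diff)
  finally have 1: "emeasure \<sigma> (I - atoms \<sigma>) \<le> emeasure \<tau> (I - atoms \<tau>)" .
  have "(\<Sum>\<^sub>\<infinity>x\<in>I \<inter> atoms \<sigma>. ennreal (K (measure \<sigma> {x}))) \<le> (\<Sum>\<^sub>\<infinity>x\<in>I \<inter> atoms \<tau>. ennreal (K (measure \<tau> {x})))"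
    using sub le' by (intro infsum_ennreal_mono_neutral ennreal_leI mono_onD[OF K]) auto
  with 1 show ?thesis
    unfolding energy_def by (rule add_mono)
qed

lemma energy_Un:
  assumes \<tau>: "finite_borel_measure \<tau>" and "I \<in> sets borel" "J \<in> sets borel" "I \<inter> J = {}"
  shows "energy K \<tau> (I \<union> J) = energy K \<tau> I + energy K \<tau> J"
proof -
  interpret T: finite_borel_measure \<tau> by (rule \<tau>)
  note [simp] = T.M_is_borel borel_atoms[OF \<tau>] assms(2,3)
  have "emeasure \<tau> (I \<union> J - atoms \<tau>) = emeasure \<tau> (I - atoms \<tau>) + emeasure \<tau> (J - atoms \<tau>)"
    using assms(4) by (subst plus_emeasure) (auto simp: Un_Diff)
  moreover have "(\<Sum>\<^sub>\<infinity>x\<in>(I \<union> J) \<inter> atoms \<tau>. ennreal (K (measure \<tau> {x}))) =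
      (\<Sum>\<^sub>\<infinity>x\<in>I \<inter> atoms \<tau>. ennreal (K (measure \<tau> {x}))) + (\<Sum>\<^sub>\<infinity>x\<in>J \<inter> atoms \<tau>. ennreal (K (measure \<tau> {x})))"
    unfolding Int_Un_distrib2
    using assms(4) by (intro infsum_Un_disjoint nonneg_summable_on_complete) auto
  ultimately show ?thesis
    by (simp add: energy_def ac_simps)
qed

lemma mutually_singular_singleton:
  assumes "finite_borel_measure P" "finite_borel_measure N" "mutually_singular P N"
  shows "measure P {x} = 0 \<or> measure N {x} = 0"
proof -
  obtain A where A: "A \<in> sets borel" "emeasure P (- A) = 0" "emeasure N A = 0"
    using assms(3) by (auto simp: mutually_singular_def)
  note [simp] = assms(1,2)[THEN finite_borel_measure.M_is_borel]
  show ?thesis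
  proof (cases "x \<in> A")
    case True
    then have "emeasure N {x} = 0" using A by (intro emeasure_eq_0[OF _ A(3)]) auto
    then show ?thesis by (simp add: measure_def)
  next
    case False
    then have "emeasure P {x} = 0" using A by (intro emeasure_eq_0[OF _ A(2)]) auto
    then show ?thesis by (simp add: measure_def)
  qed
qed

lemma measure_singleton_outside:
  assumes "finite_borel_measure P" "emeasure P (- {a<..<b}) = 0" "x \<notin> {a<..<b}"
  shows "measure P {x} = 0"
proof -
  have "emeasure P {x} = 0"
    using assms(3) by (intro emeasure_eq_0[OF _ assms(2)]) (auto simp: finite_borel_measure.M_is_borel[OF assms(1)])
  then show ?thesis by (simp add: measure_def)
qed

text \<open>At each point at most one of two mutually singular measures has mass, so |P{x} - N{x}| =
  P{x} + N{x}.\<close>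

lemma rep_jump_set_eq_atoms:
  assumes rep: "bv_rep a b u c P N" and sing: "mutually_singular P N"
  shows "jump_set a b u = atoms (add_measure P N)"
    and "x \<in> atoms (add_measure P N) \<Longrightarrow> jump_size u x = measure (add_measure P N) {x}"
proof -
  have P: "finite_borel_measure P" and N: "finite_borel_measure N" and
    conc: "emeasure P (- {a<..<b}) = 0" "emeasure N (- {a<..<b}) = 0"
    using rep by (auto simp: bv_rep_def)
  have *: "x \<in> {a<..<b}" if "x \<in> atoms (add_measure P N)" for x
    using that measure_singleton_outside[OF P conc(1), of x] measure_singleton_outside[OF N conc(2), of x]
    by (cases "x \<in> {a<..<b}") (auto simp: atoms_def measure_add_measure[OF P N])
  show "jump_set a b u = atoms (add_measure P N)"
    unfolding rep_jump_set[OF rep] using * mutually_singular_singleton[OF P N sing]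
    by (auto simp: atoms_def measure_add_measure[OF P N]) (metis add.right_neutral add.left_neutral)+
  show "jump_size u x = measure (add_measure P N) {x}" if "x \<in> atoms (add_measure P N)"
    using rep_jump_size[OF rep *[OF that]] mutually_singular_singleton[OF P N sing, of x]
    by (auto simp: measure_add_measure[OF P N])
qed

lemma TV_K_eq_energy:
  assumes rep: "bv_rep a b u c P N" and sing: "mutually_singular P N"
    and abs: "\<And>X. X \<in> sets borel \<Longrightarrow> abs_deriv a b u (X \<inter> {a<..<b}) = emeasure P X + emeasure N X"
  shows "TV_K K a b u = energy K (add_measure P N) UNIV"
proof -
  have P: "finite_borel_measure P" and N: "finite_borel_measure N"
    using rep by (auto simp: bv_rep_def)
  let ?T = "add_measure P N"
  have b: "atoms ?T \<in> sets borel"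
    by (intro borel_atoms finite_borel_add_measure P N)
  have "{a<..<b} - atoms ?T = (UNIV - atoms ?T) \<inter> {a<..<b}" by blast
  then have "abs_deriv a b u ({a<..<b} - atoms ?T) = emeasure ?T (UNIV - atoms ?T)"
    using abs[of "UNIV - atoms ?T"] b by (simp add: emeasure_add_measure[OF P N])
  moreover have "(\<Sum>\<^sub>\<infinity>x\<in>atoms ?T. ennreal (K (jump_size u x))) = (\<Sum>\<^sub>\<infinity>x\<in>UNIV \<inter> atoms ?T. ennreal (K (measure ?T {x})))"
    using rep_jump_set_eq_atoms(2)[OF rep sing] by (intro infsum_cong_neutral) auto
  ultimately show ?thesis
    by (simp add: TV_K_def energy_def rep_jump_set_eq_atoms(1)[OF rep sing])
qed

section \<open>Comparison of different representing pairs\<close>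

lemma cdf_concentrated:
  assumes P: "finite_borel_measure P" and conc: "emeasure P (- {a<..<b}) = 0"
  shows "x \<le> a \<Longrightarrow> cdf P x = 0" "b \<le> x \<Longrightarrow> cdf P x = measure P {..<b}"
proof -
  interpret P: finite_borel_measure P by (rule P)
  note [simp] = P.M_is_borel
  have 0: "measure P X = 0" if "X \<in> sets borel" "X \<subseteq> - {a<..<b}" for X
  proof -
    have "emeasure P X = 0" using that by (intro emeasure_eq_0[OF _ conc]) auto
    then show ?thesis by (simp add: measure_def)
  qed
  show "x \<le> a \<Longrightarrow> cdf P x = 0" unfolding cdf_def by (rule 0) auto
  assume "b \<le> x"
  then have "{..x} = {..<b} \<union> {b..x}" by auto
  moreover have "measure P ({..<b} \<union> {b..x}) = measure P {..<b} + measure P {b..x}"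
    by (rule P.finite_measure_Union) auto
  ultimately have "measure P {..x} = measure P {..<b} + measure P {b..x}"
    by simp
  then show "cdf P x = measure P {..<b}"
    using 0[of "{b..x}"] by (simp add: cdf_def subset_iff)
qed

text \<open>Right-continuous representatives agree on [a, b). All distribution functions vanish at
  \<open>a\<close>, which isolates the constants; at \<open>b\<close> the measures have no mass, so
  the value there is the limit from the left.\<close>

lemma rep_unique:
  assumes ab: "a < b" and rep: "bv_rep a b u c P N" and rep': "bv_rep a b u c' P' N'"
  shows "c = c'" "cdf P x - cdf N x = cdf P' x - cdf N' x"
proof -
  have P: "finite_borel_measure P" and N: "finite_borel_measure N" and
    P': "finite_borel_measure P'" and N': "finite_borel_measure N'" and
    conc: "emeasure P (- {a<..<b}) = 0" "emeasure N (- {a<..<b}) = 0"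
    "emeasure P' (- {a<..<b}) = 0" "emeasure N' (- {a<..<b}) = 0" and
    AE: "AE x in lborel. x \<in> {a<..<b} \<longrightarrow> u x = c + cdf P x - cdf N x"
    "AE x in lborel. x \<in> {a<..<b} \<longrightarrow> u x = c' + cdf P' x - cdf N' x"
    using rep rep' by (auto simp: bv_rep_def)
  have "AE x in lborel. x \<in> {a<..<b} \<longrightarrow> c + cdf P x - cdf N x = c' + cdf P' x - cdf N' x"
    using AE by eventually_elim auto
  note inside = AE_eq_imp_eq_right_continuous[OF this]
  have eq: "c + cdf P x - cdf N x = c' + cdf P' x - cdf N' x" if "a \<le> x" "x < b" for x
    using that P N P' N' by (intro inside continuous_intros finite_borel_measure.cdf_is_right_cont)
  show c: "c = c'"
    using eq[of a] ab by (simp add: cdf_concentrated(1)[OF P conc(1)] cdf_concentrated(1)[OF N conc(2)]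
        cdf_concentrated(1)[OF P' conc(3)] cdf_concentrated(1)[OF N' conc(4)])
  have left: "measure P {..<b} - measure N {..<b} = measure P' {..<b} - measure N' {..<b}"
  proof (rule tendsto_unique[of "at_left b"])
    show "((\<lambda>x. cdf P x - cdf N x) \<longlongrightarrow> measure P {..<b} - measure N {..<b}) (at_left b)"
      using P N by (intro tendsto_intros finite_borel_measure.cdf_at_left)
    have "((\<lambda>x. cdf P' x - cdf N' x) \<longlongrightarrow> measure P' {..<b} - measure N' {..<b}) (at_left b)"
      using P' N' by (intro tendsto_intros finite_borel_measure.cdf_at_left)
    moreover have "\<forall>\<^sub>F x in at_left b. cdf P' x - cdf N' x = cdf P x - cdf N x"
      unfolding eventually_at_left_field using eq c ab by (intro exI[of _ a]) force
    ultimately show "((\<lambda>x. cdf P x - cdf N x) \<longlongrightarrow> measure P' {..<b} - measure N' {..<b}) (at_left b)"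
      by (rule Lim_transform_eventually)
  qed simp
  consider "x \<le> a" | "a < x" "x < b" | "b \<le> x" by linarith
  then show "cdf P x - cdf N x = cdf P' x - cdf N' x"
  proof cases
    case 1
    then show ?thesis
      by (simp add: cdf_concentrated(1)[OF P conc(1)] cdf_concentrated(1)[OF N conc(2)]
        cdf_concentrated(1)[OF P' conc(3)] cdf_concentrated(1)[OF N' conc(4)])
  next
    case 2
    then show ?thesis using eq[of x] c by simp
  next
    case 3
    then show ?thesis
      using left by (simp add: cdf_concentrated(2)[OF P conc(1)] cdf_concentrated(2)[OF N conc(2)]
        cdf_concentrated(2)[OF P' conc(3)] cdf_concentrated(2)[OF N' conc(4)])
  qed
qed

text \<open>Mass common to \<open>P\<close> and \<open>N\<close> is counted in \<open>energy\<close>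
  but cancels in \<open>u\<close>, hence only an inequality. It is the direction required of
  competitors, which may then be given by any convenient pair.\<close>

lemma TV_K_le_energy:
  assumes ab: "a < b" and rep: "bv_rep a b u c P N" and K: "mono_on {0..} K"
  shows "TV_K K a b u \<le> energy K (add_measure P N) UNIV"
proof -
  obtain c0 P0 N0 where r: "bv_rep a b u c0 P0 N0" "mutually_singular P0 N0"
    "\<And>X. X \<in> sets borel \<Longrightarrow> abs_deriv a b u (X \<inter> {a<..<b}) = emeasure P0 X + emeasure N0 X"
    using BV_rep[OF ab BV_if_rep[OF ab rep]] by metis
  have f: "finite_borel_measure P0" "finite_borel_measure N0" "finite_borel_measure P" "finite_borel_measure N"
    using rep r(1) by (auto simp: bv_rep_def)
  have "energy K (add_measure P0 N0) UNIV \<le> energy K (add_measure P N) UNIV"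
    using f jordan_decomposition_minimal[OF f r(2) rep_unique(2)[OF ab r(1) rep]]
    by (intro energy_mono finite_borel_add_measure K) (auto simp: emeasure_add_measure intro: add_mono)
  then show ?thesis
    by (simp add: TV_K_eq_energy[OF r])
qed

section \<open>The cost of jumps\<close>

lemma finite_subset_small_rest:
  assumes \<tau>: "finite_borel_measure \<tau>" and A: "countable A" and "\<epsilon> > 0"
  obtains F where "finite F" "F \<subseteq> A" "measure \<tau> (A - F) < \<epsilon>"
proof (cases "finite A")
  case True
  then show ?thesis using assms(3) by (intro that[of A]) simp_all
next
  case False
  interpret T: finite_borel_measure \<tau> by (rule \<tau>)
  define F where "F n = from_nat_into A ` {..<n}" for n
  have "A \<noteq> {}" using False by blast
  then have inA: "from_nat_into A n \<in> A" for n
    by (rule from_nat_into)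
  have "A - F n \<in> sets \<tau>" for n
  proof -
    have "A \<in> sets borel"
      by (rule sets.countable[OF _ A]) simp
    moreover have "F n \<in> sets borel"
      by (rule sets.countable) (simp_all add: F_def)
    ultimately show ?thesis unfolding T.M_is_borel by (rule sets.Diff)
  qed
  then have "(\<lambda>n. measure \<tau> (A - F n)) \<longlonglongrightarrow> measure \<tau> (\<Inter>n. A - F n)"
  proof (intro T.finite_Lim_measure_decseq)
    have "F m \<subseteq> F n" if "m \<le> n" for m n
      unfolding F_def using that by (intro image_mono) simp
    then show "decseq (\<lambda>n. A - F n)"
      unfolding decseq_def by blast
  qed blast
  also have "(\<Inter>n. A - F n) = {}"
  proof -
    have "x \<in> F (Suc (to_nat_on A x))" if "x \<in> A" for x
    proof -
      have "x = from_nat_into A (to_nat_on A x)"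
        using from_nat_into_to_nat_on[OF A that] by simp
      then show ?thesis unfolding F_def by blast
    qed
    then show ?thesis by blast
  qed
  finally have "(\<lambda>n. measure \<tau> (A - F n)) \<longlonglongrightarrow> 0" by simp
  then have "eventually (\<lambda>n. measure \<tau> (A - F n) < \<epsilon>) sequentially"
    by (rule order_tendstoD(2)[OF _ assms(3)])
  then obtain n where "measure \<tau> (A - F n) < \<epsilon>"
    using eventually_happens'[OF sequentially_bot] by blast
  moreover have "F n \<subseteq> A" "finite (F n)"
    using inA by (auto simp: F_def)
  ultimately show ?thesis using that by blast
qed

locale jump_cost =
  fixes K C :: "real \<Rightarrow> real"
  assumes K_nonneg: "\<rho> \<ge> 0 \<Longrightarrow> K \<rho> \<ge> 0" and K1: "K1 K" and K2: "K2 K C" and K3: "K3 K"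
begin

lemma K_mono: "mono_on {0..} K" and K_0: "K 0 = 0"
  using K1 by (auto simp: K1_def)

lemma C_pos: "M > 0 \<Longrightarrow> C M > 0"
  using K2 by (auto simp: K2_def)

lemma K_gap:
  assumes "M > 0" "r \<ge> 0" "s \<ge> 0" "r + s \<le> M"
  shows "K (r + s) + C M * r * s \<le> K r + K s"
  using K2 assms unfolding K2_def by blast

lemma K_subadditive:
  assumes "r \<ge> 0" "s \<ge> 0" shows "K (r + s) \<le> K r + K s"
proof -
  \<comment> \<open>The constant is that of \<open>r + s + 1\<close>, since (K2) asks for a positive
    M even when r = s = 0.\<close>
  have "K (r + s) + C (r + s + 1) * r * s \<le> K r + K s"
    using assms by (intro K_gap) auto
  moreover have "0 \<le> C (r + s + 1) * r * s"
    using assms C_pos[of "r + s + 1"] by (intro mult_nonneg_nonneg) auto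
  ultimately show ?thesis by linarith
qed

lemma K_sum:
  assumes "finite F" "\<And>x. x \<in> F \<Longrightarrow> f x \<ge> 0"
  shows "K (\<Sum>x\<in>F. f x) \<le> (\<Sum>x\<in>F. K (f x))"
  using assms
proof (induction F)
  case (insert x F)
  have "K (f x + sum f F) \<le> K (f x) + K (sum f F)"
    using insert.prems by (intro K_subadditive sum_nonneg) auto
  with insert show ?case by simp
qed (simp add: K_0)

text \<open>Cutting r into n equal pieces, subadditivity gives K(r) \<le> n K(r/n), and by (K3) the
  right side tends to r.\<close>

lemma K_le:
  assumes "r \<ge> 0" shows "K r \<le> r"
proof (cases "r = 0")
  case False
  with assms have r: "r > 0" by simp
  define q where "q n = r / real (Suc n)" for n
  have "filterlim q (at_right 0) sequentially"
  proof -
    have "(\<lambda>n. r * inverse (real (Suc n))) \<longlonglongrightarrow> r * 0"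
      by (intro tendsto_intros LIMSEQ_inverse_real_of_nat)
    then have "q \<longlonglongrightarrow> 0"
      by (simp add: q_def[abs_def] field_simps)
    then show ?thesis
      using r by (auto simp: filterlim_at q_def)
  qed
  then have "(\<lambda>n. K (q n) / q n) \<longlonglongrightarrow> 1"
    using K3 unfolding K3_def by (rule filterlim_compose[rotated])
  then have "(\<lambda>n. r * (K (q n) / q n)) \<longlonglongrightarrow> r * 1"
    by (intro tendsto_intros)
  moreover have "K r \<le> r * (K (q n) / q n)" for n
  proof -
    have "K r = K (\<Sum>i<Suc n. q n)" by (simp add: q_def del: of_nat_Suc)
    also have "\<dots> \<le> (\<Sum>i<Suc n. K (q n))"
      using r by (intro K_sum) (auto simp: q_def)
    also have "\<dots> = r * (K (q n) / q n)"
      using r by (simp add: q_def)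
    finally show ?thesis .
  qed
  ultimately show ?thesis
    using LIMSEQ_le_const[of _ "r * 1" "K r"] by auto
qed (simp add: K_0)

text \<open>Finitely many atoms carrying all but \<open>e\<close> of the atomic mass are merged by
  subadditivity, and the remaining mass is estimated by K(r) \<le> r. The meaning is that collapsing
  \<open>I\<close> to a single jump never costs more, whatever the structure of the diffuse
  part.\<close>

lemma K_measure_le_energy:
  assumes \<tau>: "finite_borel_measure \<tau>" and I: "I \<in> sets borel"
  shows "ennreal (K (measure \<tau> I)) \<le> energy K \<tau> I"
proof (rule ennreal_le_epsilon)
  interpret T: finite_borel_measure \<tau> by (rule \<tau>)
  note [simp] = T.M_is_borel borel_atoms[OF \<tau>] I
  fix e :: real assume "0 < e"
  obtain F where F: "finite F" "F \<subseteq> I \<inter> atoms \<tau>" "measure \<tau> (I \<inter> atoms \<tau> - F) < e"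
    using finite_subset_small_rest[OF \<tau> countable_Int2[OF countable_atoms[OF \<tau>]] \<open>0 < e\<close>] by blast
  have Fb: "F \<in> sets borel"
    by (rule sets.countable[OF _ countable_finite[OF F(1)]]) simp
  note [simp] = Fb
  have "measure \<tau> I = measure \<tau> F + measure \<tau> (I - F)"
  proof -
    have "measure \<tau> (F \<union> (I - F)) = measure \<tau> F + measure \<tau> (I - F)"
      by (rule T.finite_measure_Union) (auto simp: sets.Diff)
    moreover have "F \<union> (I - F) = I" using F by blast
    ultimately show ?thesis by simp
  qed
  also have "measure \<tau> F = (\<Sum>x\<in>F. measure \<tau> {x})"
    using F(1) by (intro T.finite_measure_eq_sum_singleton) auto
  finally have "K (measure \<tau> I) \<le> K (\<Sum>x\<in>F. measure \<tau> {x}) + K (measure \<tau> (I - F))"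
    using K_subadditive[of "\<Sum>x\<in>F. measure \<tau> {x}" "measure \<tau> (I - F)"] by (simp add: sum_nonneg)
  also have "\<dots> \<le> (\<Sum>x\<in>F. K (measure \<tau> {x})) + measure \<tau> (I - F)"
    using F(1) by (intro add_mono K_sum K_le) auto
  also have "measure \<tau> (I - F) \<le> measure \<tau> (I - atoms \<tau>) + e"
  proof -
    have "measure \<tau> (I - F) = measure \<tau> ((I - atoms \<tau>) \<union> (I \<inter> atoms \<tau> - F))"
      using F(2) by (intro arg_cong[where f = "measure \<tau>"]) auto
    also have "\<dots> \<le> measure \<tau> (I - atoms \<tau>) + measure \<tau> (I \<inter> atoms \<tau> - F)"
      by (intro measure_subadditive) (auto simp: sets.Diff sets.Int)
    finally show ?thesis using F(3) by simp
  qed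
  finally have "ennreal (K (measure \<tau> I)) \<le> ennreal ((\<Sum>x\<in>F. K (measure \<tau> {x})) + (measure \<tau> (I - atoms \<tau>) + e))"
    by (intro ennreal_leI) simp
  also have "\<dots> = (\<Sum>x\<in>F. ennreal (K (measure \<tau> {x}))) + (emeasure \<tau> (I - atoms \<tau>) + ennreal e)"
    using \<open>0 < e\<close> unfolding T.emeasure_eq_measure
    by (simp add: K_nonneg sum_nonneg)
  also have "(\<Sum>x\<in>F. ennreal (K (measure \<tau> {x}))) \<le> (\<Sum>\<^sub>\<infinity>x\<in>I \<inter> atoms \<tau>. ennreal (K (measure \<tau> {x})))"
    unfolding infsum_finite[OF F(1), symmetric]
    using F(2) by (intro infsum_ennreal_mono_neutral) auto
  finally show "ennreal (K (measure \<tau> I)) \<le> energy K \<tau> I + ennreal e"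
    by (simp add: energy_def ac_simps)
qed

text \<open>Collapse in two stages: \<open>I\<close> and \<open>J\<close> are each merged into one
  jump by \<open>K_measure_le_energy\<close>, and the merging of these two jumps is measured by
  (K2). The gain comes from this last stage.\<close>

lemma energy_merge_gap:
  assumes \<tau>: "finite_borel_measure \<tau>" and I: "I \<in> sets borel" "J \<in> sets borel" "I \<inter> J = {}"
    and M: "M > 0" "measure \<tau> (I \<union> J) \<le> M"
  shows "ennreal (K (measure \<tau> (I \<union> J)) + C M * measure \<tau> I * measure \<tau> J) \<le> energy K \<tau> (I \<union> J)"
proof -
  interpret T: finite_borel_measure \<tau> by (rule \<tau>)
  have eq: "measure \<tau> (I \<union> J) = measure \<tau> I + measure \<tau> J"
    using I by (intro T.finite_measure_Union) (auto simp: T.M_is_borel)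
  have "K (measure \<tau> (I \<union> J)) + C M * measure \<tau> I * measure \<tau> J \<le> K (measure \<tau> I) + K (measure \<tau> J)"
    unfolding eq using M by (intro K_gap) (auto simp: eq)
  then have "ennreal (K (measure \<tau> (I \<union> J)) + C M * measure \<tau> I * measure \<tau> J)
      \<le> ennreal (K (measure \<tau> I)) + ennreal (K (measure \<tau> J))"
    by (simp add: K_nonneg ennreal_leI flip: ennreal_plus)
  also have "\<dots> \<le> energy K \<tau> I + energy K \<tau> J"
    using \<tau> I by (intro add_mono K_measure_le_energy)
  finally show ?thesis
    using energy_Un[OF \<tau> I] by simp
qed

end

section \<open>Minimizers for increasing data\<close>

text \<open>\<open>interval_measure\<close> sees only increments of \<open>F\<close>; the value 0 to
  the left of \<open>a\<close> fixes the additive constant through the limit at minus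
  infinity.\<close>

lemma interval_measure_of_cdf:
  assumes mono: "\<And>x y. x \<le> y \<Longrightarrow> F x \<le> F y" and rc: "\<And>x. continuous (at_right x) F"
    and left: "\<And>x. x \<le> a \<Longrightarrow> F x = 0" and right: "\<And>x. b \<le> x \<Longrightarrow> F x = F b" and "a < b"
  shows "finite_borel_measure (interval_measure F)" "cdf (interval_measure F) x = F x"
proof -
  have bot: "(F \<longlongrightarrow> 0) at_bot"
    by (rule tendsto_eventually[OF eventually_mono[OF eventually_le_at_bot left]])
  have top: "(F \<longlongrightarrow> F b) at_top"
    by (rule tendsto_eventually[OF eventually_mono[OF eventually_ge_at_top right]])
  show fb: "finite_borel_measure (interval_measure F)"
    using mono[of a b] left[of a] \<open>a < b\<close>
    by (intro finite_borel_measure_interval_measure[OF mono rc bot top]) auto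
  then interpret F: finite_borel_measure "interval_measure F" .
  have "cdf (interval_measure F) x - cdf (interval_measure F) y = F x - F y" if "y < x" for y
    using that mono rc by (simp add: F.cdf_diff_eq measure_interval_measure_Ioc)
  then have "\<forall>\<^sub>F y in at_bot. F x - F y = cdf (interval_measure F) x - cdf (interval_measure F) y"
    unfolding eventually_at_bot_dense by (intro exI[of _ x]) force
  then have L1: "((\<lambda>y. cdf (interval_measure F) x - cdf (interval_measure F) y) \<longlongrightarrow> F x - 0) at_bot"
    by (rule Lim_transform_eventually[rotated]) (intro tendsto_intros bot)
  have L2: "((\<lambda>y. cdf (interval_measure F) x - cdf (interval_measure F) y) \<longlongrightarrow>
      cdf (interval_measure F) x - 0) at_bot"
    by (intro tendsto_intros F.cdf_lim_at_bot)
  show "cdf (interval_measure F) x = F x"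
    using tendsto_unique[OF trivial_limit_at_bot_linorder L1 L2] by simp
qed

text \<open>Up to constants, (cdf \<tau> + V)/2 and (cdf \<tau> - V)/2 are nondecreasing by the
  domination. Their measures need not be mutually singular, but they add up to \<open>\<tau>\<close>
  exactly, so a competitor built in this way is charged the energy of \<open>\<tau>\<close> and no
  more.\<close>

lemma bv_of_dominated:
  assumes \<tau>: "finite_borel_measure \<tau>" and conc: "emeasure \<tau> (- {a<..<b}) = 0" and "a < b"
    and cont: "\<And>x. continuous (at_right x) V"
    and dom: "\<And>x y. x \<le> y \<Longrightarrow> \<bar>V y - V x\<bar> \<le> cdf \<tau> y - cdf \<tau> x"
  obtains c P N where "finite_borel_measure P" "finite_borel_measure N"
    "emeasure P (- {a<..<b}) = 0" "emeasure N (- {a<..<b}) = 0"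
    "\<And>x. V x = c + cdf P x - cdf N x" "add_measure P N = \<tau>"
proof -
  interpret T: finite_borel_measure \<tau> by (rule \<tau>)
  define W where "W s x = (cdf \<tau> x + s * (V x - V a)) / 2" for s x
  have W: "finite_borel_measure (interval_measure (W s))" "cdf (interval_measure (W s)) x = W s x"
    if s: "\<bar>s\<bar> = 1" for s x
  proof -
    have mono: "W s x \<le> W s y" if "x \<le> y" for x y
    proof -
      have "s * V x - s * V y \<le> \<bar>V y - V x\<bar>"
        using s by (auto simp: abs_if split: if_splits)
      then show ?thesis
        using dom[OF that] by (simp add: W_def right_diff_distrib)
    qed
    have rc: "continuous (at_right x) (W s)" for x
      unfolding W_def[abs_def] by (intro continuous_intros cont T.cdf_is_right_cont) simp
    have left: "W s x = 0" if "x \<le> a" for x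
      using dom[OF that] cdf_concentrated(1)[OF \<tau> conc] that by (simp add: W_def)
    have right: "W s x = W s b" if "b \<le> x" for x
      using dom[OF that] cdf_concentrated(2)[OF \<tau> conc, of x] cdf_concentrated(2)[OF \<tau> conc, of b] that
      by (simp add: W_def)
    show "finite_borel_measure (interval_measure (W s))" "cdf (interval_measure (W s)) x = W s x"
      using interval_measure_of_cdf[where F = "W s" and a = a and b = b, OF mono rc left right \<open>a < b\<close>] by blast+
  qed
  define P N where "P = interval_measure (W 1)" and "N = interval_measure (W (-1))"
  have P: "finite_borel_measure P" and N: "finite_borel_measure N"
    unfolding P_def N_def by (simp_all add: W(1))
  have cdfs: "cdf P x = (cdf \<tau> x + (V x - V a)) / 2" "cdf N x = (cdf \<tau> x - (V x - V a)) / 2" for x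
    unfolding P_def N_def by (simp_all add: W(2) W_def)
  have eq: "add_measure P N = \<tau>"
  proof (rule cdf_unique'[OF finite_borel_add_measure[OF P N] \<tau>])
    show "cdf (add_measure P N) = cdf \<tau>"
      by (auto simp: cdf_add_measure[OF P N] cdfs fun_eq_iff field_simps)
  qed
  have "emeasure P X + emeasure N X = emeasure \<tau> X" for X
    using emeasure_add_measure[OF P N, of X] eq by simp
  then have "emeasure P (- {a<..<b}) = 0" "emeasure N (- {a<..<b}) = 0"
    using conc by (metis add_eq_0_iff_both_eq_0)+
  moreover have "V x = V a + cdf P x - cdf N x" for x
    by (simp add: cdfs field_simps)
  ultimately show ?thesis
    using that P N eq by blast
qed

lemma continuous_at_right_If:
  fixes f g :: "real \<Rightarrow> real"
  assumes "continuous (at_right x) f" "continuous (at_right x) g"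
  shows "continuous (at_right x) (\<lambda>y. if y < k then f y else g y)"
proof (cases "x < k")
  case True
  then have "\<forall>\<^sub>F y in at_right x. f y = (if y < k then f y else g y)"
    unfolding eventually_at_right_field by (intro exI[of _ k]) auto
  with assms(1) True show ?thesis
    unfolding continuous_within by (auto intro: Lim_transform_eventually)
next
  case False
  then have "\<forall>\<^sub>F y in at_right x. g y = (if y < k then f y else g y)"
    unfolding eventually_at_right_field by (intro exI[of _ "x + 1"]) auto
  with assms(2) False show ?thesis
    unfolding continuous_within by (auto intro: Lim_transform_eventually)
qed

text \<open>n points leave n - 1 gaps, which is the source of the summand 1 in the bound for the
  number of jumps.\<close>

lemma separated_card_le:
  fixes F :: "real set"
  assumes "finite F" "F \<noteq> {}" and gap: "\<And>x y. x \<in> F \<Longrightarrow> y \<in> F \<Longrightarrow> x < y \<Longrightarrow> r \<le> y - x"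
  shows "(real (card F) - 1) * r \<le> Max F - Min F"
  using assms
proof (induction F rule: finite_linorder_max_induct)
  case (insert x F)
  show ?case
  proof (cases "F = {}")
    case False
    have less: "Max F < x" using insert.hyps False by simp
    have "(real (card F) - 1) * r \<le> Max F - Min F"
      using False insert by auto
    moreover have "r \<le> x - Max F"
      using insert.prems(2)[of "Max F" x] less insert.hyps False by simp
    moreover have "Max (insert x F) = x"
      using insert.hyps by (intro Max_eqI) (auto simp: less_imp_le)
    moreover have "Min F < x"
      using insert.hyps Min_in[OF _ False] by blast
    then have "Min (insert x F) = Min F"
      using insert.hyps(1) False by (simp add: Min_insert)
    moreover have "real (card (insert x F)) = real (card F) + 1"
      using insert.hyps by (subst card_insert_disjoint) auto
    ultimately show ?thesis by (simp add: algebra_simps)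
  qed simp
qed simp

section \<open>The minimization problem in terms of measures\<close>

definition concentrated :: "real \<Rightarrow> real \<Rightarrow> real measure \<Rightarrow> bool" where
  "concentrated a b P \<longleftrightarrow> finite_borel_measure P \<and> emeasure P (- {a<..<b}) = 0"

definition fidelity :: "real \<Rightarrow> real \<Rightarrow> (real \<Rightarrow> real) \<Rightarrow> (real \<Rightarrow> real) \<Rightarrow> ennreal" where
  "fidelity a b g w = (\<integral>\<^sup>+x\<in>{a<..<b}. ennreal (\<bar>w x - g x\<bar>\<^sup>2) \<partial>lborel)"

text \<open>
  The datum \<open>g\<close> is extended by constants to the whole line. Competitors are described by pairs of
  measures rather than by functions, so that the decreasing case reduces to the increasing one by
  exchanging \<open>P\<close> and \<open>N\<close>.
\<close>

locale minimizer = jump_cost K C for K C :: "real \<Rightarrow> real" +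
  fixes a b lam M c :: real and g :: "real \<Rightarrow> real" and P N :: "real measure"
  assumes ab: "a < b" and lam: "lam > 0" and M: "M > 0" "M \<ge> g b - g a"
    and g_cont: "continuous_on UNIV g" and g_mono: "mono g"
    and conc_P: "concentrated a b P" and conc_N: "concentrated a b N"
    and singular: "mutually_singular P N"
    and minimal: "\<And>c' P' N'. concentrated a b P' \<Longrightarrow> concentrated a b N' \<Longrightarrow>
      energy K (add_measure P N) UNIV + ennreal (lam / 2) * fidelity a b g (\<lambda>x. c + cdf P x - cdf N x)
      \<le> energy K (add_measure P' N') UNIV + ennreal (lam / 2) * fidelity a b g (\<lambda>x. c' + cdf P' x - cdf N' x)"
begin

sublocale P: finite_borel_measure P
  using conc_P by (simp add: concentrated_def)

sublocale N: finite_borel_measure N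
  using conc_N by (simp add: concentrated_def)

lemma finite_P: "finite_borel_measure P" and finite_N: "finite_borel_measure N"
  by unfold_locales

definition \<tau> where "\<tau> = add_measure P N"
definition w where "w x = c + cdf P x - cdf N x"
text \<open>A real-valued form of \<open>fidelity\<close>, so that two fidelities can be
  subtracted.\<close>

definition defect where "defect v = (LINT x|lborel. indicator {a<..<b} x * (v x - g x)\<^sup>2)"

sublocale T: finite_borel_measure \<tau>
  unfolding \<tau>_def by (intro finite_borel_add_measure finite_P finite_N)

lemma \<tau>_concentrated: "emeasure \<tau> (- {a<..<b}) = 0"
  using conc_P conc_N by (simp add: \<tau>_def concentrated_def emeasure_add_measure)

lemma cdf_\<tau>: "cdf \<tau> x = cdf P x + cdf N x"
  by (simp add: \<tau>_def cdf_add_measure finite_P finite_N)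

lemma w_dominated: "x \<le> y \<Longrightarrow> \<bar>w y - w x\<bar> \<le> cdf \<tau> y - cdf \<tau> x"
  using P.cdf_nondecreasing[of x y] N.cdf_nondecreasing[of x y] by (simp add: w_def cdf_\<tau>)

lemma w_right_cont: "continuous (at_right x) w"
  unfolding w_def[abs_def] by (intro continuous_intros P.cdf_is_right_cont N.cdf_is_right_cont)

lemma rep_borel: "finite_borel_measure P' \<Longrightarrow> finite_borel_measure N' \<Longrightarrow> (\<lambda>x. c' + cdf P' x - cdf N' x) \<in> borel_measurable borel"
  using cdf_borel_measurable[of P'] cdf_borel_measurable[of N'] by measurable

lemma rep_bounded:
  assumes "finite_borel_measure P'" "finite_borel_measure N'"
  shows "\<bar>c' + cdf P' x - cdf N' x\<bar> \<le> \<bar>c'\<bar> + measure P' (space P') + measure N' (space N')"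
  using finite_borel_measure.cdf_nonneg[OF assms(1), of x] finite_borel_measure.cdf_nonneg[OF assms(2), of x]
    finite_borel_measure.cdf_bounded[OF assms(1), of x] finite_borel_measure.cdf_bounded[OF assms(2), of x]
  by linarith

lemma defect_integrable:
  assumes [measurable]: "v \<in> borel_measurable borel" and B: "\<And>x. \<bar>v x\<bar> \<le> B"
  shows "integrable lborel (\<lambda>x. indicator {a<..<b} x * (v x - g x)\<^sup>2)"
proof -
  have [measurable]: "g \<in> borel_measurable borel"
    using g_cont by (rule borel_measurable_continuous_onI)
  have "integrable lborel (\<lambda>x. indicator {a<..<b} x *\<^sub>R (v x - g x)\<^sup>2)"
  proof (rule integrableI_bounded_set_indicator[where B = "(B + (\<bar>g a\<bar> + \<bar>g b\<bar>))\<^sup>2"])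
    show "AE x in lborel. x \<in> {a<..<b} \<longrightarrow> norm ((v x - g x)\<^sup>2) \<le> (B + (\<bar>g a\<bar> + \<bar>g b\<bar>))\<^sup>2"
    proof (rule AE_I2, rule impI)
      fix x assume "x \<in> {a<..<b}"
      then have "g a \<le> g x" "g x \<le> g b"
        using g_mono by (auto simp: mono_def)
      then have "\<bar>v x - g x\<bar> \<le> B + (\<bar>g a\<bar> + \<bar>g b\<bar>)"
        using B[of x] by linarith
      then show "norm ((v x - g x)\<^sup>2) \<le> (B + (\<bar>g a\<bar> + \<bar>g b\<bar>))\<^sup>2"
        by (simp add: abs_le_square_iff[symmetric])
    qed
    show "emeasure lborel {a<..<b} < \<infinity>" using ab by simp
  qed auto
  then show ?thesis by simp
qed

lemma defect_nonneg: "0 \<le> defect v"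
  unfolding defect_def by (intro integral_nonneg_AE) auto

lemma fidelity_eq_defect:
  assumes "v \<in> borel_measurable borel" "\<And>x. \<bar>v x\<bar> \<le> B"
  shows "fidelity a b g v = ennreal (defect v)"
proof -
  have "fidelity a b g v = (\<integral>\<^sup>+x. ennreal (indicator {a<..<b} x * (v x - g x)\<^sup>2) \<partial>lborel)"
    unfolding fidelity_def by (intro nn_integral_cong) (auto simp: indicator_def)
  also have "\<dots> = ennreal (defect v)"
    unfolding defect_def by (intro nn_integral_eq_integral defect_integrable[OF assms]) auto
  finally show ?thesis .
qed

lemma w_borel: "w \<in> borel_measurable borel"
  unfolding w_def[abs_def] by (rule rep_borel[OF finite_P finite_N])

lemma w_bounded: "\<bar>w x\<bar> \<le> \<bar>c\<bar> + measure P (space P) + measure N (space N)"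
  unfolding w_def by (rule rep_bounded[OF finite_P finite_N])

lemma minimal_defect:
  assumes P': "concentrated a b P'" and N': "concentrated a b N'"
    and v: "\<And>x. v x = c' + cdf P' x - cdf N' x"
  shows "energy K \<tau> UNIV + ennreal (lam / 2 * defect w) \<le> energy K (add_measure P' N') UNIV + ennreal (lam / 2 * defect v)"
proof -
  have f: "finite_borel_measure P'" "finite_borel_measure N'" using P' N' by (auto simp: concentrated_def)
  have v': "v = (\<lambda>x. c' + cdf P' x - cdf N' x)" using v by auto
  have "fidelity a b g v = ennreal (defect v)"
    unfolding v' by (rule fidelity_eq_defect[OF rep_borel[OF f] rep_bounded[OF f]])
  moreover have "fidelity a b g w = ennreal (defect w)"
    by (rule fidelity_eq_defect[OF w_borel w_bounded])
  ultimately show ?thesis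
    using minimal[OF P' N', of c'] ennreal_mult[OF _ defect_nonneg, of "lam / 2"] lam
    by (simp only: v'[symmetric] w_def[abs_def, symmetric] \<tau>_def[symmetric])
qed

lemma concentrated_null_measure: "concentrated a b (null_measure borel)"
  by (auto simp: concentrated_def intro!: finite_borel_measureI)

text \<open>Comparison with the zero function, whose energy is 0 and whose fidelity is finite.
  Finiteness is what permits cancelling energies in the extended reals.\<close>

lemma energy_finite: "energy K \<tau> UNIV < \<infinity>"
proof -
  let ?Z = "add_measure (null_measure borel) (null_measure borel)"
  have f: "finite_borel_measure (null_measure borel)"
    using concentrated_null_measure by (simp add: concentrated_def)
  have "energy K ?Z UNIV = 0"
    by (simp add: energy_def atoms_def measure_add_measure[OF f f] emeasure_add_measure[OF f f] measure_def)
  then have "energy K \<tau> UNIV + ennreal (lam / 2 * defect w) \<le>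
      ennreal (lam / 2 * defect (\<lambda>x. 0 + cdf (null_measure borel) x - cdf (null_measure borel) x))"
    using minimal_defect[OF concentrated_null_measure concentrated_null_measure,
        of "\<lambda>x. 0 + cdf (null_measure borel) x - cdf (null_measure borel) x" 0] by simp
  then have "energy K \<tau> UNIV \<le> ennreal (lam / 2 * defect (\<lambda>x. 0 + cdf (null_measure borel) x - cdf (null_measure borel) x))"
    by (rule order.trans[rotated]) simp
  then show ?thesis
    by (rule order.strict_trans1) simp
qed

text \<open>\<open>V\<close> can be realised with the same measure \<open>\<tau>\<close>, so
  minimality compares the fidelities alone. Together with \<open>closer\<close> this forces equality
  of the distances almost everywhere and, by right-continuity, everywhere in (a, b). A strict
  improvement at a single point is therefore already a contradiction.\<close>

lemma dominated_competitor:
  assumes cont: "\<And>x. continuous (at_right x) V"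
    and dom: "\<And>x y. x \<le> y \<Longrightarrow> \<bar>V y - V x\<bar> \<le> cdf \<tau> y - cdf \<tau> x"
    and closer: "\<And>x. a < x \<Longrightarrow> x < b \<Longrightarrow> \<bar>V x - g x\<bar> \<le> \<bar>w x - g x\<bar>"
    and x: "a < x" "x < b"
  shows "\<bar>V x - g x\<bar> = \<bar>w x - g x\<bar>"
proof -
  obtain c' P' N' where r: "finite_borel_measure P'" "finite_borel_measure N'"
    "emeasure P' (- {a<..<b}) = 0" "emeasure N' (- {a<..<b}) = 0"
    "\<And>x. V x = c' + cdf P' x - cdf N' x" "add_measure P' N' = \<tau>"
    by (rule bv_of_dominated[OF T.finite_borel_measure_axioms \<tau>_concentrated ab cont dom]) (assumption | rule that)+
  have "energy K \<tau> UNIV + ennreal (lam / 2 * defect w) \<le> energy K \<tau> UNIV + ennreal (lam / 2 * defect V)"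
    using minimal_defect[of P' N' V c'] r by (simp add: concentrated_def)
  then have "ennreal (lam / 2 * defect w) \<le> ennreal (lam / 2 * defect V)"
    using energy_finite by (simp only: ennreal_add_left_cancel_le) auto
  then have "lam / 2 * defect w \<le> lam / 2 * defect V"
    using lam defect_nonneg[of V] by (subst (asm) ennreal_le_iff) auto
  then have "defect w \<le> defect V"
    using lam by simp
  have V: "V = (\<lambda>x. c' + cdf P' x - cdf N' x)" using r(5) by auto
  have iV: "integrable lborel (\<lambda>x. indicator {a<..<b} x * (V x - g x)\<^sup>2)"
    unfolding V by (rule defect_integrable[OF rep_borel rep_bounded]) (use r in auto)
  have iw: "integrable lborel (\<lambda>x. indicator {a<..<b} x * (w x - g x)\<^sup>2)"
    by (rule defect_integrable[OF w_borel w_bounded])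
  have le: "indicator {a<..<b} x * (V x - g x)\<^sup>2 \<le> indicator {a<..<b} x * (w x - g x)\<^sup>2" for x
    using closer[of x] by (auto simp: indicator_def abs_le_square_iff)
  have "defect V \<le> defect w"
    unfolding defect_def by (intro integral_mono iV iw le)
  with \<open>defect w \<le> defect V\<close> have "AE x in lborel. indicator {a<..<b} x * (V x - g x)\<^sup>2 = indicator {a<..<b} x * (w x - g x)\<^sup>2"
    by (intro sigma_finite_measure.integral_eq_mono_AE_eq_AE[OF sigma_finite_lborel] iV iw AE_I2 le) (simp add: defect_def)
  then have "AE x in lborel. x \<in> {a<..<b} \<longrightarrow> \<bar>V x - g x\<bar> = \<bar>w x - g x\<bar>"
    by eventually_elim (auto simp: indicator_def power2_eq_iff abs_eq_iff)
  moreover have "continuous (at_right y) g" for y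
    using g_cont by (simp add: continuous_on_eq_continuous_within continuous_at_imp_continuous_at_within)
  ultimately show ?thesis
    using x by (intro AE_eq_imp_eq_right_continuous[of a b "\<lambda>x. \<bar>V x - g x\<bar>"] continuous_intros cont w_right_cont) auto
qed

section \<open>Truncation arguments: range and monotonicity\<close>

lemma w_le: assumes "a < x" "x < b" shows "w x \<le> g b"
proof (rule ccontr)
  assume "\<not> w x \<le> g b"
  have "\<bar>min (w x) (g b) - g x\<bar> = \<bar>w x - g x\<bar>"
  proof (rule dominated_competitor[OF _ _ _ assms])
    show "continuous (at_right x) (\<lambda>x. min (w x) (g b))" for x
      by (intro continuous_min w_right_cont continuous_const)
    show "\<bar>min (w y) (g b) - min (w x) (g b)\<bar> \<le> cdf \<tau> y - cdf \<tau> x" if "x \<le> y" for x y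
      using w_dominated[OF that] by linarith
    show "\<bar>min (w x) (g b) - g x\<bar> \<le> \<bar>w x - g x\<bar>" if "a < x" "x < b" for x
      using monoD[OF g_mono, of x b] that by linarith
  qed
  with monoD[OF g_mono, of x b] assms \<open>\<not> w x \<le> g b\<close> show False by linarith
qed

lemma w_ge: assumes "a < x" "x < b" shows "g a \<le> w x"
proof (rule ccontr)
  assume "\<not> g a \<le> w x"
  have "\<bar>max (w x) (g a) - g x\<bar> = \<bar>w x - g x\<bar>"
  proof (rule dominated_competitor[OF _ _ _ assms])
    show "continuous (at_right x) (\<lambda>x. max (w x) (g a))" for x
      by (intro continuous_max w_right_cont continuous_const)
    show "\<bar>max (w y) (g a) - max (w x) (g a)\<bar> \<le> cdf \<tau> y - cdf \<tau> x" if "x \<le> y" for x y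
      using w_dominated[OF that] by linarith
    show "\<bar>max (w x) (g a) - g x\<bar> \<le> \<bar>w x - g x\<bar>" if "a < x" "x < b" for x
      using monoD[OF g_mono, of a x] that by linarith
  qed
  with monoD[OF g_mono, of a x] assms \<open>\<not> g a \<le> w x\<close> show False by linarith
qed

text \<open>
  If \<open>w\<close> falls across the level \<open>l\<close> at \<open>k\<close>, then truncating at \<open>l\<close> either the values above \<open>l\<close> on the
  left of \<open>k\<close> (when \<open>g k \<le> l\<close>) or those below \<open>l\<close> on the right of \<open>k\<close> (when \<open>g k > l\<close>) does not
  increase the variation and moves \<open>w\<close> strictly towards \<open>g\<close>.
\<close>

lemma w_mono_inside:
  assumes x12: "a < x1" "x1 < x2" "x2 < b" shows "w x1 \<le> w x2"
proof (rule ccontr)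
  assume "\<not> w x1 \<le> w x2"
  define l where "l = (w x1 + w x2) / 2"
  have l: "w x2 < l" "l < w x1"
    using \<open>\<not> w x1 \<le> w x2\<close> by (auto simp: l_def field_simps)
  define S where "S = {x. x1 \<le> x \<and> x \<le> x2 \<and> l < w x}"
  define k where "k = Sup S"
  have S: "x1 \<in> S" "bdd_above S"
    using l x12 by (auto simp: S_def intro!: bdd_aboveI[of _ x2])
  have k: "x1 \<le> k" "k \<le> x2"
    using S by (auto simp: k_def S_def intro: cSup_upper cSup_least)
  have after: "w x \<le> l" if "k < x" "x \<le> x2" for x
    using cSup_upper[OF _ S(2), of x] that k by (fastforce simp: k_def S_def)
  have wk: "w k \<le> l"
  proof (cases "k = x2")
    case False
    show ?thesis
    proof (rule tendsto_upperbound)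
      show "(w \<longlongrightarrow> w k) (at_right k)"
        using w_right_cont by (simp add: continuous_within)
      show "\<forall>\<^sub>F x in at_right k. w x \<le> l"
        unfolding eventually_at_right_field using after False k by (intro exI[of _ x2]) auto
    qed simp
  qed (use l in simp)
  \<comment> \<open>Since \<open>w k \<le> l\<close>, the supremum does not belong to
    \<open>S\<close>, and points with values above \<open>l\<close> accumulate at \<open>k\<close>
    strictly from the left. They stand in for the left limit at \<open>k\<close> when the truncation
    on the right is shown to be dominated: a rise from \<open>w x\<close> to \<open>l\<close> is
    bounded by the rise from \<open>w x\<close> to \<open>w z\<close>.\<close>
  have before: "\<exists>z. x < z \<and> z < k \<and> l < w z" if xk: "x < k" for x
  proof -
    obtain z where "z \<in> S" "x < z"
      using xk S less_cSup_iff[of S x] unfolding k_def by blast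
    moreover have "z \<le> k"
      using cSup_upper[OF \<open>z \<in> S\<close> S(2)] by (simp add: k_def)
    ultimately show ?thesis
      using wk by (intro exI[of _ z]) (auto simp: S_def less_le)
  qed
  have x1k: "x1 < k"
    using k wk l by (auto simp: less_le)
  show False
  proof (cases "g k \<le> l")
    case True
    let ?V = "\<lambda>x. if x < k then min (w x) l else w x"
    have "\<bar>?V x1 - g x1\<bar> = \<bar>w x1 - g x1\<bar>"
    proof (rule dominated_competitor)
      show "continuous (at_right x) ?V" for x
        by (intro continuous_at_right_If continuous_min w_right_cont continuous_const)
      show "\<bar>?V y - ?V x\<bar> \<le> cdf \<tau> y - cdf \<tau> x" if "x \<le> y" for x y
      proof (cases "x < k \<and> k \<le> y")
        case True
        then show ?thesis
          using w_dominated[of x y] w_dominated[of x k] w_dominated[of k y] wk by auto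
      next
        case False
        then show ?thesis
          using w_dominated[OF that] that by auto
      qed
      show "\<bar>?V x - g x\<bar> \<le> \<bar>w x - g x\<bar>" if "a < x" "x < b" for x
        using monoD[OF g_mono, of x k] True by auto
    qed (use x12 in auto)
    with x1k l monoD[OF g_mono, of x1 k] True show False by auto
  next
    case False
    let ?V = "\<lambda>x. if x < k then w x else max (w x) l"
    have "\<bar>?V x2 - g x2\<bar> = \<bar>w x2 - g x2\<bar>"
    proof (rule dominated_competitor)
      show "continuous (at_right x) ?V" for x
        by (intro continuous_at_right_If continuous_max w_right_cont continuous_const)
      show "\<bar>?V y - ?V x\<bar> \<le> cdf \<tau> y - cdf \<tau> x" if "x \<le> y" for x y
      proof (cases "x < k \<and> k \<le> y")
        case True
        then obtain z where z: "x < z" "z < k" "l < w z"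
          using before by blast
        show ?thesis
          using True z w_dominated[of x y] w_dominated[of x z] w_dominated[of z y] by auto
      next
        case False
        then show ?thesis
          using w_dominated[OF that] that by auto
      qed
      show "\<bar>?V x - g x\<bar> \<le> \<bar>w x - g x\<bar>" if "a < x" "x < b" for x
        using monoD[OF g_mono, of k x] False by auto
    qed (use x12 in auto)
    with k l monoD[OF g_mono, of k x2] False show False by auto
  qed
qed

section \<open>End points, and absence of a negative part\<close>

lemma P_concentrated: "emeasure P (- {a<..<b}) = 0" and N_concentrated: "emeasure N (- {a<..<b}) = 0"
  using conc_P conc_N by (auto simp: concentrated_def)

lemma w_left: "x \<le> a \<Longrightarrow> w x = w a" and w_right: "b \<le> x \<Longrightarrow> w x = w b"
  using cdf_concentrated[OF finite_P P_concentrated] cdf_concentrated[OF finite_N N_concentrated]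
  by (simp_all add: w_def)

lemma w_tendsto_b: "(w \<longlongrightarrow> w b) (at_left b)"
proof -
  have "((\<lambda>x. c + cdf P x - cdf N x) \<longlongrightarrow> c + measure P {..<b} - measure N {..<b}) (at_left b)"
    by (intro tendsto_intros P.cdf_at_left N.cdf_at_left)
  then show ?thesis
    using cdf_concentrated(2)[OF finite_P P_concentrated, of b] cdf_concentrated(2)[OF finite_N N_concentrated, of b]
    by (simp add: w_def[abs_def])
qed

text \<open>Outside (a, b) the function is constant on either side, and the end points are limits of
  interior points: from the right at \<open>a\<close> by right-continuity, from the left at
  \<open>b\<close> because no mass sits there.\<close>

lemma w_mono: "mono w"
proof -
  have at_a: "w a \<le> w y" if "a < y" "y < b" for y
  proof (rule tendsto_upperbound)
    show "(w \<longlongrightarrow> w a) (at_right a)"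
      using w_right_cont by (simp add: continuous_within)
    show "\<forall>\<^sub>F x in at_right a. w x \<le> w y"
      unfolding eventually_at_right_field using that w_mono_inside by blast
  qed simp
  have less_b: "w x \<le> w y" if "x < y" "y < b" for x y
    using that at_a[of y] w_mono_inside[of x y] w_left[of x] w_left[of y]
    by (cases "x \<le> a"; cases "y \<le> a") auto
  have at_b: "w x \<le> w b" if "x < b" for x
  proof (rule tendsto_lowerbound[OF w_tendsto_b])
    show "\<forall>\<^sub>F y in at_left b. w x \<le> w y"
      unfolding eventually_at_left_field using that less_b by blast
  qed simp
  have "w x \<le> w y" if "x < y" for x y
    using that less_b[of x y] at_b[of x] w_right[of x] w_right[of y]
    by (cases "b \<le> x"; cases "b \<le> y") auto
  then show ?thesis
    by (metis monoI order_le_less)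
qed

lemma w_bounds: "g a \<le> w x" "w x \<le> g b"
proof -
  have "(w \<longlongrightarrow> w a) (at_right a)"
    using w_right_cont by (simp add: continuous_within)
  then have "g a \<le> w a"
  proof (rule tendsto_lowerbound)
    show "\<forall>\<^sub>F x in at_right a. g a \<le> w x"
      unfolding eventually_at_right_field using ab w_ge by blast
  qed simp
  then show "g a \<le> w x"
    using monoD[OF w_mono, of a x] w_left[of x] by (cases "x \<le> a") linarith+
  have "w b \<le> g b"
  proof (rule tendsto_upperbound[OF w_tendsto_b])
    show "\<forall>\<^sub>F x in at_left b. w x \<le> g b"
      unfolding eventually_at_left_field using ab w_le by blast
  qed simp
  then show "w x \<le> g b"
    using monoD[OF w_mono, of x b] w_right[of x] by (cases "b \<le> x") linarith+
qed

text \<open>An increasing \<open>w\<close> is, up to the constant \<open>c\<close>, the distribution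
  function of a positive measure, which together with the null measure forms another representing
  pair. Minimality of the Jordan pair bounds \<open>N\<close> by the null measure.\<close>

lemma emeasure_N: "X \<in> sets borel \<Longrightarrow> emeasure N X = 0"
proof -
  define F where "F x = w x - c" for x
  have F: "finite_borel_measure (interval_measure F)" "\<And>x. cdf (interval_measure F) x = F x"
  proof -
    have "F x \<le> F y" if "x \<le> y" for x y
      using monoD[OF w_mono that] by (simp add: F_def)
    moreover have "continuous (at_right x) F" for x
      unfolding F_def[abs_def] by (intro continuous_intros w_right_cont)
    moreover have "F x = 0" if "x \<le> a" for x
      using that cdf_concentrated(1)[OF finite_P P_concentrated] cdf_concentrated(1)[OF finite_N N_concentrated]
      by (simp add: F_def w_def)
    moreover have "F x = F b" if "b \<le> x" for x
      using w_right[OF that] by (simp add: F_def)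
    ultimately show "finite_borel_measure (interval_measure F)" "\<And>x. cdf (interval_measure F) x = F x"
      using interval_measure_of_cdf[where F = F and a = a and b = b, OF _ _ _ _ ab] by blast+
  qed
  have Z: "finite_borel_measure (null_measure borel)"
    using concentrated_null_measure by (simp add: concentrated_def)
  assume X: "X \<in> sets borel"
  have "emeasure N X \<le> emeasure (null_measure borel) X"
  proof (rule jordan_decomposition_minimal(2)[OF finite_P finite_N F(1) Z singular _ X])
    show "cdf P x - cdf N x = cdf (interval_measure F) x - cdf (null_measure borel) x" for x
      using F(2) by (simp add: F_def w_def cdf_def)
  qed
  then show ?thesis by simp
qed

lemma w_eq: "w x = c + cdf P x"
  using emeasure_N[of "{..x}"] by (simp add: w_def cdf_def measure_def)

lemma \<tau>_eq: "\<tau> = P"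
proof (rule measure_eqI)
  show "sets \<tau> = sets P" by (simp add: P.M_is_borel T.M_is_borel)
  fix X assume "X \<in> sets \<tau>"
  then show "emeasure \<tau> X = emeasure P X"
    using emeasure_N[of X] by (simp add: \<tau>_def emeasure_add_measure[OF finite_P finite_N])
qed

lemma measure_diff_cdf: "x \<le> y \<Longrightarrow> measure P {x<..y} = w y - w x"
  using P.cdf_diff_eq[of x y] by (cases "x = y") (auto simp: w_eq)

section \<open>Replacing an interval by a single jump\<close>

lemma split_le:
  assumes kd: "a < k" "k < d" "d < b" and x: "k \<le> x" "x \<le> d"
  shows "measure P {k..d} = measure P {k..x} + measure P {x<..d}"
    and "measure P {k..x} = w x - (c + measure P {..<k})"
proof -
  have "measure P ({k..x} \<union> {x<..d}) = measure P {k..x} + measure P {x<..d}"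
    by (rule P.finite_measure_Union) (auto simp: P.M_is_borel)
  moreover have "{k..x} \<union> {x<..d} = {k..d}" using x by auto
  ultimately show "measure P {k..d} = measure P {k..x} + measure P {x<..d}" by simp
  have "measure P ({..<k} \<union> {k..x}) = measure P {..<k} + measure P {k..x}"
    by (rule P.finite_measure_Union) (auto simp: P.M_is_borel)
  moreover have "{..<k} \<union> {k..x} = {..x}" using x by auto
  ultimately show "measure P {k..x} = w x - (c + measure P {..<k})"
    by (simp add: w_eq cdf_def)
qed

text \<open>
  The competitor \<open>v\<close> replaces \<open>w\<close> on \<open>[k, d]\<close> by a step function with values \<open>u0 = w(k-)\<close> and
  \<open>u2 = w(d)\<close>, i.e. the push-forward \<open>\<nu>\<close> of \<open>P\<close> collapses \<open>[k, d]\<close> to the jump point \<open>y\<close>. The point \<open>y\<close> is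
  chosen such that \<open>v\<close> and \<open>w\<close> have the same mean on \<open>[k, d]\<close>; since \<open>g\<close> is increasing, the term
  \<open>(v - w) (g y - g)\<close> is then favourable, and the fidelity grows by at most the integral of
  \<open>(w - u0) (u2 - w)\<close>, whose integrand at \<open>z\<close> is \<open>P[k, z] P(z, d]\<close>.
\<close>

lemma merge_bound:
  assumes kd: "a < k" "k < d" "d < b" and pos: "measure P {k..d} > 0"
    and S: "\<And>x. k \<le> x \<Longrightarrow> x < d \<Longrightarrow> measure P {k..x} * measure P {x<..d} \<le> S"
    and x: "k \<le> x" "x < d"
  shows "C M * (measure P {k..x} * measure P {x<..d}) \<le> lam / 2 * (S * (d - k))"
proof -
  note [simp] = P.M_is_borel P.borel_UNIV
  define u0 where "u0 = c + measure P {..<k}"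
  define u2 where "u2 = w d"
  define \<delta> where "\<delta> = measure P {k..d}"
  have \<delta>: "\<delta> = u2 - u0" "\<delta> > 0"
    using split_le(2)[OF kd, of d] kd pos by (auto simp: \<delta>_def u0_def u2_def)
  have wb: "u0 \<le> w x" "w x \<le> u2" if "k \<le> x" "x \<le> d" for x
    using split_le(2)[OF kd that] monoD[OF w_mono that(2)] measure_nonneg[of P "{k..x}"]
    by (auto simp: u0_def u2_def)
  have w_int: "integrable lborel (\<lambda>x. indicator {k..<d} x * w x)"
  proof -
    have "integrable lborel (\<lambda>x. indicator {k..<d} x *\<^sub>R w x)"
      by (rule integrableI_bounded_set_indicator[where B = "\<bar>c\<bar> + measure P (space P) + measure N (space N)"])
        (use kd w_bounded w_borel in auto)
    then show ?thesis by simp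
  qed
  define m where "m = (LINT x|lborel. indicator {k..<d} x * w x)"
  have ind_int: "integrable lborel (\<lambda>x. indicator {s..<t} x * (q::real))"
    "s \<le> t \<Longrightarrow> (LINT x|lborel. indicator {s..<t} x * q) = (t - s) * q" for s t q
  proof -
    have "integrable lborel (indicator {s..<t} :: real \<Rightarrow> real)"
      by (cases "s \<le> t") auto
    then show "integrable lborel (\<lambda>x. indicator {s..<t} x * (q::real))" by simp
  qed simp
  have "u0 * (d - k) \<le> m"
  proof -
    have "(LINT x|lborel. indicator {k..<d} x * u0) \<le> m"
      unfolding m_def by (intro integral_mono ind_int w_int) (auto simp: indicator_def wb)
    then show ?thesis using ind_int(2)[of k d u0] kd by (simp add: mult.commute)
  qed
  have "m \<le> u2 * (d - k)"
  proof -
    have "m \<le> (LINT x|lborel. indicator {k..<d} x * u2)"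
      unfolding m_def by (intro integral_mono ind_int w_int) (auto simp: indicator_def wb)
    then show ?thesis using ind_int(2)[of k d u2] kd by (simp add: mult.commute)
  qed
  \<comment> \<open>Solves \<open>u0 * (y - k) + u2 * (d - y) = m\<close>. Because m lies between u0
    (d - k) and u2 (d - k), the solution falls into [k, d].\<close>
  define y where "y = (u2 * d - u0 * k - m) / \<delta>"
  have "y * \<delta> = u2 * d - u0 * k - m" using \<delta> by (simp add: y_def)
  then have y_eq: "u0 * (y - k) + u2 * (d - y) = m"
    unfolding \<delta>(1) by (simp add: algebra_simps)
  have y: "k \<le> y" "y \<le> d"
  proof -
    have "(y - k) * \<delta> = u2 * (d - k) - m" "(d - y) * \<delta> = m - u0 * (d - k)"
      using \<open>y * \<delta> = _\<close> unfolding left_diff_distrib by (simp_all add: \<delta>(1) algebra_simps)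
    then have "0 \<le> (y - k) * \<delta>" "0 \<le> (d - y) * \<delta>"
      using \<open>m \<le> _\<close> \<open>u0 * (d - k) \<le> m\<close> by auto
    then show "k \<le> y" "y \<le> d" using \<delta>(2) by (auto simp: zero_le_mult_iff)
  qed
  define f where "f z = (if z \<in> {k..d} then y else z)" for z
  have [measurable]: "f \<in> borel_measurable borel"
    unfolding f_def[abs_def] by measurable
  have fP: "f \<in> measurable P borel" by (simp add: measurable_cong_sets[OF P.M_is_borel refl])
  define \<nu> where "\<nu> = distr P borel f"
  have e\<nu>: "emeasure \<nu> X = emeasure P (f -` X)" if "X \<in> sets borel" for X
    unfolding \<nu>_def using that by (subst emeasure_distr[OF fP]) auto
  have f\<nu>: "finite_borel_measure \<nu>"
    by (rule finite_borel_measureI) (use e\<nu>[of UNIV] in \<open>auto simp: \<nu>_def\<close>)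
  interpret V: finite_borel_measure \<nu> by (rule f\<nu>)
  note [simp] = V.M_is_borel
  have m\<nu>: "measure \<nu> X = measure P (f -` X)" if "X \<in> sets borel" for X
    using e\<nu>[OF that] by (simp add: measure_def)
  have "f -` (- {a<..<b}) = - {a<..<b}"
    using kd y by (auto simp: f_def split: if_splits)
  then have c\<nu>: "concentrated a b \<nu>"
    using e\<nu>[of "- {a<..<b}"] P_concentrated f\<nu> by (simp add: concentrated_def)
  define v where "v z = c + cdf \<nu> z" for z
  have cdf\<nu>: "cdf \<nu> z = measure P (f -` {..z})" for z
    by (simp add: cdf_def m\<nu>)
  have v: "v z = (if z < k \<or> d \<le> z then w z else if z < y then u0 else u2)" for z
  proof -
    consider "z < k" | "d \<le> z" | "k \<le> z" "z < d" "z < y" | "k \<le> z" "z < d" "y \<le> z" by linarith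
    then show ?thesis
    proof cases
      case 1
      then have "f -` {..z} = {..z}" using y kd by (auto simp: f_def split: if_splits)
      with 1 show ?thesis by (simp add: v_def cdf\<nu> w_eq) (simp add: cdf_def)
    next
      case 2
      then have "f -` {..z} = {..z}" using y kd by (auto simp: f_def split: if_splits)
      with 2 show ?thesis by (simp add: v_def cdf\<nu> w_eq) (simp add: cdf_def)
    next
      case 3
      then have "f -` {..z} = {..<k}" using y kd by (auto simp: f_def split: if_splits)
      with 3 show ?thesis by (simp add: v_def cdf\<nu> u0_def)
    next
      case 4
      then have "f -` {..z} = {..d}" using y kd by (auto simp: f_def split: if_splits)
      with 4 show ?thesis by (simp add: v_def cdf\<nu> u2_def w_eq) (simp add: cdf_def)
    qed
  qed
  have en_out: "energy K \<nu> (- {k..d}) \<le> energy K P (- {k..d})"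
  proof (rule energy_mono[OF f\<nu> finite_P K_mono])
    fix X assume X: "X \<in> sets borel" "X \<subseteq> - {k..d}"
    then have "f -` X = X" using y by (auto simp: f_def split: if_splits)
    then show "emeasure \<nu> X \<le> emeasure P X" using e\<nu>[OF X(1)] by simp
  qed simp
  have en_in: "energy K \<nu> {k..d} = ennreal (K \<delta>)"
  proof -
    have meas_y: "measure \<nu> {y} = \<delta>"
    proof -
      have "f -` {y} = {k..d}" using y by (auto simp: f_def split: if_splits)
      then show ?thesis using m\<nu>[of "{y}"] by (simp add: \<delta>_def)
    qed
    have "f -` {z} = {}" if "z \<in> {k..d}" "z \<noteq> y" for z
      using that by (auto simp: f_def split: if_splits)
    then have other: "z \<notin> atoms \<nu>" if "z \<in> {k..d}" "z \<noteq> y" for z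
      using that m\<nu>[of "{z}"] by (simp add: atoms_def)
    have at: "{k..d} \<inter> atoms \<nu> = {y}"
    proof (intro equalityI subsetI)
      show "z \<in> {y}" if "z \<in> {k..d} \<inter> atoms \<nu>" for z
        using that other[of z] by (cases "z = y") simp_all
      show "z \<in> {k..d} \<inter> atoms \<nu>" if "z \<in> {y}" for z
        using that meas_y \<delta>(2) y by (simp add: atoms_def)
    qed
    have eq: "{k..d} - atoms \<nu> = {k..d} - {y}"
      using at by blast
    have "f -` ({k..d} - {y}) = {}"
      by (auto simp: f_def split: if_splits)
    then have "emeasure \<nu> ({k..d} - atoms \<nu>) = 0"
      unfolding eq using e\<nu>[of "{k..d} - {y}"] by simp
    then show ?thesis
      by (simp add: energy_def at meas_y)
  qed
  have split: "energy K \<mu> UNIV = energy K \<mu> (- {k..d}) + energy K \<mu> {k..d}" if "finite_borel_measure \<mu>" for \<mu>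
    using energy_Un[OF that, of "- {k..d}" "{k..d}" K] by simp
  have fin: "energy K P (- {k..d}) < \<infinity>"
    using energy_finite split[OF finite_P] by (auto simp: \<tau>_eq less_top)
  define A B where "A = measure P {k..x}" and "B = measure P {x<..d}"
  have AB: "0 \<le> A" "0 \<le> B" by (auto simp: A_def B_def)
  \<comment> \<open>All values of \<open>w\<close> lie between \<open>g a\<close> and
    \<open>g b\<close>, so the size of the merged jump is admissible in (K2) with the given
    M.\<close>
  have "\<delta> \<le> M"
  proof -
    have "w a = c" using cdf_concentrated(1)[OF finite_P P_concentrated, of a] by (simp add: w_eq)
    then have "g a \<le> u0" using w_bounds(1)[of a] by (simp add: u0_def add_increasing2)
    then show ?thesis using w_bounds(2)[of d] M(2) by (simp add: \<delta>(1) u2_def)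
  qed
  have gain: "ennreal (K \<delta> + C M * (A * B)) \<le> energy K P {k..d}"
  proof -
    have "{k..x} \<union> {x<..d} = {k..d}" "{k..x} \<inter> {x<..d} = {}" using x by auto
    then show ?thesis
      using energy_merge_gap[OF finite_P, of "{k..x}" "{x<..d}" M] \<open>\<delta> \<le> M\<close> M(1)
      by (auto simp: \<delta>_def A_def B_def mult.assoc)
  qed
  have Zc: "concentrated a b (null_measure borel)" by (rule concentrated_null_measure)
  have Zf: "finite_borel_measure (null_measure borel)" using Zc by (simp add: concentrated_def)
  have addZ: "add_measure \<nu> (null_measure borel) = \<nu>"
    by (rule measure_eqI) (simp_all add: emeasure_add_measure[OF f\<nu> Zf])
  have cmp: "energy K P UNIV + ennreal (lam / 2 * defect w) \<le> energy K \<nu> UNIV + ennreal (lam / 2 * defect v)"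
    using minimal_defect[OF c\<nu> Zc, of v c] by (simp add: v_def addZ \<tau>_eq cdf_def)
  have "energy K P (- {k..d}) + (ennreal (K \<delta> + C M * (A * B)) + ennreal (lam / 2 * defect w))
      \<le> energy K P UNIV + ennreal (lam / 2 * defect w)"
    unfolding split[OF finite_P] add.assoc by (intro add_left_mono add_right_mono gain)
  also note cmp
  also have "energy K \<nu> UNIV + ennreal (lam / 2 * defect v)
      \<le> energy K P (- {k..d}) + (ennreal (K \<delta>) + ennreal (lam / 2 * defect v))"
    unfolding split[OF f\<nu>] en_in add.assoc by (intro add_right_mono en_out)
  finally have "energy K P (- {k..d}) + (ennreal (K \<delta> + C M * (A * B)) + ennreal (lam / 2 * defect w)) \<le>
      energy K P (- {k..d}) + (ennreal (K \<delta>) + ennreal (lam / 2 * defect v))" .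
  then have "ennreal (K \<delta> + C M * (A * B)) + ennreal (lam / 2 * defect w) \<le> ennreal (K \<delta>) + ennreal (lam / 2 * defect v)"
    using fin by (simp only: ennreal_add_left_cancel_le) auto
  then have "ennreal (K \<delta> + C M * (A * B) + lam / 2 * defect w) \<le> ennreal (K \<delta> + lam / 2 * defect v)"
    using \<delta>(2) lam C_pos[OF M(1)] AB by (simp add: K_nonneg defect_nonneg)
  then have 1: "C M * (A * B) \<le> lam / 2 * (defect v - defect w)"
    using \<delta>(2) lam by (subst (asm) ennreal_le_iff) (auto simp: K_nonneg defect_nonneg right_diff_distrib)
  have "defect v - defect w \<le> S * (d - k)"
  proof -
    \<comment> \<open>In (v - w)(v + w - 2 g z) the other value of the step, u0 + u2 - v, is added
      and subtracted, and g z is compared with g y. This leaves the product (w - u0)(u2 - w), a term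
      with the constant factor \<open>\<kappa>\<close> whose integral vanishes by the choice of
      \<open>y\<close>, and the term containing g y - g z.\<close>
    define \<kappa> where "\<kappa> = u0 + u2 - 2 * g y"
    have v': "v = (\<lambda>x. c + cdf \<nu> x - cdf (null_measure borel) x)"
      by (simp add: v_def[abs_def] cdf_def)
    have iv: "integrable lborel (\<lambda>x. indicator {a<..<b} x * (v x - g x)\<^sup>2)"
      unfolding v' by (rule defect_integrable[OF rep_borel[OF f\<nu> Zf] rep_bounded[OF f\<nu> Zf]])
    have iw: "integrable lborel (\<lambda>x. indicator {a<..<b} x * (w x - g x)\<^sup>2)"
      by (rule defect_integrable[OF w_borel w_bounded])
    define r where "r z = indicator {k..<d} z * S +
      \<kappa> * ((indicator {k..<y} z * u0 + indicator {y..<d} z * u2) - indicator {k..<d} z * w z)" for z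
    have ir: "integrable lborel r"
      unfolding r_def[abs_def]
      by (intro Bochner_Integration.integrable_add Bochner_Integration.integrable_diff integrable_mult_right ind_int w_int)
    have "(LINT z|lborel. r z) = (d - k) * S + \<kappa> * (((y - k) * u0 + (d - y) * u2) - m)"
      unfolding r_def[abs_def] m_def using y kd ind_int w_int
      by (simp add: Bochner_Integration.integral_add Bochner_Integration.integral_diff)
    then have int_r: "(LINT z|lborel. r z) = S * (d - k)"
      using y_eq by (simp add: mult.commute)
    have le: "indicator {a<..<b} z * (v z - g z)\<^sup>2 - indicator {a<..<b} z * (w z - g z)\<^sup>2 \<le> r z" for z
    proof (cases "z \<in> {k..<d}")
      case False
      then have "v z = w z" by (auto simp: v)
      with False y show ?thesis by (auto simp: r_def)
    next
      case True
      have vz: "v z = (if z < y then u0 else u2)" using True by (auto simp: v)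
      have rz: "r z = S + \<kappa> * (v z - w z)" using True y by (auto simp: r_def vz)
      have "w z - u0 = measure P {k..z}" "u2 - w z = measure P {z<..d}"
        using split_le(2)[OF kd, of z] True measure_diff_cdf[of z d] by (auto simp: u0_def u2_def)
      then have Sz: "(w z - u0) * (u2 - w z) \<le> S"
        using S[of z] True by simp
      \<comment> \<open>Left of \<open>y\<close> the step lies below \<open>w\<close> and
        \<open>g\<close> below \<open>g y\<close>; right of \<open>y\<close> both relations are
        reversed.\<close>
      have cross: "(v z - w z) * (g y - g z) \<le> 0"
      proof (cases "z < y")
        case True
        then show ?thesis
          using \<open>z \<in> _\<close> wb[of z] monoD[OF g_mono, of z y] by (auto simp: vz intro!: mult_nonpos_nonneg)
      next
        case False
        then show ?thesis
          using \<open>z \<in> _\<close> wb[of z] monoD[OF g_mono, of y z] by (auto simp: vz intro!: mult_nonneg_nonpos)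
      qed
      have "(v z - g z)\<^sup>2 - (w z - g z)\<^sup>2 = (w z - u0) * (u2 - w z) + \<kappa> * (v z - w z) + 2 * ((v z - w z) * (g y - g z))"
        by (auto simp: vz \<kappa>_def power2_eq_square algebra_simps)
      also have "\<dots> \<le> S + \<kappa> * (v z - w z)"
        using Sz cross by linarith
      finally show ?thesis
        using True kd by (simp add: rz)
    qed
    have "defect v - defect w = (LINT z|lborel. indicator {a<..<b} z * (v z - g z)\<^sup>2 - indicator {a<..<b} z * (w z - g z)\<^sup>2)"
      unfolding defect_def by (rule Bochner_Integration.integral_diff[OF iv iw, symmetric])
    also have "\<dots> \<le> (LINT z|lborel. r z)"
      by (intro integral_mono Bochner_Integration.integrable_diff iv iw ir le)
    finally show ?thesis by (simp add: int_r)
  qed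
  then have "lam / 2 * (defect v - defect w) \<le> lam / 2 * (S * (d - k))"
    using lam by (intro mult_left_mono) auto
  with 1 show ?thesis by (simp add: A_def B_def)
qed

text \<open>\<open>merge_bound\<close> estimates the product at every split point by the same
  multiple q of its supremum S, where q = lam (d - k) / (2 C_M). Hence S \<le> q S with q < 1, and S
  is finite because the measure is.\<close>

lemma no_split:
  assumes kd: "a < k" "k < d" "d < b" and short: "d - k < 2 * C M / lam" and x: "k \<le> x" "x < d"
  shows "measure P {k..x} * measure P {x<..d} = 0"
proof (cases "measure P {k..d} > 0")
  case False
  then have "measure P {k..x} + measure P {x<..d} = 0"
    using split_le(1)[OF kd, of x] x measure_nonneg[of P "{k..d}"] by linarith
  then show ?thesis
    using measure_nonneg[of P "{k..x}"] measure_nonneg[of P "{x<..d}"] by (simp add: add_nonneg_eq_0_iff)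
next
  case True
  define \<Phi> where "\<Phi> x = measure P {k..x} * measure P {x<..d}" for x
  have \<Phi>_nonneg: "0 \<le> \<Phi> x" for x by (simp add: \<Phi>_def)
  define S where "S = (SUP x\<in>{k..<d}. \<Phi> x)"
  have bdd: "bdd_above (\<Phi> ` {k..<d})"
  proof (rule bdd_aboveI2)
    fix x show "\<Phi> x \<le> measure P (space P) * measure P (space P)"
      unfolding \<Phi>_def by (intro mult_mono P.bounded_measure) auto
  qed
  have le_S: "\<Phi> x \<le> S" if "k \<le> x" "x < d" for x
    unfolding S_def using that by (intro cSUP_upper bdd) auto
  have S0: "0 \<le> S" using le_S[OF x] \<Phi>_nonneg[of x] by linarith
  have "C M * \<Phi> x \<le> lam / 2 * (S * (d - k))" if "k \<le> x" "x < d" for x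
    using merge_bound[OF kd True _ that, of S] le_S by (simp add: \<Phi>_def)
  then have "\<Phi> x \<le> lam / 2 * (S * (d - k)) / C M" if "k \<le> x" "x < d" for x
    using that C_pos[OF M(1)] by (simp add: field_simps)
  then have "S \<le> lam / 2 * (S * (d - k)) / C M"
    unfolding S_def using kd by (intro cSUP_least) (auto simp: S_def)
  then have "C M * S \<le> lam / 2 * (d - k) * S"
    using C_pos[OF M(1)] by (simp add: field_simps)
  moreover have "lam / 2 * (d - k) < C M"
    using short lam by (simp add: field_simps)
  ultimately have "S = 0"
    using S0 by (metis mult_less_cancel_right less_le not_le)
  then show ?thesis
    using le_S[OF x] \<Phi>_nonneg[of x] unfolding \<Phi>_def by linarith
qed

section \<open>Spacing and number of the jumps\<close>

lemma atoms_inside: "atoms P \<subseteq> {a<..<b}"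
proof
  fix x assume "x \<in> atoms P"
  then show "x \<in> {a<..<b}"
    using measure_singleton_outside[OF finite_P P_concentrated, of x] by (auto simp: atoms_def)
qed

text \<open>The split point is \<open>x\<close> itself: the degenerate interval [x, x] holds one
  atom and (x, y] the other, so the product that \<open>no_split\<close> makes vanish would be
  positive.\<close>

lemma atoms_gap:
  assumes "x \<in> atoms P" "y \<in> atoms P" "x < y" shows "2 * C M / lam \<le> y - x"
proof (rule ccontr)
  assume "\<not> 2 * C M / lam \<le> y - x"
  then have "measure P {x..x} * measure P {x<..y} = 0"
    using assms atoms_inside by (intro no_split) auto
  moreover have "measure P {x..x} > 0"
    using assms(1) by (simp add: atoms_def zero_less_measure_iff)
  moreover have "measure P {y} \<le> measure P {x<..y}"
    using assms(3) by (intro P.finite_measure_mono) (auto simp: P.M_is_borel)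
  moreover have "measure P {y} > 0"
    using assms(2) by (simp add: atoms_def zero_less_measure_iff)
  ultimately show False by auto
qed

text \<open>Stated for finite subsets because the finiteness of the whole set of atoms is itself
  deduced from this bound.\<close>

lemma card_atoms_subset:
  assumes "finite F" "F \<subseteq> atoms P" shows "real (card F) \<le> (b - a) * lam / (2 * C M) + 1"
proof (cases "F = {}")
  case True
  then show ?thesis using ab lam C_pos[OF M(1)] by (simp add: less_imp_le)
next
  case False
  have "(real (card F) - 1) * (2 * C M / lam) \<le> Max F - Min F"
    using assms False atoms_gap by (intro separated_card_le) auto
  also have "\<dots> \<le> b - a"
  proof -
    have "Max F \<in> {a<..<b}" "Min F \<in> {a<..<b}"
      using assms False atoms_inside by (meson Max_in Min_in subsetD)+
    then show ?thesis by simp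
  qed
  finally show ?thesis
    using lam C_pos[OF M(1)] by (simp add: field_simps)
qed

lemma finite_atoms: "finite (atoms P)"
proof (rule ccontr)
  assume "infinite (atoms P)"
  obtain n where n: "(b - a) * lam / (2 * C M) + 1 < real n"
    using reals_Archimedean2 by blast
  obtain F where "finite F" "card F = n" "F \<subseteq> atoms P"
    using infinite_arbitrarily_large[OF \<open>infinite (atoms P)\<close>] by blast
  then show False
    using card_atoms_subset n by fastforce
qed

lemma card_atoms: "int (card (atoms P)) \<le> \<lfloor>(b - a) * lam / (2 * C M)\<rfloor> + 1"
  using card_atoms_subset[OF finite_atoms] by (simp add: le_floor_iff flip: diff_le_eq)

section \<open>Constancy between the jumps\<close>

lemma w_continuous_on:
  assumes "x < y" "\<And>z. z \<in> {x<..y} \<Longrightarrow> z \<notin> atoms P"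
  shows "continuous_on {x..y} w"
  unfolding continuous_on_eq_continuous_within
proof
  fix z assume z: "z \<in> {x..y}"
  show "continuous (at z within {x..y}) w"
  proof (cases "z = x")
    \<comment> \<open>\<open>x\<close> itself may be an atom; at this end of the interval continuity
      is required only from the right.\<close>
    case True
    then show ?thesis
      using w_right_cont assms(1) by (simp add: at_within_Icc_at_right)
  next
    case False
    then have "isCont (cdf P) z"
      using assms(2)[of z] z by (auto simp: P.isCont_cdf atoms_def)
    then have "isCont w z"
      unfolding w_eq[abs_def] by (intro continuous_intros)
    then show ?thesis
      by (rule continuous_at_imp_continuous_at_within)
  qed
qed

text \<open>If w x < w y, continuity yields a point where \<open>w\<close> takes the mean of the two
  values. Both sides of it then carry at least half of the increment, which \<open>no_split\<close>
  forbids on so short an interval.\<close>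

lemma w_const_short:
  assumes xy: "a < x" "x < y" "y < b" "y - x < 2 * C M / lam"
    and no_atoms: "\<And>z. z \<in> {x<..y} \<Longrightarrow> z \<notin> atoms P"
  shows "w x = w y"
proof (rule ccontr)
  assume "w x \<noteq> w y"
  then have less: "w x < w y"
    using monoD[OF w_mono, of x y] xy by auto
  have "\<exists>z\<ge>x. z \<le> y \<and> w z = (w x + w y) / 2"
    using less xy by (intro IVT' w_continuous_on no_atoms) auto
  then obtain z where z: "x \<le> z" "z \<le> y" "w z = (w x + w y) / 2" by blast
  have "z \<noteq> y" using z less by auto
  then have "measure P {x..z} * measure P {z<..y} = 0"
    using xy z by (intro no_split) auto
  moreover have "measure P {z<..y} > 0"
    using measure_diff_cdf[OF z(2)] z less by simp
  moreover have "measure P {x<..z} \<le> measure P {x..z}"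
    by (intro P.finite_measure_mono) (auto simp: P.M_is_borel)
  moreover have "measure P {x<..z} > 0"
    using measure_diff_cdf[OF z(1)] z less by simp
  ultimately show False by auto
qed

text \<open>An interval of arbitrary length is traversed in steps of half the critical length, which
  stay strictly below the bound in \<open>w_const_short\<close>.\<close>

lemma w_const_inside:
  assumes "a < x" "x < y" "y < b" "\<And>z. z \<in> {x<..y} \<Longrightarrow> z \<notin> atoms P"
  shows "w x = w y"
proof -
  define r where "r = 2 * C M / lam"
  have r: "r > 0" using lam C_pos[OF M(1)] by (simp add: r_def)
  have "w x = w y" if "a < x" "x < y" "y < b" "\<And>z. z \<in> {x<..y} \<Longrightarrow> z \<notin> atoms P"
    "y - x < real n * (r / 2)" for n x
    using that
  proof (induction n arbitrary: x)
    case (Suc n)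
    show ?case
    proof (cases "y - x < r")
      case True
      then show ?thesis
        using Suc.prems by (intro w_const_short) (auto simp: r_def)
    next
      case False
      have "w x = w (x + r / 2)"
        using Suc.prems r False by (intro w_const_short) (auto simp: r_def[symmetric])
      also have "\<dots> = w y"
        using Suc.prems r False by (intro Suc.IH) (auto simp: algebra_simps)
      finally show ?thesis .
    qed
  qed simp
  moreover obtain n where "y - x < real n * (r / 2)"
    using reals_Archimedean3[of "r / 2"] r by (meson half_gt_zero)
  ultimately show ?thesis using assms by blast
qed

text \<open>The merging argument works strictly inside (a, b); the end points are added by
  continuity on the closed interval.\<close>

lemma w_const:
  assumes xy: "a \<le> x" "x < y" "y \<le> b" and no: "\<And>z. z \<in> {x<..y} \<Longrightarrow> z \<notin> atoms P"
  shows "w x = w y"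
proof -
  define m where "m = (x + y) / 2"
  have m: "x < m" "m < y" using xy by (auto simp: m_def)
  have inside: "w z = w m" if "z \<in> {x<..<y}" for z
  proof (cases z m rule: linorder_cases)
    case less
    then show ?thesis using that xy m no by (intro w_const_inside) auto
  next
    case greater
    then have "w m = w z" using that xy m no by (intro w_const_inside) auto
    then show ?thesis by simp
  qed simp
  have cl: "closure {x<..<y} = {x..y}" using xy by simp
  have "w z = w m" if "z \<in> {x..y}" for z
    using w_continuous_on[OF xy(2) no] inside that
    by (intro continuous_constant_on_closure[of "{x<..<y}" w "w m" z]) (auto simp: cl)
  then show ?thesis using xy by auto
qed

text \<open>The atoms serve as break points. A component is connected, so two of its points span a
  segment free of atoms.\<close>

lemma w_piecewise_constant: "piecewise_constant_on a b w"
  unfolding piecewise_constant_on_def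
proof (intro exI conjI ballI)
  show "finite (atoms P)" "atoms P \<subseteq> {a<..<b}" by (rule finite_atoms atoms_inside)+
  fix I assume I: "I \<in> components ({a..b} - atoms P)"
  have eq: "w x = w y" if "x \<in> I" "y \<in> I" "x < y" for x y
  proof (rule w_const)
    have "{x..y} \<subseteq> I"
      using in_components_connected[OF I] that by (intro connected_contains_Icc)
    then have "{x..y} \<subseteq> {a..b} - atoms P"
      using in_components_subset[OF I] by blast
    then show "z \<notin> atoms P" if "z \<in> {x<..y}" for z
      using that greaterThanAtMost_subseteq_atLeastAtMost_iff[of x y x y] by blast
    show "a \<le> x" "y \<le> b" using that in_components_subset[OF I] by auto
  qed (rule that)
  show "w constant_on I"
  proof (cases "I = {}")
    case False
    then obtain x where "x \<in> I" by blast
    then have "w y = w x" if "y \<in> I" for y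
      using eq that by (cases x y rule: linorder_cases) auto
    then show ?thesis by (auto simp: constant_on_def)
  qed (simp add: constant_on_def)
qed

end

section \<open>The main theorem\<close>

lemma concentrated_rep:
  "bv_rep a b u c P N \<longleftrightarrow> concentrated a b P \<and> concentrated a b N \<and>
     (AE x in lborel. x \<in> {a<..<b} \<longrightarrow> u x = c + cdf P x - cdf N x)"
  by (auto simp: bv_rep_def concentrated_def)

lemma add_measure_commute:
  assumes "finite_borel_measure P" "finite_borel_measure N"
  shows "add_measure P N = add_measure N P"
  by (rule measure_eqI) (simp_all add: emeasure_add_measure assms add.commute)

lemma fidelity_cong_AE:
  assumes "AE x in lborel. x \<in> {a<..<b} \<longrightarrow> u x = v x"
  shows "fidelity a b g u = fidelity a b g v"
  unfolding fidelity_def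
  by (rule nn_integral_cong_AE) (use assms in eventually_elim, auto simp: indicator_def)

lemma fidelity_uminus: "fidelity a b (\<lambda>x. - g x) (\<lambda>x. - u x) = fidelity a b g u"
proof -
  have "\<bar>- u x - - g x\<bar> = \<bar>u x - g x\<bar>" for x by linarith
  then show ?thesis by (simp add: fidelity_def)
qed

lemma fidelity_cong: "(\<And>x. x \<in> {a<..<b} \<Longrightarrow> g x = h x) \<Longrightarrow> fidelity a b g u = fidelity a b h u"
  unfolding fidelity_def by (intro nn_integral_cong) (auto simp: indicator_def)

theorem theorem1p3:
  fixes a b lam M :: real and K C g U :: "real \<Rightarrow> real"
  assumes "a < b" and "lam > 0"
    and "\<And>\<rho>. \<rho> \<ge> 0 \<Longrightarrow> K \<rho> \<ge> 0"
    and "K1 K" and "K2 K C" and "K3 K"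
    and "continuous_on {a..b} g"
    and "mono_on {a..b} g \<or> antimono_on {a..b} g"
    and "M > 0" and "M \<ge> Sup (g ` {a..b}) - Inf (g ` {a..b})"
    and "is_arg_min (TV_Kg K lam g a b) (\<lambda>u. u \<in> BV a b) U"
  shows "(\<exists>V. (AE x\<in>{a<..<b} in lebesgue. V x = U x) \<and>
            (mono_on {a..b} g \<longrightarrow> mono_on {a..b} V) \<and>
            (antimono_on {a..b} g \<longrightarrow> antimono_on {a..b} V) \<and>
            piecewise_constant_on a b V \<and>
            (\<forall>x\<in>{a..b}. Inf (g ` {a..b}) \<le> V x \<and> V x \<le> Sup (g ` {a..b}))) \<and>
         finite (jump_set a b U) \<and>
         int (card (jump_set a b U)) \<le> \<lfloor>(b - a) * lam / (2 * C M)\<rfloor> + 1"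
proof -
  note ab = \<open>a < b\<close>
  interpret jump_cost K C
    using assms(3-6) by unfold_locales auto
  have TV: "TV_Kg K lam g a b u = TV_K K a b u + ennreal (lam / 2) * fidelity a b g u" for u
    by (simp add: TV_Kg_def fidelity_def nn_integral_completion)
  have UBV: "U \<in> BV a b" and Umin: "\<And>u. u \<in> BV a b \<Longrightarrow> TV_Kg K lam g a b U \<le> TV_Kg K lam g a b u"
    using assms(11) by (auto simp: is_arg_min_def not_less)
  obtain c P N where rep: "bv_rep a b U c P N" and sing: "mutually_singular P N"
    and abs: "\<And>X. X \<in> sets borel \<Longrightarrow> abs_deriv a b U (X \<inter> {a<..<b}) = emeasure P X + emeasure N X"
    by (rule BV_rep[OF ab UBV]) (rule that; assumption)
  have conc: "concentrated a b P" "concentrated a b N"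
    and AE: "AE x in lborel. x \<in> {a<..<b} \<longrightarrow> U x = c + cdf P x - cdf N x"
    using rep by (auto simp: concentrated_rep)
  have fin: "finite_borel_measure P" "finite_borel_measure N"
    using conc by (auto simp: concentrated_def)
  \<comment> \<open>Clamping the argument to [a, b] keeps continuity and monotonicity and leaves the
    values that enter the fidelity unchanged.\<close>
  define ge where "ge x = g (max a (min b x))" for x
  have ge_cont: "continuous_on UNIV ge"
    unfolding ge_def[abs_def] using ab
    by (intro continuous_on_compose2[OF assms(7)] continuous_intros) auto
  have ge: "ge x = g x" if "x \<in> {a..b}" for x
    using that by (simp add: ge_def)
  \<comment> \<open>On the left \<open>TV_K_eq_energy\<close> applies because the pair of
    \<open>U\<close> is mutually singular; on the right the inequality \<open>TV_K_le_energy\<close>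
    suffices.\<close>
  have min0: "energy K (add_measure P N) UNIV + ennreal (lam / 2) * fidelity a b ge (\<lambda>x. c + cdf P x - cdf N x)
      \<le> energy K (add_measure P' N') UNIV + ennreal (lam / 2) * fidelity a b ge (\<lambda>x. c' + cdf P' x - cdf N' x)"
    if "concentrated a b P'" "concentrated a b N'" for c' P' N'
  proof -
    let ?v = "\<lambda>x. c' + cdf P' x - cdf N' x"
    have r: "bv_rep a b ?v c' P' N'" using that by (simp add: concentrated_rep)
    have "energy K (add_measure P N) UNIV + ennreal (lam / 2) * fidelity a b g U \<le> TV_K K a b ?v + ennreal (lam / 2) * fidelity a b g ?v"
      using Umin[OF BV_if_rep[OF ab r]] by (simp add: TV TV_K_eq_energy[OF rep sing abs])
    also have "\<dots> \<le> energy K (add_measure P' N') UNIV + ennreal (lam / 2) * fidelity a b g ?v"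
      by (intro add_right_mono TV_K_le_energy[OF ab r] K_mono)
    finally show ?thesis
      unfolding fidelity_cong_AE[OF AE] using fidelity_cong[of a b ge g] ge by simp
  qed
  have jumps: "jump_set a b U = atoms (add_measure P N)"
    by (rule rep_jump_set_eq_atoms(1)[OF rep sing])
  have main: "(\<exists>V. (AE x\<in>{a<..<b} in lebesgue. V x = U x) \<and>
            (mono_on {a..b} g \<longrightarrow> mono_on {a..b} V) \<and>
            (antimono_on {a..b} g \<longrightarrow> antimono_on {a..b} V) \<and>
            piecewise_constant_on a b V \<and>
            (\<forall>x\<in>{a..b}. Inf (g ` {a..b}) \<le> V x \<and> V x \<le> Sup (g ` {a..b})))"
    if V: "AE x in lborel. x \<in> {a<..<b} \<longrightarrow> V x = U x" "piecewise_constant_on a b V"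
      "mono_on {a..b} g \<and> mono_on {a..b} V \<or> antimono_on {a..b} g \<and> antimono_on {a..b} V"
      "\<And>x. x \<in> {a..b} \<Longrightarrow> Inf (g ` {a..b}) \<le> V x \<and> V x \<le> Sup (g ` {a..b})" for V
  proof (intro exI[of _ V] conjI impI ballI)
    show "AE x\<in>{a<..<b} in lebesgue. V x = U x"
      by (rule AE_completion[OF V(1)])
    \<comment> \<open>Data that are both nondecreasing and nonincreasing are constant, and then the
      bounds by \<open>Inf\<close> and \<open>Sup\<close> pin \<open>V\<close> down. This settles
      the implication that the case at hand does not cover.\<close>
    have const: "V x = V y" if "mono_on {a..b} g" "antimono_on {a..b} g" "x \<in> {a..b}" "y \<in> {a..b}" for x y
    proof -
      have "g z = g a" if "z \<in> {a..b}" for z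
        using mono_onD[OF \<open>mono_on {a..b} g\<close>, of a z] monotone_onD[OF \<open>antimono_on {a..b} g\<close>, of a z] that by auto
      then have "g ` {a..b} = (\<lambda>_. g a) ` {a..b}" by (intro image_cong refl)
      also have "\<dots> = {g a}" using ab by (simp add: image_constant_conv)
      finally have "g ` {a..b} = {g a}" .
      then show ?thesis using V(4)[OF that(3)] V(4)[OF that(4)] by simp
    qed
    show "mono_on {a..b} V" if g: "mono_on {a..b} g"
    proof (rule ccontr)
      assume no: "\<not> mono_on {a..b} V"
      then have anti: "antimono_on {a..b} g" using V(3) by blast
      then have "mono_on {a..b} V"
        by (intro mono_onI eq_refl const[OF g anti])
      with no show False ..
    qed
    show "antimono_on {a..b} V" if g: "antimono_on {a..b} g"
    proof (rule ccontr)
      assume no: "\<not> antimono_on {a..b} V"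
      then have mono: "mono_on {a..b} g" using V(3) by blast
      then have "antimono_on {a..b} V"
        by (intro monotone_onI eq_refl const[OF mono g])
      with no show False ..
    qed
  qed (use V in auto)
  show ?thesis
  proof (cases "mono_on {a..b} g")
    case True
    have "mono ge"
      using ab by (intro monoI) (auto simp: ge_def intro!: mono_onD[OF True])
    have Inf: "Inf (g ` {a..b}) = g a"
      using ab mono_onD[OF True] by (intro cInf_eq_minimum) auto
    have Sup: "Sup (g ` {a..b}) = g b"
      using ab mono_onD[OF True] by (intro cSup_eq_maximum) auto
    interpret minimizer K C a b lam M c ge P N
      using assms \<open>mono ge\<close> ge_cont conc sing min0 Inf Sup ge[of a] ge[of b] by unfold_locales auto
    have "jump_set a b U = atoms P"
      using jumps \<tau>_eq by (simp add: \<tau>_def)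
    moreover have "\<exists>V. (AE x\<in>{a<..<b} in lebesgue. V x = U x) \<and>
            (mono_on {a..b} g \<longrightarrow> mono_on {a..b} V) \<and>
            (antimono_on {a..b} g \<longrightarrow> antimono_on {a..b} V) \<and>
            piecewise_constant_on a b V \<and>
            (\<forall>x\<in>{a..b}. Inf (g ` {a..b}) \<le> V x \<and> V x \<le> Sup (g ` {a..b}))"
    proof (rule main[of w])
      show "AE x in lborel. x \<in> {a<..<b} \<longrightarrow> w x = U x"
        using AE by eventually_elim (auto simp: w_def)
      show "mono_on {a..b} g \<and> mono_on {a..b} w \<or> antimono_on {a..b} g \<and> antimono_on {a..b} w"
        using True w_mono by (auto simp: mono_on_def mono_def)
      show "Inf (g ` {a..b}) \<le> w x \<and> w x \<le> Sup (g ` {a..b})" for x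
        using w_bounds ge[of a] ge[of b] ab by (simp add: Inf Sup)
    qed (rule w_piecewise_constant)
    ultimately show ?thesis
      using finite_atoms card_atoms by simp
  next
    case False
    then have anti: "antimono_on {a..b} g" using assms(8) by blast
    define h where "h x = - ge x" for x
    have "mono h"
      using ab by (intro monoI) (auto simp: h_def ge_def intro!: monotone_onD[OF anti])
    have h_cont: "continuous_on UNIV h"
      unfolding h_def[abs_def] by (intro continuous_intros ge_cont)
    have Inf: "Inf (g ` {a..b}) = g b"
      using ab monotone_onD[OF anti] by (intro cInf_eq_minimum) auto
    have Sup: "Sup (g ` {a..b}) = g a"
      using ab monotone_onD[OF anti] by (intro cSup_eq_maximum) auto
    \<comment> \<open>A competitor (c', P', N') for \<open>h\<close> corresponds to (-c', N', P')
      for \<open>ge\<close>: the fidelity is unchanged when both functions change sign, and the sum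
      of the two measures is symmetric.\<close>
    have min1: "energy K (add_measure N P) UNIV + ennreal (lam / 2) * fidelity a b h (\<lambda>x. - c + cdf N x - cdf P x)
      \<le> energy K (add_measure P' N') UNIV + ennreal (lam / 2) * fidelity a b h (\<lambda>x. c' + cdf P' x - cdf N' x)"
      if "concentrated a b P'" "concentrated a b N'" for c' P' N'
    proof -
      have flip: "fidelity a b h v = fidelity a b ge (\<lambda>x. - v x)" for v
        using fidelity_uminus[of a b ge "\<lambda>x. - v x"] by (simp add: h_def[abs_def])
      have "(\<lambda>x. - (- c + cdf N x - cdf P x)) = (\<lambda>x. c + cdf P x - cdf N x)"
        "(\<lambda>x. - (c' + cdf P' x - cdf N' x)) = (\<lambda>x. - c' + cdf N' x - cdf P' x)"
        by auto
      moreover have "add_measure P' N' = add_measure N' P'" "add_measure N P = add_measure P N"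
        using that fin by (auto intro!: add_measure_commute simp: concentrated_def)
      ultimately show ?thesis
        using min0[OF that(2,1), of "- c'"] unfolding flip by simp
    qed
    interpret minimizer K C a b lam M "- c" h N P
      using assms \<open>mono h\<close> h_cont conc mutually_singular_sym[OF sing] min1 Inf Sup ge[of a] ge[of b]
      by unfold_locales (auto simp: h_def)
    have "jump_set a b U = atoms N"
      using jumps \<tau>_eq add_measure_commute[OF fin] by (simp add: \<tau>_def)
    moreover have "\<exists>V. (AE x\<in>{a<..<b} in lebesgue. V x = U x) \<and>
            (mono_on {a..b} g \<longrightarrow> mono_on {a..b} V) \<and>
            (antimono_on {a..b} g \<longrightarrow> antimono_on {a..b} V) \<and>
            piecewise_constant_on a b V \<and>
            (\<forall>x\<in>{a..b}. Inf (g ` {a..b}) \<le> V x \<and> V x \<le> Sup (g ` {a..b}))"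
    proof (rule main[of "\<lambda>x. - w x"])
      show "AE x in lborel. x \<in> {a<..<b} \<longrightarrow> - w x = U x"
        using AE by eventually_elim (auto simp: w_def)
      show "mono_on {a..b} g \<and> mono_on {a..b} (\<lambda>x. - w x) \<or> antimono_on {a..b} g \<and> antimono_on {a..b} (\<lambda>x. - w x)"
        using anti w_mono by (auto simp: monotone_on_def mono_def)
      show "Inf (g ` {a..b}) \<le> - w x \<and> - w x \<le> Sup (g ` {a..b})" for x
        using w_bounds[of x] ge[of a] ge[of b] ab by (simp add: Inf Sup h_def)
      show "piecewise_constant_on a b (\<lambda>x. - w x)"
        using w_piecewise_constant unfolding piecewise_constant_on_def constant_on_def by metis
    qed
    ultimately show ?thesis
      using finite_atoms card_atoms by simp
  qed
qed

end
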